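(* Let $n\in\mathbb N$, $1<p<\infty$, $-\frac np<r<0$, $r+\varrho=-n$ and $1<q<\infty$, and let $\frac1p+\frac1{p'}=1$, $\frac1q+\frac1{q'}=1$. Then $H^{\varrho}L_{p'}(\ell_{q'},\mathbb R^n)$ is a predual space of $L^r_p(\ell_q,\mathbb R^n)$. More precisely, let $\alpha>n/p$, so that $L_{p'}(\ell_{q'},w_\alpha,\mathbb R^n)$ is continuously embedded in $H^{\varrho}L_{p'}(\ell_{q'},\mathbb R^n)$. Then $g\in\left(H^{\varrho}L_{p'}(\ell_{q'},\mathbb R^n)\right)'$ if, and only if, it can be uniquely represented as $$g(f)=\int_{\mathbb R^n}\sum_{j\in\mathbb N_0}g_j(x)f_j(x)\,dx\qquad\text{for all } f=\{f_j\}\in L_{p'}(\ell_{q'},w_\alpha,\mathbb R^n),$$ where $\{g_j\}\in L^r_p(\ell_q,\mathbb R^n)$ and $$\left\|g\,\middle|\,\left(H^{\varrho}L_{p'}(\ell_{q'},\mathbb R^n)\right)'\right\|=\left\|\{g_j\}\,|\,L^r_p(\ell_q,\mathbb R^n)\right\|.$$ Moreover, if $\{g_j\}\in L^r_p(\ell_q,\mathbb R^n)$, then $$\left\|\{g_j\}\,|\,L^r_p(\ell_q,\mathbb R^n)\right\|=\sup_f\left|\int_{\mathbb R^n}\sum_{j\in\mathbb N_0}g_j(x)f_j(x)\,dx\right|,$$ where the supremum is taken over all $f=\{f_j\}\in H^{\varrho}L_{p'}(\ell_{q'},\mathbb R^n)$ with $\|f\,|\,H^{\varrho}L_{p'}(\ell_{q'},\mathbb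 R^n)\|\le1$.
   Context: Functions are complex-valued; $X'$ denotes the topological dual of $X$. For $J\in\mathbb Z$, $M\in\mathbb Z^n$ put $Q_{J,M}=2^{-J}(M+[-1,1]^n)$. Morrey space: for $1<p<\infty$, $-\frac np\le r<0$, $L^r_p(\mathbb R^n)$ is the set of all $f\in L_p^{\rm loc}(\mathbb R^n)$ with $\|f|L^r_p(\mathbb R^n)\|=\sup_{J\in\mathbb Z,M\in\mathbb Z^n}2^{J(\frac np+r)}\|f|L_p(Q_{J,M})\|<\infty$. Predual Morrey space: for $1<p<\infty$, $-n<\varrho<-\frac np$, $H^\varrho L_p(\mathbb R^n)$ is the set of all $h\in S'(\mathbb R^n)$ which can be represented as $h=\sum_{J\in\mathbb Z,M\in\mathbb Z^n}\lambda_{J,M}a_{J,M}$ (convergence in $S'(\mathbb R^n)$) with $\operatorname{supp}a_{J,M}\subset Q_{J,M}$, $\|a_{J,M}|L_p(\mathbb R^n)\|\le2^{-J(\frac np+\varrho)}$ and $\sum_{J,M}|\lambda_{J,M}|<\infty$; its norm $\|h|H^\varrho L_p(\mathbb R^n)\|$ is the infimum of $\sum_{J,M}|\lambda_{J,M}|$ over all such representations. One has $H^\varrho L_p(\mathbb R^n)\subset L_u(\mathbb R^n)$ with $u=-n/\varrho$, so its elements are functions. (Here this is used with $p'$ in place of $p$; note that $r>-n/p$ and $r+\varrho=-n$ give $-n<\varrho<-n/p'$.) Vector-valued versions: $L^r_p(\ell_q,\mathbb R^n)$ is the set of all sequences $\{f_j\}_{j\in\mathbb N_0}$ in $L^r_p(\mathbb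 R^n)$ with $\|\{f_j\}|L^r_p(\ell_q,\mathbb R^n)\|=\big\|\big(\sum_{j\ge0}|f_j(\cdot)|^q\big)^{1/q}\big|L^r_p(\mathbb R^n)\big\|<\infty$. With $w_\alpha(x)=(1+|x|^2)^{\alpha/2}$, the space $L_p(\ell_q,w_\alpha,\mathbb R^n)$ is defined in the same way with the norm $\|w_\alpha f|L_p(\mathbb R^n)\|$ in place of $\|f|L^r_p(\mathbb R^n)\|$. $H^\varrho L_p(\ell_q,\mathbb R^n)$ is the set of all sequences $\{g_j\}_{j\in\mathbb N_0}$ in $H^\varrho L_p(\mathbb R^n)$ such that $\big(\sum_{j\ge0}|g_j(\cdot)|^q\big)^{1/q}\in H^\varrho L_p(\mathbb R^n)$, normed by the $H^\varrho L_p(\mathbb R^n)$-norm of this function. *)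

theory Defs
  imports "HOL-Analysis.Analysis"
begin

text \<open>
  The space \<open>\<real>\<^sup>n\<close> is \<open>real ^ 'n\<close> with \<open>n = CARD('n)\<close>. Elements of the function spaces are
  honest functions, not equivalence classes; identities between elements are therefore stated
  almost everywhere.
\<close>

definition Lp_on :: "(real^'n) set \<Rightarrow> real \<Rightarrow> (real^'n \<Rightarrow> complex) set" where
  "Lp_on S p = {f. f \<in> borel_measurable (lebesgue_on S) \<and>
                   integrable (lebesgue_on S) (\<lambda>x. cmod (f x) powr p)}"

definition Lp_norm_on :: "(real^'n) set \<Rightarrow> real \<Rightarrow> (real^'n \<Rightarrow> complex) \<Rightarrow> real" where
  "Lp_norm_on S p f = (\<integral>x. cmod (f x) powr p \<partial>(lebesgue_on S)) powr (1 / p)"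

definition Lp_loc :: "real \<Rightarrow> (real^'n \<Rightarrow> complex) set" where
  "Lp_loc p = {f. f \<in> borel_measurable lebesgue \<and> (\<forall>K. compact K \<longrightarrow> f \<in> Lp_on K p)}"

definition weight :: "real \<Rightarrow> real^'n \<Rightarrow> real" where
  "weight \<alpha> x = (1 + (norm x)\<^sup>2) powr (\<alpha> / 2)"

definition weighted_Lp :: "real \<Rightarrow> real \<Rightarrow> (real^'n \<Rightarrow> complex) set" where
  "weighted_Lp p \<alpha> = {f. (\<lambda>x. of_real (weight \<alpha> x) * f x) \<in> Lp_on UNIV p}"

definition weighted_Lp_norm :: "real \<Rightarrow> real \<Rightarrow> (real^'n \<Rightarrow> complex) \<Rightarrow> real" where
  "weighted_Lp_norm p \<alpha> f = Lp_norm_on UNIV p (\<lambda>x. of_real (weight \<alpha> x) * f x)"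

definition dyadic_cube :: "int \<Rightarrow> int^'n \<Rightarrow> (real^'n) set" where
  "dyadic_cube J M =
     (\<lambda>y. (2 powi (- J)) *\<^sub>R ((\<chi> i. of_int (M $ i)) + y)) ` {y. \<forall>i. - 1 \<le> y $ i \<and> y $ i \<le> 1}"

definition morrey_terms :: "real \<Rightarrow> real \<Rightarrow> (real^'n \<Rightarrow> complex) \<Rightarrow> real set" where
  "morrey_terms p r f =
     (\<lambda>(J, M). 2 powr (of_int J * (real CARD('n) / p + r)) * Lp_norm_on (dyadic_cube J M) p f)
       ` (UNIV :: (int \<times> (int^'n)) set)"

definition morrey :: "real \<Rightarrow> real \<Rightarrow> (real^'n \<Rightarrow> complex) set" where
  "morrey p r = {f. f \<in> Lp_loc p \<and> bdd_above (morrey_terms p r f)}"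

definition morrey_norm :: "real \<Rightarrow> real \<Rightarrow> (real^'n \<Rightarrow> complex) \<Rightarrow> real" where
  "morrey_norm p r f = Sup (morrey_terms p r f)"

definition partial_deriv :: "'n \<Rightarrow> (real^'n \<Rightarrow> complex) \<Rightarrow> real^'n \<Rightarrow> complex" where
  "partial_deriv i \<phi> x = frechet_derivative \<phi> (at x) (axis i 1)"

primrec iter_partial :: "'n list \<Rightarrow> (real^'n \<Rightarrow> complex) \<Rightarrow> real^'n \<Rightarrow> complex" where
  "iter_partial [] \<phi> = \<phi>"
| "iter_partial (i # is) \<phi> = partial_deriv i (iter_partial is \<phi>)"

definition schwartz :: "(real^'n \<Rightarrow> complex) set" where
  "schwartz = {\<phi>. \<forall>is. iter_partial is \<phi> differentiable_on UNIV \<and>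
                  (\<forall>N::nat. bounded (range (\<lambda>x. (1 + norm x) ^ N *\<^sub>R iter_partial is \<phi> x)))}"

definition schwartz_norm :: "nat \<Rightarrow> (real^'n \<Rightarrow> complex) \<Rightarrow> real" where
  "schwartz_norm N \<phi> = (SUP (is, x) \<in> {is. length is \<le> N} \<times> UNIV.
                          (1 + norm x) ^ N * cmod (iter_partial is \<phi> x))"

text \<open>
  A tempered distribution is a functional defined on all functions of which only the values on
  Schwartz functions are relevant.
\<close>

definition tempered :: "((real^'n \<Rightarrow> complex) \<Rightarrow> complex) set" where
  "tempered = {T. (\<forall>\<phi>\<in>schwartz. \<forall>\<psi>\<in>schwartz. T (\<lambda>x. \<phi> x + \<psi> x) = T \<phi> + T \<psi>) \<and>
                  (\<forall>c. \<forall>\<phi>\<in>schwartz. T (\<lambda>x. c * \<phi> x) = c * T \<phi>) \<and>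
                  (\<exists>N C. \<forall>\<phi>\<in>schwartz. cmod (T \<phi>) \<le> C * schwartz_norm N \<phi>)}"

definition regular_dist :: "(real^'n \<Rightarrow> complex) \<Rightarrow> (real^'n \<Rightarrow> complex) \<Rightarrow> complex" where
  "regular_dist f \<phi> = (\<integral>x. f x * \<phi> x \<partial>lebesgue)"

definition ess_supp :: "(real^'n \<Rightarrow> complex) \<Rightarrow> (real^'n) set" where
  "ess_supp f = - \<Union>{U. open U \<and> (AE x in lebesgue. x \<in> U \<longrightarrow> f x = 0)}"

definition atomic_rep :: "real \<Rightarrow> real \<Rightarrow> ((real^'n \<Rightarrow> complex) \<Rightarrow> complex) \<Rightarrow>
    (int \<times> (int^'n) \<Rightarrow> complex) \<Rightarrow> (int \<times> (int^'n) \<Rightarrow> real^'n \<Rightarrow> complex) \<Rightarrow> bool" where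
  "atomic_rep p \<rho> T lam a \<longleftrightarrow>
     (\<forall>J M. a (J, M) \<in> Lp_on UNIV p \<and> ess_supp (a (J, M)) \<subseteq> dyadic_cube J M \<and>
            Lp_norm_on UNIV p (a (J, M)) \<le> 2 powr (- of_int J * (real CARD('n) / p + \<rho>))) \<and>
     (\<lambda>k. cmod (lam k)) summable_on UNIV \<and>
     (\<forall>\<phi>\<in>schwartz. ((\<lambda>k. lam k * regular_dist (a k) \<phi>) has_sum T \<phi>) UNIV)"

definition predual_dist :: "real \<Rightarrow> real \<Rightarrow> ((real^'n \<Rightarrow> complex) \<Rightarrow> complex) set" where
  "predual_dist p \<rho> = {T \<in> tempered. \<exists>lam a. atomic_rep p \<rho> T lam a}"

definition predual_dist_norm ::
    "real \<Rightarrow> real \<Rightarrow> ((real^'n \<Rightarrow> complex) \<Rightarrow> complex) \<Rightarrow> real" where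
  "predual_dist_norm p \<rho> T =
     Inf {\<Sum>\<^sub>\<infinity>k. cmod (lam k) | lam. \<exists>a. atomic_rep p \<rho> T lam a}"

text \<open>
  Every element of \<open>predual_dist p \<rho>\<close> is the regular distribution of a function; the function
  space consists of these functions. The integrability condition says that \<open>regular_dist f\<close> is
  a genuine (absolutely convergent) integral on every test function, since the Bochner integral
  of a non-integrable function is \<open>0\<close> by convention.
\<close>

definition predual_morrey :: "real \<Rightarrow> real \<Rightarrow> (real^'n \<Rightarrow> complex) set" where
  "predual_morrey p \<rho> =
     {f. f \<in> borel_measurable lebesgue \<and>
         (\<forall>\<phi>\<in>schwartz. integrable lebesgue (\<lambda>x. f x * \<phi> x)) \<and>
         regular_dist f \<in> predual_dist p \<rho>}"

definition predual_morrey_norm :: "real \<Rightarrow> real \<Rightarrow> (real^'n \<Rightarrow> complex) \<Rightarrow> real" where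
  "predual_morrey_norm p \<rho> f = predual_dist_norm p \<rho> (regular_dist f)"

type_synonym 'n fun_seq = "nat \<Rightarrow> real^'n \<Rightarrow> complex"

definition lq_fun :: "real \<Rightarrow> 'n::finite fun_seq \<Rightarrow> real^'n \<Rightarrow> complex" where
  "lq_fun q f x = of_real ((\<Sum>j. cmod (f j x) powr q) powr (1 / q))"

definition seq_space :: "(real^'n::finite \<Rightarrow> complex) set \<Rightarrow> real \<Rightarrow> 'n fun_seq set" where
  "seq_space E q = {f. (\<forall>j. f j \<in> E) \<and>
                       (AE x in lebesgue. summable (\<lambda>j. cmod (f j x) powr q)) \<and>
                       lq_fun q f \<in> E}"

definition seq_norm :: "((real^'n::finite \<Rightarrow> complex) \<Rightarrow> real) \<Rightarrow> real \<Rightarrow> 'n fun_seq \<Rightarrow> real" where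
  "seq_norm N q f = N (lq_fun q f)"

abbreviation morrey_seq :: "real \<Rightarrow> real \<Rightarrow> real \<Rightarrow> 'n::finite fun_seq set" where
  "morrey_seq p r q \<equiv> seq_space (morrey p r) q"

abbreviation morrey_seq_norm :: "real \<Rightarrow> real \<Rightarrow> real \<Rightarrow> 'n::finite fun_seq \<Rightarrow> real" where
  "morrey_seq_norm p r q \<equiv> seq_norm (morrey_norm p r) q"

abbreviation predual_seq :: "real \<Rightarrow> real \<Rightarrow> real \<Rightarrow> 'n::finite fun_seq set" where
  "predual_seq p \<rho> q \<equiv> seq_space (predual_morrey p \<rho>) q"

abbreviation predual_seq_norm :: "real \<Rightarrow> real \<Rightarrow> real \<Rightarrow> 'n::finite fun_seq \<Rightarrow> real" where
  "predual_seq_norm p \<rho> q \<equiv> seq_norm (predual_morrey_norm p \<rho>) q"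

abbreviation weighted_seq :: "real \<Rightarrow> real \<Rightarrow> real \<Rightarrow> 'n::finite fun_seq set" where
  "weighted_seq p \<alpha> q \<equiv> seq_space (weighted_Lp p \<alpha>) q"

abbreviation weighted_seq_norm :: "real \<Rightarrow> real \<Rightarrow> real \<Rightarrow> 'n::finite fun_seq \<Rightarrow> real" where
  "weighted_seq_norm p \<alpha> q \<equiv> seq_norm (weighted_Lp_norm p \<alpha>) q"

definition seq_ae_eq :: "'n::finite fun_seq \<Rightarrow> 'n fun_seq \<Rightarrow> bool" where
  "seq_ae_eq f g \<longleftrightarrow> (\<forall>j. AE x in lebesgue. f j x = g j x)"

text \<open>
  \<open>normed_seq_space\<close> expresses that the quotient modulo almost everywhere equality is a normed
  complex vector space.
\<close>

definition normed_seq_space :: "'n::finite fun_seq set \<Rightarrow> ('n fun_seq \<Rightarrow> real) \<Rightarrow> bool" where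
  "normed_seq_space X N \<longleftrightarrow>
     (\<lambda>j x. 0) \<in> X \<and>
     (\<forall>f\<in>X. \<forall>g\<in>X. (\<lambda>j x. f j x + g j x) \<in> X \<and> N (\<lambda>j x. f j x + g j x) \<le> N f + N g) \<and>
     (\<forall>c. \<forall>f\<in>X. (\<lambda>j x. c * f j x) \<in> X \<and> N (\<lambda>j x. c * f j x) = cmod c * N f) \<and>
     (\<forall>f\<in>X. N f = 0 \<longleftrightarrow> seq_ae_eq f (\<lambda>j x. 0))"

text \<open>
  Only the values of a functional on the carrier are relevant. Boundedness makes it compatible
  with almost everywhere equality.
\<close>

definition seq_dual ::
    "'n::finite fun_seq set \<Rightarrow> ('n fun_seq \<Rightarrow> real) \<Rightarrow> ('n fun_seq \<Rightarrow> complex) set" where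
  "seq_dual X N = {G. (\<forall>f\<in>X. \<forall>g\<in>X. G (\<lambda>j x. f j x + g j x) = G f + G g) \<and>
                      (\<forall>c. \<forall>f\<in>X. G (\<lambda>j x. c * f j x) = c * G f) \<and>
                      (\<exists>C. \<forall>f\<in>X. cmod (G f) \<le> C * N f)}"

definition dual_norm ::
    "'n::finite fun_seq set \<Rightarrow> ('n fun_seq \<Rightarrow> real) \<Rightarrow> ('n fun_seq \<Rightarrow> complex) \<Rightarrow> real" where
  "dual_norm X N G = (SUP f \<in> {f \<in> X. N f \<le> 1}. cmod (G f))"

definition predual_space :: "'n::finite fun_seq set \<Rightarrow> ('n fun_seq \<Rightarrow> real) \<Rightarrow>
    'n fun_seq set \<Rightarrow> ('n fun_seq \<Rightarrow> real) \<Rightarrow> bool" where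
  "predual_space X NX Y NY \<longleftrightarrow>
     normed_seq_space X NX \<and> normed_seq_space Y NY \<and>
     (\<exists>\<Phi>. (\<forall>y\<in>Y. \<Phi> y \<in> seq_dual X NX \<and> dual_norm X NX (\<Phi> y) = NY y) \<and>
          (\<forall>y\<in>Y. \<forall>z\<in>Y. \<forall>f\<in>X. \<Phi> (\<lambda>j x. y j x + z j x) f = \<Phi> y f + \<Phi> z f) \<and>
          (\<forall>c. \<forall>y\<in>Y. \<forall>f\<in>X. \<Phi> (\<lambda>j x. c * y j x) f = c * \<Phi> y f) \<and>
          (\<forall>G\<in>seq_dual X NX. \<exists>y\<in>Y. \<forall>f\<in>X. \<Phi> y f = G f))"

definition pairing_exists :: "'n::finite fun_seq \<Rightarrow> 'n fun_seq \<Rightarrow> bool" where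
  "pairing_exists g f \<longleftrightarrow> (AE x in lebesgue. summable (\<lambda>j. g j x * f j x)) \<and>
                          integrable lebesgue (\<lambda>x. \<Sum>j. g j x * f j x)"

definition pairing :: "'n::finite fun_seq \<Rightarrow> 'n fun_seq \<Rightarrow> complex" where
  "pairing g f = (\<integral>x. (\<Sum>j. g j x * f j x) \<partial>lebesgue)"

definition represented_by ::
    "'n::finite fun_seq set \<Rightarrow> ('n fun_seq \<Rightarrow> complex) \<Rightarrow> 'n fun_seq \<Rightarrow> bool" where
  "represented_by D G g \<longleftrightarrow> (\<forall>f\<in>D. pairing_exists g f \<and> G f = pairing g f)"

end

theory Submission
  imports Defs
begin

text \<open>
  A function lies in the predual Morrey space iff its modulus has a majorant \<open>\<Sum>i. b i\<close> with \<open>b i\<close>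
  supported in the \<open>i\<close>-th dyadic cube and \<open>L\<^sub>p\<^sub>'\<close>-norm at most \<open>\<kappa> i * t i\<close>, and its norm is the infimum
  of \<open>\<Sum>i. t i\<close>. Indeed \<open>f\<close> is the sum of \<open>f * b i / (\<Sum>k. b k)\<close>, and conversely an atomic series
  which converges to \<open>f\<close> in the sense of distributions converges to \<open>f\<close> almost everywhere, as testing
  with smooth approximations of indicators of boxes shows. So the norm is a lattice norm, it is
  order continuous, and Hoelder's inequality on each cube pairs the space with the Morrey space.
  Given a bounded functional \<open>G\<close> and a strictly positive, rapidly decreasing weight \<open>v\<close>, the set
  function which maps \<open>A\<close> to the value of \<open>G\<close> at the sequence with \<open>j\<close>-th component \<open>indicator A * v\<close>
  and all others zero is, by order continuity, an absolutely continuous complex measure. Its density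
  is \<open>g j * v\<close>. Testing with truncations of the extremal functions of the \<open>L\<^sub>p(\<ell>\<^sub>q)\<close> duality bounds
  the Morrey norm of \<open>g\<close> by the norm of \<open>G\<close>. Order continuity also yields that such truncated
  sequences are dense, which extends the representation from them to all sequences.
\<close>

section \<open>Integral inequalities\<close>

text \<open>The obstacle is that the predual is defined by distributions and by infima over signed
  atomic series, where neither monotonicity nor limits are visible. Majorants exhibit both, and the
  duality no longer depends on dyadic geometry: it is proved for any sequence of sets
  \<open>Q i\<close> with constants \<open>\<kappa> i\<close>, used here with
  \<open>2 powr (J * (n / p + r))\<close>, which by \<open>r + \<rho> = - n\<close> is the atom
  bound \<open>2 powr (- J * (n / p' + \<rho>))\<close>. The weight \<open>v\<close> must be small
  enough to have finite block norm, so that the set functions are finite on all measurable sets, and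
  large enough to dominate Schwartz functions. It is the weight with exponent
  \<open>- (\<alpha> + n + 1)\<close>: the part \<open>\<alpha>\<close> cancels the weight of the
  embedded space, the rest leaves an integrable power. Sequences with finitely many components, all
  dominated by a multiple of \<open>v\<close>, lie in every space involved, so a single density
  argument covers both the extension from the weighted space and uniqueness.\<close>

lemma conjugate_exponent_gt_1:
  fixes p p' :: real
  assumes "1 < p" "1 / p + 1 / p' = 1"
  shows "1 < p'"
proof -
  have "1 / p < 1" "0 < 1 / p"
    using assms by auto
  then have "0 < 1 / p'" "1 / p' < 1"
    using assms(2) by linarith+
  then show ?thesis
    by (simp add: divide_less_eq split: if_splits)
qed

lemma conjugate_exponent_eq:
  fixes p p' :: real
  assumes "1 < p" "1 / p + 1 / p' = 1"
  shows "(p - 1) * p' = p"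
  using assms conjugate_exponent_gt_1[OF assms] by (simp add: field_simps)

lemma powr_powr_cancel:
  fixes x p :: real
  assumes "0 \<le> x" "p \<noteq> 0"
  shows "(x powr (1 / p)) powr p = x" "(x powr p) powr (1 / p) = x"
  using assms by (auto simp: powr_powr)

text \<open>Serves the degenerate cases of the inequalities below, in which a bound is zero and one
  cannot normalise by it.\<close>

lemma nn_integral_powr_eq_0:
  fixes f :: "'a \<Rightarrow> real"
  assumes [measurable]: "f \<in> borel_measurable M"
    and "(\<integral>\<^sup>+x. ennreal (f x powr p) \<partial>M) \<le> 0"
  shows "AE x in M. f x = 0"
proof -
  have "(\<integral>\<^sup>+x. ennreal (f x powr p) \<partial>M) = 0"
    using assms(2) by simp
  then have "AE x in M. ennreal (f x powr p) = 0"
    by (subst (asm) nn_integral_0_iff_AE) auto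
  then show ?thesis
    by eventually_elim (auto simp: ennreal_eq_0_iff dest: order_antisym[OF _ powr_ge_zero])
qed

text \<open>Stated with arbitrary bounds \<open>A\<close> and \<open>B\<close> in place of norms, so
  that infinite integrals never occur and the same statement serves Lebesgue measure and counting
  measure.\<close>

lemma nn_integral_Hoelder:
  fixes f g :: "'a \<Rightarrow> real" and A B p p' :: real
  assumes [measurable]: "f \<in> borel_measurable M" "g \<in> borel_measurable M"
    and p: "1 < p" "1 / p + 1 / p' = 1"
    and nn: "\<And>x. 0 \<le> f x" "\<And>x. 0 \<le> g x" "0 \<le> A" "0 \<le> B"
    and f: "(\<integral>\<^sup>+x. ennreal (f x powr p) \<partial>M) \<le> ennreal (A powr p)"
    and g: "(\<integral>\<^sup>+x. ennreal (g x powr p') \<partial>M) \<le> ennreal (B powr p')"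
  shows "(\<integral>\<^sup>+x. ennreal (f x * g x) \<partial>M) \<le> ennreal (A * B)"
proof (cases "A = 0 \<or> B = 0")
  case True
  have "AE x in M. f x * g x = 0"
  proof (cases "A = 0")
    case True
    have "AE x in M. f x = 0"
      by (rule nn_integral_powr_eq_0[of _ _ p]) (use True f in auto)
    then show ?thesis by eventually_elim auto
  next
    case False
    have "AE x in M. g x = 0"
      by (rule nn_integral_powr_eq_0[of _ _ p']) (use False True g in auto)
    then show ?thesis by eventually_elim auto
  qed
  then have "(\<integral>\<^sup>+x. ennreal (f x * g x) \<partial>M) = (\<integral>\<^sup>+x. 0 \<partial>M)"
    by (intro nn_integral_cong_AE) auto
  then show ?thesis by simp
next
  case False
  then have AB: "A > 0" "B > 0" using nn by auto
  note p' = conjugate_exponent_gt_1[OF p]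
  \<comment> \<open>Young's inequality for \<open>f x / A\<close> and \<open>g x / B\<close>,
    multiplied by \<open>A * B\<close>. After integration the two terms contribute at most
    \<open>A * B / p\<close> and \<open>A * B / p'\<close>.\<close>
  have *: "f x * g x \<le> (A * B / (p * A powr p)) * f x powr p + (A * B / (p' * B powr p')) * g x powr p'" for x
  proof -
    have "(f x / A) * (g x / B) \<le> (f x / A) powr p / p + (g x / B) powr p' / p'"
      by (rule Youngs_inequality) (use p p' nn AB in auto)
    then have "A * B * ((f x / A) * (g x / B)) \<le> A * B * ((f x / A) powr p / p + (g x / B) powr p' / p')"
      using AB by (intro mult_left_mono) auto
    moreover have "A * B * ((f x / A) * (g x / B)) = f x * g x"
      using AB by simp
    moreover have "A * B * ((f x / A) powr p / p + (g x / B) powr p' / p') =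
        (A * B / (p * A powr p)) * f x powr p + (A * B / (p' * B powr p')) * g x powr p'"
      using AB nn by (simp add: powr_divide field_simps)
    ultimately show ?thesis by simp
  qed
  have "(\<integral>\<^sup>+x. ennreal (f x * g x) \<partial>M) \<le>
      (\<integral>\<^sup>+x. ennreal (A * B / (p * A powr p)) * ennreal (f x powr p)
             + ennreal (A * B / (p' * B powr p')) * ennreal (g x powr p') \<partial>M)"
    using * AB p p'
    by (intro nn_integral_mono) (auto simp flip: ennreal_mult ennreal_plus intro!: ennreal_leI)
  also have "\<dots> = ennreal (A * B / (p * A powr p)) * (\<integral>\<^sup>+x. ennreal (f x powr p) \<partial>M)
             + ennreal (A * B / (p' * B powr p')) * (\<integral>\<^sup>+x. ennreal (g x powr p') \<partial>M)"
    by (subst nn_integral_add) (auto simp: nn_integral_cmult)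
  also have "\<dots> \<le> ennreal (A * B / (p * A powr p)) * ennreal (A powr p)
             + ennreal (A * B / (p' * B powr p')) * ennreal (B powr p')"
    by (intro add_mono mult_left_mono f g) auto
  also have "\<dots> = ennreal (A * B / (p * A powr p) * A powr p + A * B / (p' * B powr p') * B powr p')"
    using AB p p' by (simp flip: ennreal_mult ennreal_plus)
  also have "A * B / (p * A powr p) * A powr p + A * B / (p' * B powr p') * B powr p' = A * B * (1 / p + 1 / p')"
    using AB by (simp add: field_simps)
  finally show ?thesis using p by simp
qed

text \<open>Zero arguments are treated apart because convexity of the power is invoked for positive
  ones; there the claim reduces to \<open>w powr p \<le> w\<close> for \<open>w\<close> in the unit
  interval.\<close>

lemma powr_convex_ineq:
  fixes x y u v p :: real
  assumes "1 \<le> p" "0 \<le> x" "0 \<le> y" "0 \<le> u" "0 \<le> v" "u + v = 1"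
  shows "(u * x + v * y) powr p \<le> u * x powr p + v * y powr p"
proof -
  have *: "(w * z) powr p \<le> w * z powr p" if "0 \<le> w" "w \<le> 1" "0 \<le> z" for w z :: real
  proof -
    have "w powr p \<le> w"
    proof (cases "w = 0")
      case False
      have "w powr p \<le> w powr 1"
        using that assms False by (intro powr_mono') auto
      then show ?thesis using that False by simp
    qed simp
    then show ?thesis
      using that by (simp add: powr_mult mult_right_mono)
  qed
  show ?thesis
  proof (cases "x = 0 \<or> y = 0")
    case True
    then show ?thesis using *[of u x] *[of v y] assms by auto
  next
    case False
    then show ?thesis
      using powr_convex[OF assms(1)] assms unfolding convex_on_def by auto
  qed
qed

lemma nn_integral_Minkowski:
  fixes f g :: "'a \<Rightarrow> real" and A B p :: real
  assumes [measurable]: "f \<in> borel_measurable M" "g \<in> borel_measurable M"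
    and p: "1 \<le> p"
    and nn: "\<And>x. 0 \<le> f x" "\<And>x. 0 \<le> g x" "0 \<le> A" "0 \<le> B"
    and f: "(\<integral>\<^sup>+x. ennreal (f x powr p) \<partial>M) \<le> ennreal (A powr p)"
    and g: "(\<integral>\<^sup>+x. ennreal (g x powr p) \<partial>M) \<le> ennreal (B powr p)"
  shows "(\<integral>\<^sup>+x. ennreal ((f x + g x) powr p) \<partial>M) \<le> ennreal ((A + B) powr p)"
proof -
  consider "A = 0" | "B = 0" | "A > 0" "B > 0" using nn by fastforce
  then show ?thesis
  proof cases
    case 1
    have "AE x in M. f x = 0"
      by (rule nn_integral_powr_eq_0[of _ _ p]) (use 1 f in auto)
    then have "(\<integral>\<^sup>+x. ennreal ((f x + g x) powr p) \<partial>M) = (\<integral>\<^sup>+x. ennreal (g x powr p) \<partial>M)"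
      by (intro nn_integral_cong_AE) auto
    then show ?thesis using g 1 by simp
  next
    case 2
    have "AE x in M. g x = 0"
      by (rule nn_integral_powr_eq_0[of _ _ p]) (use 2 g in auto)
    then have "(\<integral>\<^sup>+x. ennreal ((f x + g x) powr p) \<partial>M) = (\<integral>\<^sup>+x. ennreal (f x powr p) \<partial>M)"
      by (intro nn_integral_cong_AE) auto
    then show ?thesis using f 2 by simp
  next
    case 3
    \<comment> \<open>Convexity is applied with weights \<open>A / S\<close> and
      \<open>B / S\<close> at the normalised functions; \<open>u\<close> and \<open>w\<close> are
      the factors left after multiplying back by \<open>S powr p\<close>, and they make the two
      terms add up to \<open>S powr p * ((A + B) / S)\<close>.\<close>
    define S where "S = A + B"
    define u where "u = S powr p * (A / S) / A powr p"
    define w where "w = S powr p * (B / S) / B powr p"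
    have S: "S > 0" and uw: "0 \<le> u" "0 \<le> w" using 3 by (auto simp: S_def u_def w_def)
    have *: "(f x + g x) powr p \<le> u * f x powr p + w * g x powr p" for x
    proof -
      have "((A/S) * (f x / A) + (B/S) * (g x / B)) powr p
          \<le> (A/S) * (f x / A) powr p + (B/S) * (g x / B) powr p"
        by (rule powr_convex_ineq) (use p nn 3 S in \<open>auto simp: S_def simp flip: add_divide_distrib\<close>)
      moreover have "(A/S) * (f x / A) + (B/S) * (g x / B) = (f x + g x) / S"
        using 3 by (simp add: add_divide_distrib)
      ultimately have "((f x + g x) / S) powr p
          \<le> (A/S) * (f x / A) powr p + (B/S) * (g x / B) powr p" by simp
      then have "S powr p * ((f x + g x) / S) powr p
          \<le> S powr p * ((A/S) * (f x / A) powr p + (B/S) * (g x / B) powr p)"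
        by (intro mult_left_mono) auto
      moreover have "S powr p * ((f x + g x) / S) powr p = (f x + g x) powr p"
        using S nn by (simp add: powr_divide)
      moreover have "S powr p * ((A/S) * (f x / A) powr p + (B/S) * (g x / B) powr p)
          = u * f x powr p + w * g x powr p"
        using S nn 3 by (simp add: powr_divide u_def w_def field_simps)
      ultimately show ?thesis by simp
    qed
    have "(\<integral>\<^sup>+x. ennreal ((f x + g x) powr p) \<partial>M) \<le>
      (\<integral>\<^sup>+x. ennreal u * ennreal (f x powr p) + ennreal w * ennreal (g x powr p) \<partial>M)"
      using * uw by (intro nn_integral_mono) (auto simp flip: ennreal_mult ennreal_plus intro!: ennreal_leI)
    also have "\<dots> = ennreal u * (\<integral>\<^sup>+x. ennreal (f x powr p) \<partial>M) + ennreal w * (\<integral>\<^sup>+x. ennreal (g x powr p) \<partial>M)"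
      by (subst nn_integral_add) (auto simp: nn_integral_cmult)
    also have "\<dots> \<le> ennreal u * ennreal (A powr p) + ennreal w * ennreal (B powr p)"
      by (intro add_mono mult_left_mono f g) auto
    also have "\<dots> = ennreal (u * A powr p + w * B powr p)"
      using uw by (simp flip: ennreal_mult ennreal_plus)
    also have "u * A powr p + w * B powr p = S powr p * ((A + B) / S)"
      using 3 S by (simp add: u_def w_def field_simps)
    finally show ?thesis using S by (simp add: S_def)
  qed
qed

text \<open>The integral inequality over the counting measure of the naturals, where the integral is
  a series.\<close>

lemma suminf_Hoelder:
  fixes a b :: "nat \<Rightarrow> real"
  assumes p: "1 < p" "1 / p + 1 / p' = 1"
    and nn: "\<And>j. 0 \<le> a j" "\<And>j. 0 \<le> b j"
    and a: "summable (\<lambda>j. a j powr p)" and b: "summable (\<lambda>j. b j powr p')"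
  shows "summable (\<lambda>j. a j * b j)"
    and "(\<Sum>j. a j * b j) \<le> (\<Sum>j. a j powr p) powr (1/p) * (\<Sum>j. b j powr p') powr (1/p')"
proof -
  define A B where "A = (\<Sum>j. a j powr p) powr (1/p)" and "B = (\<Sum>j. b j powr p') powr (1/p')"
  have A: "A powr p = (\<Sum>j. a j powr p)" and B: "B powr p' = (\<Sum>j. b j powr p')"
    unfolding A_def B_def using p conjugate_exponent_gt_1[OF p] a b
    by (auto intro!: powr_powr_cancel(1) suminf_nonneg)
  have "(\<integral>\<^sup>+j. ennreal (a j * b j) \<partial>count_space UNIV) \<le> ennreal (A * B)"
  proof (rule nn_integral_Hoelder[OF _ _ p])
    show "(\<integral>\<^sup>+j. ennreal (a j powr p) \<partial>count_space UNIV) \<le> ennreal (A powr p)"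
      unfolding A nn_integral_count_space_nat using a by (simp add: suminf_ennreal2)
    show "(\<integral>\<^sup>+j. ennreal (b j powr p') \<partial>count_space UNIV) \<le> ennreal (B powr p')"
      unfolding B nn_integral_count_space_nat using b by (simp add: suminf_ennreal2)
  qed (use nn in \<open>auto simp: A_def B_def\<close>)
  then have *: "(\<Sum>j. ennreal (a j * b j)) \<le> ennreal (A * B)"
    by (simp add: nn_integral_count_space_nat)
  show s: "summable (\<lambda>j. a j * b j)"
    by (rule summable_suminf_not_top) (use nn * in \<open>auto simp: top_unique\<close>)
  have "ennreal (\<Sum>j. a j * b j) \<le> ennreal (A * B)"
    using * s nn by (simp add: suminf_ennreal2)
  then show "(\<Sum>j. a j * b j) \<le> (\<Sum>j. a j powr p) powr (1/p) * (\<Sum>j. b j powr p') powr (1/p')"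
    by (simp add: A_def B_def)
qed

lemma suminf_Minkowski:
  fixes a b :: "nat \<Rightarrow> real"
  assumes p: "1 \<le> p" and nn: "\<And>j. 0 \<le> a j" "\<And>j. 0 \<le> b j"
    and a: "summable (\<lambda>j. a j powr p)" and b: "summable (\<lambda>j. b j powr p)"
  shows "summable (\<lambda>j. (a j + b j) powr p)"
    and "(\<Sum>j. (a j + b j) powr p) powr (1/p) \<le> (\<Sum>j. a j powr p) powr (1/p) + (\<Sum>j. b j powr p) powr (1/p)"
proof -
  define A B where "A = (\<Sum>j. a j powr p) powr (1/p)" and "B = (\<Sum>j. b j powr p) powr (1/p)"
  have A: "A powr p = (\<Sum>j. a j powr p)" and B: "B powr p = (\<Sum>j. b j powr p)"
    unfolding A_def B_def using p a b
    by (auto intro!: powr_powr_cancel(1) suminf_nonneg)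
  have "(\<integral>\<^sup>+j. ennreal ((a j + b j) powr p) \<partial>count_space UNIV) \<le> ennreal ((A + B) powr p)"
  proof (rule nn_integral_Minkowski[OF _ _ p])
    show "(\<integral>\<^sup>+j. ennreal (a j powr p) \<partial>count_space UNIV) \<le> ennreal (A powr p)"
      unfolding A nn_integral_count_space_nat using a by (simp add: suminf_ennreal2)
    show "(\<integral>\<^sup>+j. ennreal (b j powr p) \<partial>count_space UNIV) \<le> ennreal (B powr p)"
      unfolding B nn_integral_count_space_nat using b by (simp add: suminf_ennreal2)
  qed (use nn in \<open>auto simp: A_def B_def\<close>)
  then have *: "(\<Sum>j. ennreal ((a j + b j) powr p)) \<le> ennreal ((A + B) powr p)"
    by (simp add: nn_integral_count_space_nat)
  show s: "summable (\<lambda>j. (a j + b j) powr p)"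
    by (rule summable_suminf_not_top) (use * in \<open>auto simp: top_unique\<close>)
  have "ennreal (\<Sum>j. (a j + b j) powr p) \<le> ennreal ((A + B) powr p)"
    using * s by (simp add: suminf_ennreal2)
  then have "(\<Sum>j. (a j + b j) powr p) \<le> (A + B) powr p"
    by simp
  then have "(\<Sum>j. (a j + b j) powr p) powr (1/p) \<le> ((A + B) powr p) powr (1/p)"
    using p s by (intro powr_mono2) (auto intro: suminf_nonneg)
  then show "(\<Sum>j. (a j + b j) powr p) powr (1/p) \<le> (\<Sum>j. a j powr p) powr (1/p) + (\<Sum>j. b j powr p) powr (1/p)"
    using p by (simp add: powr_powr_cancel A_def B_def)
qed

section \<open>Densities of set functions\<close>

text \<open>Finite additivity together with continuity at the empty set gives a finite measure, to
  which Radon-Nikodym applies. The set function \<open>\<tau>\<close> carries the control: it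
  transfers continuity and null sets to \<open>\<mu>\<close>, so that a single \<open>\<tau>\<close>
  built from a norm can serve several set functions.\<close>

lemma (in sigma_finite_measure) nonneg_set_function_density:
  fixes \<mu> \<tau> :: "'a set \<Rightarrow> real"
  assumes add: "\<And>A B. A \<in> sets M \<Longrightarrow> B \<in> sets M \<Longrightarrow> A \<inter> B = {} \<Longrightarrow> \<mu> (A \<union> B) = \<mu> A + \<mu> B"
    and nonneg: "\<And>A. A \<in> sets M \<Longrightarrow> 0 \<le> \<mu> A"
    and bound: "\<And>A. A \<in> sets M \<Longrightarrow> \<mu> A \<le> \<tau> A"
    and null: "\<And>A. A \<in> null_sets M \<Longrightarrow> \<tau> A = 0"
    and cont: "\<And>A. range A \<subseteq> sets M \<Longrightarrow> decseq A \<Longrightarrow> (\<Inter>i. A i) = {} \<Longrightarrow> (\<lambda>i. \<tau> (A i)) \<longlonglongrightarrow> 0"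
  shows "\<exists>h. integrable M h \<and> (\<forall>A\<in>sets M. \<mu> A = (\<integral>x. indicator A x * h x \<partial>M))"
proof -
  have pos: "positive (sets M) (\<lambda>A. ennreal (\<mu> A))"
    using add[of "{}" "{}"] by (simp add: positive_def)
  have ca: "countably_additive (sets M) (\<lambda>A. ennreal (\<mu> A))"
  proof (rule sets.empty_continuous_imp_countably_additive[OF pos])
    show "additive (sets M) (\<lambda>A. ennreal (\<mu> A))"
      using add nonneg by (auto simp: additive_def)
    fix A :: "nat \<Rightarrow> 'a set" assume A: "range A \<subseteq> sets M" "decseq A" "(\<Inter>i. A i) = {}"
    have "(\<lambda>i. \<mu> (A i)) \<longlonglongrightarrow> 0"
      by (rule tendsto_sandwich[OF _ _ tendsto_const cont[OF A]]) (use A nonneg bound in auto)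
    then show "(\<lambda>i. ennreal (\<mu> (A i))) \<longlonglongrightarrow> 0"
      using tendsto_ennrealI by fastforce
  qed auto
  define N where "N = measure_of (space M) (sets M) (\<lambda>A. ennreal (\<mu> A))"
  have sN[simp]: "sets N = sets M" by (simp add: N_def)
  have eN: "emeasure N A = ennreal (\<mu> A)" if "A \<in> sets M" for A
    unfolding N_def by (rule emeasure_measure_of_sigma[OF sets.sigma_algebra_axioms pos ca that])
  have ac: "absolutely_continuous M N"
    unfolding absolutely_continuous_def
  proof
    fix A assume A: "A \<in> null_sets M"
    then have "A \<in> sets M" by auto
    moreover have "\<mu> A \<le> 0" using bound null A by fastforce
    ultimately show "A \<in> null_sets N"
      using eN by (auto simp: null_sets_def ennreal_eq_0_iff)
  qed
  obtain f where [measurable]: "f \<in> borel_measurable M" and f: "density M f = N"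
    using Radon_Nikodym[OF ac sN] by auto
  have fA: "(\<integral>\<^sup>+x. f x * indicator A x \<partial>M) = ennreal (\<mu> A)" if "A \<in> sets M" for A
    using that eN[OF that] emeasure_density[of f M A] f by simp
  have "(\<integral>\<^sup>+x. f x \<partial>M) = (\<integral>\<^sup>+x. f x * indicator (space M) x \<partial>M)"
    by (intro nn_integral_cong) auto
  \<comment> \<open>\<open>\<mu>\<close> is real-valued on the whole space, hence the density has
    finite integral.\<close>
  then have fin: "(\<integral>\<^sup>+x. f x \<partial>M) < \<infinity>"
    using fA[of "space M"] by simp
  then have "AE x in M. f x \<noteq> \<infinity>"
    by (intro nn_integral_noteq_infinite) auto
  then have ae: "AE x in M. ennreal (enn2real (f x)) = f x"
    by eventually_elim (simp add: less_top)
  have "(\<integral>\<^sup>+x. ennreal (enn2real (f x)) \<partial>M) = (\<integral>\<^sup>+x. f x \<partial>M)"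
    by (rule nn_integral_cong_AE[OF ae])
  then have int: "integrable M (\<lambda>x. enn2real (f x))"
    using fin by (intro integrableI_nonneg) auto
  show ?thesis
  proof (intro exI conjI ballI)
    show "integrable M (\<lambda>x. enn2real (f x))" by fact
    fix A assume A[measurable]: "A \<in> sets M"
    have "(\<integral>x. indicator A x * enn2real (f x) \<partial>M)
        = enn2real (\<integral>\<^sup>+x. ennreal (indicator A x * enn2real (f x)) \<partial>M)"
      by (rule integral_eq_nn_integral) auto
    also have "(\<integral>\<^sup>+x. ennreal (indicator A x * enn2real (f x)) \<partial>M) = (\<integral>\<^sup>+x. f x * indicator A x \<partial>M)"
      by (rule nn_integral_cong_AE) (use ae in \<open>eventually_elim, auto simp: indicator_def\<close>)
    finally show "\<mu> A = (\<integral>x. indicator A x * enn2real (f x) \<partial>M)"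
      using fA[OF A] nonneg[OF A] by simp
  qed
qed

text \<open>Jordan decomposition: \<open>\<mu> A\<close>, the supremum of \<open>\<nu>\<close> over
  measurable subsets of \<open>A\<close>, is the positive variation, and \<open>\<mu>\<close> and
  \<open>\<mu> - \<nu>\<close> are nonnegative, additive and dominated by \<open>\<tau>\<close> and
  \<open>2 * \<tau>\<close>. Monotonicity of \<open>\<tau>\<close> keeps the supremum finite and
  below \<open>\<tau> A\<close>.\<close>

lemma (in sigma_finite_measure) signed_set_function_density:
  fixes \<nu> \<tau> :: "'a set \<Rightarrow> real"
  assumes add: "\<And>A B. A \<in> sets M \<Longrightarrow> B \<in> sets M \<Longrightarrow> A \<inter> B = {} \<Longrightarrow> \<nu> (A \<union> B) = \<nu> A + \<nu> B"
    and bound: "\<And>A. A \<in> sets M \<Longrightarrow> \<bar>\<nu> A\<bar> \<le> \<tau> A"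
    and mono: "\<And>A B. A \<in> sets M \<Longrightarrow> B \<in> sets M \<Longrightarrow> A \<subseteq> B \<Longrightarrow> \<tau> A \<le> \<tau> B"
    and null: "\<And>A. A \<in> null_sets M \<Longrightarrow> \<tau> A = 0"
    and cont: "\<And>A. range A \<subseteq> sets M \<Longrightarrow> decseq A \<Longrightarrow> (\<Inter>i. A i) = {} \<Longrightarrow> (\<lambda>i. \<tau> (A i)) \<longlonglongrightarrow> 0"
  shows "\<exists>h. integrable M h \<and> (\<forall>A\<in>sets M. \<nu> A = (\<integral>x. indicator A x * h x \<partial>M))"
proof -
  define P where "P A = {\<nu> B |B. B \<in> sets M \<and> B \<subseteq> A}" for A
  have n0: "\<nu> {} = 0" using add[of "{}" "{}"] by simp
  have up: "x \<le> \<tau> A" if x: "x \<in> P A" and A: "A \<in> sets M" for x A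
  proof -
    obtain B where B: "x = \<nu> B" "B \<in> sets M" "B \<subseteq> A" using x by (auto simp: P_def)
    then show ?thesis using bound[of B] mono[of B A] A by linarith
  qed
  then have bdd: "bdd_above (P A)" if "A \<in> sets M" for A
    using that by (auto simp: bdd_above_def)
  have P0: "0 \<in> P A" for A using n0 by (auto simp: P_def intro!: exI[of _ "{}"])
  define \<mu> where "\<mu> A = Sup (P A)" for A
  have \<mu>_ge: "\<nu> B \<le> \<mu> A" if "A \<in> sets M" "B \<in> sets M" "B \<subseteq> A" for A B
    unfolding \<mu>_def by (rule cSup_upper) (use that bdd in \<open>auto simp: P_def\<close>)
  have \<mu>_nn: "0 \<le> \<mu> A" if "A \<in> sets M" for A
    unfolding \<mu>_def by (rule cSup_upper) (use that bdd P0 in auto)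
  have \<mu>_le: "\<mu> A \<le> \<tau> A" if "A \<in> sets M" for A
    unfolding \<mu>_def by (rule cSup_least) (use that P0 up in auto)
  have \<mu>_add: "\<mu> (A \<union> B) = \<mu> A + \<mu> B" if AB: "A \<in> sets M" "B \<in> sets M" "A \<inter> B = {}" for A B
  proof (rule antisym)
    show "\<mu> (A \<union> B) \<le> \<mu> A + \<mu> B"
      unfolding \<mu>_def[of "A \<union> B"]
    proof (rule cSup_least)
      fix x assume "x \<in> P (A \<union> B)"
      then obtain C where C: "x = \<nu> C" "C \<in> sets M" "C \<subseteq> A \<union> B" by (auto simp: P_def)
      have "\<nu> ((C \<inter> A) \<union> (C \<inter> B)) = \<nu> (C \<inter> A) + \<nu> (C \<inter> B)"
        by (rule add) (use C AB in auto)
      moreover have "(C \<inter> A) \<union> (C \<inter> B) = C" using C by auto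
      moreover have "\<nu> (C \<inter> A) \<le> \<mu> A" "\<nu> (C \<inter> B) \<le> \<mu> B"
        using C AB by (auto intro!: \<mu>_ge)
      ultimately show "x \<le> \<mu> A + \<mu> B" using C by simp
    qed (use P0 in auto)
    \<comment> \<open>Two nested least-upper-bound arguments: any \<open>C\<close> in
      \<open>A\<close> and \<open>D\<close> in \<open>B\<close> are disjoint, so
      \<open>\<nu> C + \<nu> D\<close> is one of the values whose supremum is
      \<open>\<mu> (A \<union> B)\<close>.\<close>
    have "\<mu> A \<le> \<mu> (A \<union> B) - \<mu> B"
      unfolding \<mu>_def[of A]
    proof (rule cSup_least)
      fix x assume "x \<in> P A"
      then obtain C where C: "x = \<nu> C" "C \<in> sets M" "C \<subseteq> A" by (auto simp: P_def)
      have "\<mu> B \<le> \<mu> (A \<union> B) - x"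
        unfolding \<mu>_def[of B]
      proof (rule cSup_least)
        fix y assume "y \<in> P B"
        then obtain D where D: "y = \<nu> D" "D \<in> sets M" "D \<subseteq> B" by (auto simp: P_def)
        have "\<nu> (C \<union> D) = x + y" using add[of C D] C D AB by auto
        moreover have "\<nu> (C \<union> D) \<le> \<mu> (A \<union> B)"
          by (rule \<mu>_ge) (use C D AB in auto)
        ultimately show "y \<le> \<mu> (A \<union> B) - x" by simp
      qed (use P0 in auto)
      then show "x \<le> \<mu> (A \<union> B) - \<mu> B" by simp
    qed (use P0 in auto)
    then show "\<mu> A + \<mu> B \<le> \<mu> (A \<union> B)" by simp
  qed
  have "\<exists>h. integrable M h \<and> (\<forall>A\<in>sets M. \<mu> A = (\<integral>x. indicator A x * h x \<partial>M))"
    by (rule nonneg_set_function_density[of \<mu> \<tau>]) (fact \<mu>_add \<mu>_nn \<mu>_le null cont)+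
  then obtain h1 where h1: "integrable M h1" "\<And>A. A \<in> sets M \<Longrightarrow> \<mu> A = (\<integral>x. indicator A x * h1 x \<partial>M)"
    by blast
  have "\<exists>h. integrable M h \<and> (\<forall>A\<in>sets M. \<mu> A - \<nu> A = (\<integral>x. indicator A x * h x \<partial>M))"
  proof (rule nonneg_set_function_density[where \<tau> = "\<lambda>A. 2 * \<tau> A"])
    show "0 \<le> \<mu> A - \<nu> A" if "A \<in> sets M" for A using \<mu>_ge[of A A] that by simp
    show "\<mu> A - \<nu> A \<le> 2 * \<tau> A" if "A \<in> sets M" for A
      using \<mu>_le[OF that] bound[OF that] by linarith
    show "(\<lambda>i. 2 * \<tau> (A i)) \<longlonglongrightarrow> 0" if "range A \<subseteq> sets M" "decseq A" "(\<Inter>i. A i) = {}" for A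
      using tendsto_mult_left[OF cont[OF that], of 2] by simp
  qed (use \<mu>_add add null in auto)
  then obtain h2 where h2: "integrable M h2"
    "\<And>A. A \<in> sets M \<Longrightarrow> \<mu> A - \<nu> A = (\<integral>x. indicator A x * h2 x \<partial>M)" by blast
  show ?thesis
  proof (intro exI[of _ "\<lambda>x. h1 x - h2 x"] conjI ballI)
    show "integrable M (\<lambda>x. h1 x - h2 x)" using h1 h2 by auto
    fix A assume A: "A \<in> sets M"
    have "integrable M (\<lambda>x. indicator A x * h1 x)" "integrable M (\<lambda>x. indicator A x * h2 x)"
      using integrable_mult_indicator[OF A h1(1)] integrable_mult_indicator[OF A h2(1)] by simp_all
    then have "(\<integral>x. indicator A x * (h1 x - h2 x) \<partial>M) = \<mu> A - (\<mu> A - \<nu> A)"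
      using h1(2)[OF A] h2(2)[OF A] by (simp add: right_diff_distrib)
    then show "\<nu> A = (\<integral>x. indicator A x * (h1 x - h2 x) \<partial>M)" by simp
  qed
qed

section \<open>Block spaces and Morrey bounds over a system of sets\<close>

text \<open>Atoms on \<open>Q i\<close> have \<open>L_p'\<close>-norm at most
  \<open>\<kappa> i\<close>, and \<open>p\<close> is the exponent of the dual Morrey side. A
  sequence of sets keeps dyadic geometry out of the duality and turns atomic sums into ordinary
  series.\<close>

locale block_system = sigma_finite_measure M for M :: "'a measure" +
  fixes Q :: "nat \<Rightarrow> 'a set" and \<kappa> :: "nat \<Rightarrow> real" and p p' :: real
  assumes Q_sets [measurable]: "\<And>i. Q i \<in> sets M"
    and \<kappa>_pos: "\<And>i. 0 < \<kappa> i"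
    and p: "1 < p" "1 / p + 1 / p' = 1"
begin

text \<open>
  \<open>block_majorant F t b\<close> is an atomic decomposition of a majorant of \<open>F\<close>, where \<open>b i\<close> is the
  \<open>i\<close>-th atom multiplied by its coefficient \<open>t i\<close>.
\<close>

definition block_majorant :: "('a \<Rightarrow> real) \<Rightarrow> (nat \<Rightarrow> real) \<Rightarrow> (nat \<Rightarrow> 'a \<Rightarrow> real) \<Rightarrow> bool" where
  "block_majorant F t b \<longleftrightarrow>
     (\<forall>i. 0 \<le> t i) \<and> summable t \<and>
     (\<forall>i. b i \<in> borel_measurable M \<and> (\<forall>x. 0 \<le> b i x) \<and> (\<forall>x. x \<notin> Q i \<longrightarrow> b i x = 0) \<and>
          (\<integral>\<^sup>+x. ennreal (b i x powr p') \<partial>M) \<le> ennreal ((\<kappa> i * t i) powr p')) \<and>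
     (AE x in M. ennreal (F x) \<le> (\<Sum>i. ennreal (b i x)))"

definition block_fun :: "('a \<Rightarrow> real) \<Rightarrow> bool" where
  "block_fun F \<longleftrightarrow> (\<exists>t b. block_majorant F t b)"

definition block_norm :: "('a \<Rightarrow> real) \<Rightarrow> real" where
  "block_norm F = Inf {suminf t |t. \<exists>b. block_majorant F t b}"

text \<open>A number \<open>S\<close> above the Morrey norm, expressed by nonnegative integrals so
  that neither finiteness nor a supremum has to be discussed in advance.\<close>

definition morrey_bound :: "('a \<Rightarrow> real) \<Rightarrow> real \<Rightarrow> bool" where
  "morrey_bound G S \<longleftrightarrow>
     0 \<le> S \<and> (\<forall>i. (\<integral>\<^sup>+x. ennreal (G x powr p * indicator (Q i) x) \<partial>M) \<le> ennreal ((S / \<kappa> i) powr p))"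

lemma p': "1 < p'"
  by (rule conjugate_exponent_gt_1[OF p])

section \<open>Pairing of block functions with Morrey bounds\<close>

lemma block_majorantD:
  assumes "block_majorant F t b"
  shows "0 \<le> t i" "summable t" "b i \<in> borel_measurable M" "0 \<le> b i x" "x \<notin> Q i \<Longrightarrow> b i x = 0"
    "(\<integral>\<^sup>+x. ennreal (b i x powr p') \<partial>M) \<le> ennreal ((\<kappa> i * t i) powr p')"
    "AE x in M. ennreal (F x) \<le> (\<Sum>i. ennreal (b i x))"
  using assms unfolding block_majorant_def by blast+

text \<open>Hoelder on each \<open>Q i\<close>: the factor \<open>\<kappa> i\<close> of the block
  cancels the \<open>1 / \<kappa> i\<close> of the Morrey bound and leaves \<open>S * t i\<close>.
  The majorising series itself is estimated, not just \<open>F\<close>, because this also shows that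
  the series is finite almost everywhere.\<close>

lemma block_majorant_pairing_sum:
  assumes b: "block_majorant F t b" and G: "morrey_bound G S"
    and [measurable]: "G \<in> borel_measurable M" and nn: "\<And>x. 0 \<le> G x"
  shows "(\<integral>\<^sup>+x. (\<Sum>i. ennreal (b i x)) * ennreal (G x) \<partial>M) \<le> ennreal (S * suminf t)"
proof -
  note bD = block_majorantD[OF b]
  have [measurable]: "b i \<in> borel_measurable M" for i by (rule bD)
  have S: "0 \<le> S" using G by (simp add: morrey_bound_def)
  have *: "(\<integral>\<^sup>+x. ennreal (b i x) * ennreal (G x) \<partial>M) \<le> ennreal (S * t i)" for i
  proof -
    have "(\<integral>\<^sup>+x. ennreal (b i x) * ennreal (G x) \<partial>M)
        = (\<integral>\<^sup>+x. ennreal (G x * indicator (Q i) x * b i x) \<partial>M)"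
      using bD(4,5) nn by (intro nn_integral_cong) (auto simp: indicator_def mult.commute simp flip: ennreal_mult)
    also have "\<dots> \<le> ennreal ((S / \<kappa> i) * (\<kappa> i * t i))"
    proof (rule nn_integral_Hoelder[OF _ _ p])
      have "(\<integral>\<^sup>+x. ennreal ((G x * indicator (Q i) x) powr p) \<partial>M)
          = (\<integral>\<^sup>+x. ennreal (G x powr p * indicator (Q i) x) \<partial>M)"
        by (intro nn_integral_cong) (auto simp: indicator_def)
      then show "(\<integral>\<^sup>+x. ennreal ((G x * indicator (Q i) x) powr p) \<partial>M) \<le> ennreal ((S / \<kappa> i) powr p)"
        using G by (simp add: morrey_bound_def)
      show "(\<integral>\<^sup>+x. ennreal (b i x powr p') \<partial>M) \<le> ennreal ((\<kappa> i * t i) powr p')" by (rule bD)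
      show "0 \<le> S / \<kappa> i" using S \<kappa>_pos[of i] by simp
      show "0 \<le> \<kappa> i * t i" using bD(1)[of i] \<kappa>_pos[of i] by simp
      show "0 \<le> G x * indicator (Q i) x" for x using nn by simp
    qed (auto intro: bD(4))
    also have "(S / \<kappa> i) * (\<kappa> i * t i) = S * t i" using \<kappa>_pos[of i] by simp
    finally show ?thesis .
  qed
  have "(\<integral>\<^sup>+x. (\<Sum>i. ennreal (b i x)) * ennreal (G x) \<partial>M)
      = (\<integral>\<^sup>+x. (\<Sum>i. ennreal (b i x) * ennreal (G x)) \<partial>M)" by simp
  also have "\<dots> = (\<Sum>i. \<integral>\<^sup>+x. ennreal (b i x) * ennreal (G x) \<partial>M)"
    by (rule nn_integral_suminf) measurable
  also have "\<dots> \<le> (\<Sum>i. ennreal (S * t i))"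
    using * by (intro suminf_le) auto
  also have "\<dots> = ennreal (S * suminf t)"
    using bD(1,2) S by (subst suminf_ennreal2) (auto intro: summable_mult simp: suminf_mult)
  finally show ?thesis .
qed

lemma block_majorant_pairing:
  assumes b: "block_majorant F t b" and G: "morrey_bound G S"
    and [measurable]: "G \<in> borel_measurable M" and nn: "\<And>x. 0 \<le> G x"
  shows "(\<integral>\<^sup>+x. ennreal (F x * G x) \<partial>M) \<le> ennreal (S * suminf t)"
proof -
  have "AE x in M. ennreal (F x * G x) \<le> (\<Sum>i. ennreal (b i x)) * ennreal (G x)"
    using block_majorantD(7)[OF b]
    by eventually_elim (use nn in \<open>auto simp: ennreal_mult'' intro: mult_right_mono\<close>)
  then have "(\<integral>\<^sup>+x. ennreal (F x * G x) \<partial>M) \<le> (\<integral>\<^sup>+x. (\<Sum>i. ennreal (b i x)) * ennreal (G x) \<partial>M)"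
    by (rule nn_integral_mono_AE)
  also note block_majorant_pairing_sum[OF assms]
  finally show ?thesis .
qed

lemma block_majorant_suminf_nonneg: "block_majorant F t b \<Longrightarrow> 0 \<le> suminf t"
  by (intro suminf_nonneg) (auto dest: block_majorantD)

lemma block_norm_le: "block_majorant F t b \<Longrightarrow> block_norm F \<le> suminf t"
  unfolding block_norm_def
  by (rule cInf_lower) (use block_majorant_suminf_nonneg in \<open>auto intro!: bdd_belowI[of _ 0]\<close>)

lemma block_norm_approx:
  assumes "block_fun F" "block_norm F < c"
  shows "\<exists>t b. block_majorant F t b \<and> suminf t < c"
proof -
  have ne: "{suminf t |t. \<exists>b. block_majorant F t b} \<noteq> {}"
    using assms(1) by (auto simp: block_fun_def)
  show ?thesis
    using cInf_lessD[OF ne, of c] assms(2) unfolding block_norm_def by auto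
qed

lemma block_norm_nonneg:
  assumes "block_fun F" shows "0 \<le> block_norm F"
  unfolding block_norm_def
  using assms block_majorant_suminf_nonneg
  by (intro cInf_greatest) (auto simp: block_fun_def)

lemma block_norm_leI:
  assumes "block_fun F" "block_fun F'"
    and "\<And>t b. block_majorant F t b \<Longrightarrow> block_norm F' \<le> suminf t"
  shows "block_norm F' \<le> block_norm F"
  unfolding block_norm_def[of F]
  by (rule cInf_greatest) (use assms in \<open>auto simp: block_fun_def\<close>)

lemma block_fun_pairing:
  assumes F: "block_fun F" and G: "morrey_bound G S"
    and [measurable]: "G \<in> borel_measurable M" and nn: "\<And>x. 0 \<le> G x"
  shows "(\<integral>\<^sup>+x. ennreal (F x * G x) \<partial>M) \<le> ennreal (S * block_norm F)"
proof (rule ennreal_le_epsilon)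
  fix e :: real assume e: "0 < e"
  have S: "0 \<le> S" using G by (simp add: morrey_bound_def)
  \<comment> \<open>\<open>S + 1\<close> instead of \<open>S\<close> allows
    \<open>S = 0\<close>.\<close>
  define d where "d = e / (S + 1)"
  have "d > 0" using e S by (simp add: d_def)
  then obtain t b where b: "block_majorant F t b" "suminf t < block_norm F + d"
    using block_norm_approx[OF F, of "block_norm F + d"] by auto
  have "S * d \<le> e" using S e by (simp add: d_def field_simps)
  then have "S * suminf t \<le> S * block_norm F + e"
    using mult_left_mono[OF less_imp_le[OF b(2)] S] by (simp add: distrib_left)
  then show "(\<integral>\<^sup>+x. ennreal (F x * G x) \<partial>M) \<le> ennreal (S * block_norm F) + ennreal e"
    using block_majorant_pairing[OF b(1) G assms(3) nn] S block_norm_nonneg[OF F] e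
    by (auto simp flip: ennreal_plus intro: order_trans ennreal_leI)
qed

lemma block_fun_pairing_integrable:
  assumes F: "block_fun F" "F \<in> borel_measurable M" "\<And>x. 0 \<le> F x" and G: "morrey_bound G S"
    "G \<in> borel_measurable M" "\<And>x. 0 \<le> G x"
  shows "integrable M (\<lambda>x. F x * G x)" "(\<integral>x. F x * G x \<partial>M) \<le> S * block_norm F"
proof -
  note [measurable] = F(2) G(2)
  have le: "(\<integral>\<^sup>+x. ennreal (F x * G x) \<partial>M) \<le> ennreal (S * block_norm F)"
    by (rule block_fun_pairing) (use F G in auto)
  show "integrable M (\<lambda>x. F x * G x)"
    using le F(3) G(3) by (intro integrableI_nonneg) (auto intro: le_less_trans)
  have "0 \<le> S * block_norm F" using G(1) block_norm_nonneg[OF F(1)] by (simp add: morrey_bound_def)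
  then show "(\<integral>x. F x * G x \<partial>M) \<le> S * block_norm F"
    using le F(3) G(3) by (subst integral_eq_nn_integral) (auto intro: enn2real_leI)
qed

section \<open>The block norm as a lattice norm\<close>

lemma block_majorant_mono:
  assumes "block_majorant F t b" "AE x in M. F' x \<le> F x"
  shows "block_majorant F' t b"
proof -
  have "AE x in M. ennreal (F' x) \<le> (\<Sum>i. ennreal (b i x))"
    using assms(2) block_majorantD(7)[OF assms(1)]
    by eventually_elim (meson ennreal_leI order_trans)
  then show ?thesis using assms(1) unfolding block_majorant_def by blast
qed

lemma block_fun_mono: "block_fun F \<Longrightarrow> AE x in M. F' x \<le> F x \<Longrightarrow> block_fun F'"
  unfolding block_fun_def using block_majorant_mono by blast

lemma block_norm_mono:
  assumes "block_fun F" "AE x in M. F' x \<le> F x"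
  shows "block_norm F' \<le> block_norm F"
  by (rule block_norm_leI[OF assms(1) block_fun_mono[OF assms]])
    (use block_majorant_mono[OF _ assms(2)] block_norm_le in blast)

lemma block_norm_cong:
  assumes "AE x in M. F' x = F x"
  shows "block_norm F' = block_norm F"
proof -
  have "AE x in M. F' x \<le> F x" "AE x in M. F x \<le> F' x" using assms by auto
  then have "block_majorant F' t b \<longleftrightarrow> block_majorant F t b" for t b
    using block_majorant_mono[of F t b F'] block_majorant_mono[of F' t b F] by blast
  then show ?thesis unfolding block_norm_def by presburger
qed

text \<open>Blocks over the same set are added, with Minkowski in \<open>L_p'\<close>. Nonnegativity
  lets \<open>ennreal\<close> commute with the sum.\<close>

lemma block_majorant_add:
  assumes b: "block_majorant F t b" and b': "block_majorant F' t' b'"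
    and nn: "\<And>x. 0 \<le> F x" "\<And>x. 0 \<le> F' x"
  shows "block_majorant (\<lambda>x. F x + F' x) (\<lambda>i. t i + t' i) (\<lambda>i x. b i x + b' i x)"
  unfolding block_majorant_def
proof (intro conjI allI)
  note D = block_majorantD[OF b] and D' = block_majorantD[OF b']
  note [measurable] = D(3) D'(3)
  show "summable (\<lambda>i. t i + t' i)" using D(2) D'(2) by (rule summable_add)
  fix i
  show "0 \<le> t i + t' i" using D(1)[of i] D'(1)[of i] by simp
  show "(\<lambda>x. b i x + b' i x) \<in> borel_measurable M" by measurable
  show "0 \<le> b i x + b' i x" for x using D(4)[of i x] D'(4)[of i x] by simp
  show "x \<notin> Q i \<longrightarrow> b i x + b' i x = 0" for x using D(5)[of x i] D'(5)[of x i] by simp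
  show "(\<integral>\<^sup>+x. ennreal ((b i x + b' i x) powr p') \<partial>M) \<le> ennreal ((\<kappa> i * (t i + t' i)) powr p')"
    unfolding distrib_left
    by (rule nn_integral_Minkowski)
      (use D(1,4,6) D'(1,4,6) p' less_imp_le[OF \<kappa>_pos[of i]] in simp_all)
next
  note D = block_majorantD[OF b] and D' = block_majorantD[OF b']
  show "AE x in M. ennreal (F x + F' x) \<le> (\<Sum>i. ennreal (b i x + b' i x))"
    using D(7) D'(7)
  proof eventually_elim
    case (elim x)
    have "ennreal (F x + F' x) = ennreal (F x) + ennreal (F' x)" using nn by simp
    also have "\<dots> \<le> (\<Sum>i. ennreal (b i x)) + (\<Sum>i. ennreal (b' i x))" by (intro add_mono elim)
    also have "\<dots> = (\<Sum>i. ennreal (b i x) + ennreal (b' i x))" by (rule suminf_add) auto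
    also have "\<dots> = (\<Sum>i. ennreal (b i x + b' i x))" using D(4) D'(4) by simp
    finally show ?case .
  qed
qed

lemma block_fun_add:
  assumes "block_fun F" "block_fun F'" and nn: "\<And>x. 0 \<le> F x" "\<And>x. 0 \<le> F' x"
  shows "block_fun (\<lambda>x. F x + F' x)" "block_norm (\<lambda>x. F x + F' x) \<le> block_norm F + block_norm F'"
proof -
  show "block_fun (\<lambda>x. F x + F' x)"
    using assms block_majorant_add unfolding block_fun_def by blast
  show "block_norm (\<lambda>x. F x + F' x) \<le> block_norm F + block_norm F'"
  proof (rule field_le_epsilon)
    fix e :: real assume e: "0 < e"
    obtain t b where b: "block_majorant F t b" "suminf t < block_norm F + e / 2"
      using block_norm_approx[OF assms(1), of "block_norm F + e / 2"] e by auto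
    obtain t' b' where b': "block_majorant F' t' b'" "suminf t' < block_norm F' + e / 2"
      using block_norm_approx[OF assms(2), of "block_norm F' + e / 2"] e by auto
    have "block_norm (\<lambda>x. F x + F' x) \<le> (\<Sum>i. t i + t' i)"
      by (rule block_norm_le[OF block_majorant_add[OF b(1) b'(1) nn]])
    also have "\<dots> = suminf t + suminf t'"
      by (rule suminf_add[symmetric]) (use b b' block_majorantD in auto)
    finally show "block_norm (\<lambda>x. F x + F' x) \<le> block_norm F + block_norm F' + e"
      using b b' by simp
  qed
qed

lemma block_majorant_cmult:
  assumes b: "block_majorant F t b" and c: "0 \<le> c"
  shows "block_majorant (\<lambda>x. c * F x) (\<lambda>i. c * t i) (\<lambda>i x. c * b i x)"
  unfolding block_majorant_def
proof (intro conjI allI)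
  note D = block_majorantD[OF b]
  note [measurable] = D(3)
  show "summable (\<lambda>i. c * t i)" using D(2) by (rule summable_mult)
  fix i
  show "0 \<le> c * t i" using D(1)[of i] c by simp
  show "(\<lambda>x. c * b i x) \<in> borel_measurable M" by measurable
  show "0 \<le> c * b i x" for x using D(4)[of i x] c by simp
  show "x \<notin> Q i \<longrightarrow> c * b i x = 0" for x using D(5)[of x i] by simp
  have "(\<integral>\<^sup>+x. ennreal ((c * b i x) powr p') \<partial>M) = ennreal (c powr p') * (\<integral>\<^sup>+x. ennreal (b i x powr p') \<partial>M)"
    using c D(4) by (subst nn_integral_cmult[symmetric]) (auto simp: powr_mult ennreal_mult)
  also have "\<dots> \<le> ennreal (c powr p') * ennreal ((\<kappa> i * t i) powr p')"
    by (intro mult_left_mono D(6)) auto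
  also have "\<dots> = ennreal ((\<kappa> i * (c * t i)) powr p')"
    using c D(1)[of i] \<kappa>_pos[of i] by (simp add: powr_mult ennreal_mult[symmetric] mult_ac)
  finally show "(\<integral>\<^sup>+x. ennreal ((c * b i x) powr p') \<partial>M) \<le> ennreal ((\<kappa> i * (c * t i)) powr p')" .
next
  note D = block_majorantD[OF b]
  show "AE x in M. ennreal (c * F x) \<le> (\<Sum>i. ennreal (c * b i x))"
    using D(7)
  proof eventually_elim
    case (elim x)
    have "ennreal (c * F x) = ennreal c * ennreal (F x)" using c by (simp add: ennreal_mult')
    also have "\<dots> \<le> ennreal c * (\<Sum>i. ennreal (b i x))" by (intro mult_left_mono elim) auto
    also have "\<dots> = (\<Sum>i. ennreal (c * b i x))" using c by (simp add: ennreal_mult')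
    finally show ?case .
  qed
qed

lemma block_majorant_zero: "block_majorant (\<lambda>x. 0) (\<lambda>i. 0) (\<lambda>i x. 0)"
  by (auto simp: block_majorant_def)

lemma block_fun_zero: "block_fun (\<lambda>x. 0)" and block_norm_zero: "block_norm (\<lambda>x. 0) = 0"
proof -
  show *: "block_fun (\<lambda>x. 0)" using block_majorant_zero by (auto simp: block_fun_def)
  show "block_norm (\<lambda>x. 0) = 0"
    using block_norm_le[OF block_majorant_zero] block_norm_nonneg[OF *] by simp
qed

lemma block_norm_cmult_le:
  assumes "block_fun F" "0 < c"
  shows "block_norm (\<lambda>x. c * F x) \<le> c * block_norm F"
proof (rule field_le_epsilon)
  fix e :: real assume e: "0 < e"
  obtain t b where b: "block_majorant F t b" "suminf t < block_norm F + e / c"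
    using block_norm_approx[OF assms(1), of "block_norm F + e / c"] e assms by auto
  have "block_norm (\<lambda>x. c * F x) \<le> (\<Sum>i. c * t i)"
    by (rule block_norm_le[OF block_majorant_cmult[OF b(1)]]) (use assms in simp)
  also have "\<dots> = c * suminf t" using block_majorantD(2)[OF b(1)] by (rule suminf_mult)
  also have "\<dots> \<le> c * (block_norm F + e / c)" using b assms by (intro mult_left_mono) auto
  finally show "block_norm (\<lambda>x. c * F x) \<le> c * block_norm F + e" using assms by (simp add: distrib_left)
qed

lemma block_fun_cmult:
  assumes F: "block_fun F" and c: "0 \<le> c"
  shows "block_fun (\<lambda>x. c * F x)" "block_norm (\<lambda>x. c * F x) = c * block_norm F"
proof -
  show *: "block_fun (\<lambda>x. c * F x)"
    using F block_majorant_cmult[OF _ c] unfolding block_fun_def by blast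
  show "block_norm (\<lambda>x. c * F x) = c * block_norm F"
  proof (cases "c = 0")
    case True
    then show ?thesis by (simp add: block_norm_zero)
  next
    case False
    then have c: "0 < c" using c by simp
    \<comment> \<open>The reverse inequality is the first one applied to \<open>c * F\<close> and
      the factor \<open>inverse c\<close>.\<close>
    have "block_norm (\<lambda>x. inverse c * (c * F x)) \<le> inverse c * block_norm (\<lambda>x. c * F x)"
      by (rule block_norm_cmult_le[OF *]) (use c in simp)
    then have "c * block_norm F \<le> block_norm (\<lambda>x. c * F x)"
      using c by (simp add: field_simps flip: mult.assoc)
    then show ?thesis using block_norm_cmult_le[OF F c] by simp
  qed
qed

text \<open>The majorant consists of one block. This is how the norms of the extremal test functions
  are estimated.\<close>

lemma block_norm_single_le:
  assumes [measurable]: "F \<in> borel_measurable M" and nn: "\<And>x. 0 \<le> F x" "0 \<le> T"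
    and supp: "\<And>x. x \<notin> Q i \<Longrightarrow> F x = 0"
    and le: "(\<integral>\<^sup>+x. ennreal (F x powr p') \<partial>M) \<le> ennreal ((\<kappa> i * T) powr p')"
  shows "block_fun F" "block_norm F \<le> T"
proof -
  define t b where "t j = (if j = i then T else 0)" and "b j x = (if j = i then F x else 0)" for j x
  have t: "t sums T"
    unfolding t_def using sums_single[of i "\<lambda>_. T"] by simp
  have b: "(\<lambda>j. ennreal (b j x)) sums ennreal (F x)" for x
    unfolding b_def using sums_single[of i "\<lambda>_. ennreal (F x)"] by (simp add: if_distrib cong: if_cong)
  have *: "block_majorant F t b"
    unfolding block_majorant_def
  proof (intro conjI allI)
    show "summable t" using t by (rule sums_summable)
    show "AE x in M. ennreal (F x) \<le> (\<Sum>i. ennreal (b i x))"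
      using sums_unique[OF b] by simp
    fix j
    show "b j \<in> borel_measurable M" unfolding b_def by measurable
    show "(\<integral>\<^sup>+x. ennreal (b j x powr p') \<partial>M) \<le> ennreal ((\<kappa> j * t j) powr p')"
      using le by (auto simp: b_def t_def)
  qed (use nn supp in \<open>auto simp: t_def b_def\<close>)
  then show "block_fun F" by (auto simp: block_fun_def)
  show "block_norm F \<le> T" using block_norm_le[OF *] sums_unique[OF t] by simp
qed

text \<open>
  Up to a tail with small coefficient sum only finitely many atoms matter, and each of them is
  handled by dominated convergence in \<open>L\<^sub>p\<^sub>'\<close>.
\<close>

lemma block_norm_order_continuous:
  fixes H :: "nat \<Rightarrow> 'a \<Rightarrow> real"
  assumes F: "block_fun F" and [measurable]: "F \<in> borel_measurable M" "\<And>n. H n \<in> borel_measurable M"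
    and nn: "\<And>n x. 0 \<le> H n x"
    and le: "\<And>n. AE x in M. H n x \<le> F x" and lim: "AE x in M. (\<lambda>n. H n x) \<longlonglongrightarrow> 0"
  shows "(\<lambda>n. block_norm (H n)) \<longlonglongrightarrow> 0"
proof -
  obtain t b where b: "block_majorant F t b" using F by (auto simp: block_fun_def)
  note D = block_majorantD[OF b]
  note [measurable] = D(3)
  \<comment> \<open>Where \<open>F\<close> is positive, \<open>m n\<close> is the ratio
    \<open>H n / F\<close>, so that \<open>H n = m n * F\<close> almost everywhere and multiplying
    the blocks of \<open>F\<close> by \<open>m n\<close> gives blocks for \<open>H n\<close>. The
    cap at 1 makes the damping valid everywhere and not only almost everywhere.\<close>
  define m where "m n x = min 1 (if F x > 0 then H n x / F x else 0)" for n x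
  have m[measurable]: "m n \<in> borel_measurable M" for n unfolding m_def by measurable
  have m01: "0 \<le> m n x" "m n x \<le> 1" for n x using nn by (auto simp: m_def)
  define I where "I n i = (\<integral>\<^sup>+x. ennreal ((b i x * m n x) powr p') \<partial>M)" for n i
  have I_le: "I n i \<le> ennreal ((\<kappa> i * t i) powr p')" for n i
  proof -
    have "I n i \<le> (\<integral>\<^sup>+x. ennreal (b i x powr p') \<partial>M)"
      unfolding I_def using m01 D(4) p'
      by (intro nn_integral_mono ennreal_leI powr_mono2) (auto intro: mult_right_le_one_le)
    then show ?thesis using D(6)[of i] by (rule order_trans)
  qed
  have I_lim: "(\<lambda>n. I n i) \<longlonglongrightarrow> 0" for i
  proof -
    have "(\<lambda>n. I n i) \<longlonglongrightarrow> (\<integral>\<^sup>+x. 0 \<partial>M)"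
      unfolding I_def
    proof (rule nn_integral_dominated_convergence[where w = "\<lambda>x. ennreal (b i x powr p')"])
      show "AE x in M. ennreal ((b i x * m n x) powr p') \<le> ennreal (b i x powr p')" for n
        using m01 D(4) p' by (intro AE_I2 ennreal_leI powr_mono2) (auto intro: mult_right_le_one_le)
      show "(\<integral>\<^sup>+x. ennreal (b i x powr p') \<partial>M) < \<infinity>"
        using D(6)[of i] by (auto intro: le_less_trans)
      show "AE x in M. (\<lambda>n. ennreal ((b i x * m n x) powr p')) \<longlonglongrightarrow> 0"
        using lim
      proof eventually_elim
        case (elim x)
        have "(\<lambda>n. if F x > 0 then H n x / F x else 0) \<longlonglongrightarrow> 0"
          using tendsto_divide[OF elim tendsto_const[of "F x"]] by (cases "F x > 0") auto
        then have "(\<lambda>n. m n x) \<longlonglongrightarrow> min 1 0"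
          unfolding m_def by (intro tendsto_min tendsto_const)
        then have "(\<lambda>n. b i x * m n x) \<longlonglongrightarrow> 0"
          by (auto intro!: tendsto_eq_intros)
        then have "(\<lambda>n. (b i x * m n x) powr p') \<longlonglongrightarrow> 0 powr p'"
          using p' D(4) m01 by (intro tendsto_powr') auto
        then show ?case using p' tendsto_ennrealI by fastforce
      qed
    qed measurable
    then show ?thesis by simp
  qed
  \<comment> \<open>The coefficient that normalises the damped block \<open>b i * m n\<close>; it
    tends to 0 for each fixed \<open>i\<close>.\<close>
  define s where "s n i = (enn2real (I n i) powr (1 / p')) / \<kappa> i" for n i
  have s_nn: "0 \<le> s n i" for n i using \<kappa>_pos[of i] by (simp add: s_def)
  have s_I: "I n i = ennreal ((\<kappa> i * s n i) powr p')" for n i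
  proof -
    have "I n i < \<infinity>" using I_le[of n i] by (auto intro: le_less_trans)
    then show ?thesis
      using \<kappa>_pos[of i] p' by (simp add: s_def powr_powr less_top)
  qed
  have s_lim: "(\<lambda>n. s n i) \<longlonglongrightarrow> 0" for i
  proof -
    have "(\<lambda>n. enn2real (I n i)) \<longlonglongrightarrow> 0" using tendsto_enn2real[of _ 0] I_lim[of i] by simp
    then have "(\<lambda>n. enn2real (I n i) powr (1 / p')) \<longlonglongrightarrow> 0 powr (1 / p')"
      using p' by (intro tendsto_powr') auto
    then show ?thesis unfolding s_def using tendsto_divide[OF _ tendsto_const, of _ 0 _ "\<kappa> i"] \<kappa>_pos[of i]
      by fastforce
  qed
  have bound: "block_norm (H n) \<le> (\<Sum>i<K. s n i) + (\<Sum>i. t (i + K))" for n K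
  proof -
    \<comment> \<open>Only the first \<open>K\<close> blocks are damped. The tail keeps its original
      blocks, whose coefficients have a small sum independently of \<open>n\<close>.\<close>
    define t' b' where "t' i = (if i < K then s n i else t i)"
      and "b' i x = (if i < K then b i x * m n x else b i x)" for i x
    have sum_t': "summable t'"
      using D(2) summable_iff_shift[of t' K] summable_iff_shift[of t K] by (simp add: t'_def)
    have "block_majorant (H n) t' b'"
      unfolding block_majorant_def
    proof (intro conjI allI)
      show "summable t'" by fact
      fix i
      show "0 \<le> t' i" using s_nn D(1) by (auto simp: t'_def)
      show "b' i \<in> borel_measurable M" unfolding b'_def by measurable
      show "0 \<le> b' i x" for x using m01 D(4) by (auto simp: b'_def)
      show "x \<notin> Q i \<longrightarrow> b' i x = 0" for x using D(5) by (auto simp: b'_def)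
      show "(\<integral>\<^sup>+x. ennreal (b' i x powr p') \<partial>M) \<le> ennreal ((\<kappa> i * t' i) powr p')"
        using s_I[of n i] D(6)[of i] by (auto simp: b'_def t'_def I_def)
    next
      show "AE x in M. ennreal (H n x) \<le> (\<Sum>i. ennreal (b' i x))"
        using le[of n] D(7)
      proof eventually_elim
        case (elim x)
        have "H n x = m n x * F x"
          using nn[of n x] elim(1) by (auto simp: m_def min_def)
        then have "ennreal (H n x) = ennreal (m n x) * ennreal (F x)"
          using m01 by (simp add: ennreal_mult')
        also have "\<dots> \<le> ennreal (m n x) * (\<Sum>i. ennreal (b i x))"
          by (intro mult_left_mono elim) auto
        also have "\<dots> = (\<Sum>i. ennreal (m n x) * ennreal (b i x))" by simp
        also have "\<dots> \<le> (\<Sum>i. ennreal (b' i x))"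
        proof (rule suminf_le)
          fix i
          have "m n x * b i x \<le> b i x"
            using m01[of n x] D(4)[of i x] by (intro mult_left_le_one_le) auto
          then show "ennreal (m n x) * ennreal (b i x) \<le> ennreal (b' i x)"
            using m01 D(4) by (auto simp: b'_def mult.commute simp flip: ennreal_mult intro!: ennreal_leI)
        qed auto
        finally show ?case .
      qed
    qed
    then have "block_norm (H n) \<le> suminf t'" by (rule block_norm_le)
    also have "\<dots> = (\<Sum>i. t' (i + K)) + (\<Sum>i<K. t' i)"
      by (rule suminf_split_initial_segment[OF sum_t'])
    also have "\<dots> = (\<Sum>i. t (i + K)) + (\<Sum>i<K. s n i)" by (simp add: t'_def)
    finally show ?thesis by simp
  qed
  show ?thesis
  proof (rule LIMSEQ_I)
    fix e :: real assume e: "0 < e"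
    have "(\<lambda>K. \<Sum>i. t (i + K)) \<longlonglongrightarrow> 0" by (rule suminf_exist_split2[OF D(2)])
    then have "\<forall>\<^sub>F K in sequentially. (\<Sum>i. t (i + K)) < e / 2"
      by (rule order_tendstoD) (use e in simp)
    then obtain K where K: "(\<Sum>i. t (i + K)) < e / 2"
      by (auto dest: eventually_happens)
    have "(\<lambda>n. \<Sum>i<K. s n i) \<longlonglongrightarrow> (\<Sum>i<K. 0)" by (intro tendsto_sum s_lim)
    then have "(\<lambda>n. \<Sum>i<K. s n i) \<longlonglongrightarrow> 0" by simp
    then obtain N where N: "\<And>n. n \<ge> N \<Longrightarrow> norm ((\<Sum>i<K. s n i) - 0) < e / 2"
      using LIMSEQ_D[of _ 0 "e / 2"] e by (metis half_gt_zero)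
    show "\<exists>N. \<forall>n\<ge>N. norm (block_norm (H n) - 0) < e"
    proof (intro exI allI impI)
      fix n assume "n \<ge> N"
      then have "(\<Sum>i<K. s n i) < e / 2" using N by fastforce
      moreover have "0 \<le> block_norm (H n)"
        by (rule block_norm_nonneg[OF block_fun_mono[OF F le]])
      ultimately show "norm (block_norm (H n) - 0) < e" using bound[of n K] K by simp
    qed
  qed
qed

section \<open>Definiteness and convergence through a strictly positive weight\<close>

lemma block_norm_eq_0_imp:
  assumes F: "block_fun F" "block_norm F = 0" and [measurable]: "F \<in> borel_measurable M"
    and nn: "\<And>x. 0 \<le> F x"
    and v: "morrey_bound v S" and [measurable]: "v \<in> borel_measurable M" and vpos: "\<And>x. 0 < v x"
  shows "AE x in M. F x = 0"
proof -
  have "(\<integral>\<^sup>+x. ennreal (F x * v x) \<partial>M) \<le> ennreal (S * block_norm F)"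
    by (rule block_fun_pairing[OF F(1) v]) (use vpos less_imp_le in auto)
  then have "(\<integral>\<^sup>+x. ennreal (F x * v x) \<partial>M) = 0" using F by simp
  then have "AE x in M. ennreal (F x * v x) = 0" by (subst (asm) nn_integral_0_iff_AE) auto
  then show ?thesis
  proof eventually_elim
    case (elim x)
    then have "F x * v x \<le> 0" by (simp add: ennreal_eq_0_iff)
    then show ?case using vpos[of x] nn[of x] by (simp add: mult_le_0_iff)
  qed
qed

text \<open>Pairing with a strictly positive Morrey-bounded \<open>v\<close> makes the weighted
  series integrable, so the series itself is finite almost everywhere.\<close>

lemma block_majorant_AE_summable:
  assumes b: "block_majorant F t b"
    and v: "morrey_bound v S" and [measurable]: "v \<in> borel_measurable M" and vpos: "\<And>x. 0 < v x"
  shows "AE x in M. summable (\<lambda>i. b i x)"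
proof -
  note D = block_majorantD[OF b]
  note [measurable] = D(3)
  have "(\<integral>\<^sup>+x. (\<Sum>i. ennreal (b i x)) * ennreal (v x) \<partial>M) \<le> ennreal (S * suminf t)"
    by (rule block_majorant_pairing_sum[OF b v]) (use vpos less_imp_le in auto)
  then have "(\<integral>\<^sup>+x. (\<Sum>i. ennreal (b i x)) * ennreal (v x) \<partial>M) \<noteq> \<infinity>"
    by (auto simp: top_unique)
  then have "AE x in M. (\<Sum>i. ennreal (b i x)) * ennreal (v x) \<noteq> \<infinity>"
    by (intro nn_integral_noteq_infinite) auto
  then show ?thesis
  proof eventually_elim
    case (elim x)
    then have "(\<Sum>i. ennreal (b i x)) \<noteq> top"
      using vpos[of x] by (auto simp: ennreal_mult_eq_top_iff ennreal_eq_0_iff)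
    then show ?case by (intro summable_suminf_not_top D(4))
  qed
qed

end

section \<open>The sequence space norm\<close>

text \<open>For a sequence that is not \<open>q\<close>-summable the value has no meaning;
  summability therefore appears as a separate assumption or conclusion in what follows.\<close>

definition lq_norm :: "real \<Rightarrow> (nat \<Rightarrow> complex) \<Rightarrow> real" where
  "lq_norm q a = (\<Sum>j. cmod (a j) powr q) powr (1 / q)"

lemma lq_norm_nonneg [simp]: "0 \<le> lq_norm q a"
  by (simp add: lq_norm_def)

lemma lq_norm_powr:
  assumes "0 < q" "summable (\<lambda>j. cmod (a j) powr q)"
  shows "lq_norm q a powr q = (\<Sum>j. cmod (a j) powr q)"
  unfolding lq_norm_def using assms by (intro powr_powr_cancel(1) suminf_nonneg) auto

lemma lq_norm_ge:
  assumes "0 < q" "summable (\<lambda>j. cmod (a j) powr q)"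
  shows "cmod (a j) \<le> lq_norm q a"
proof -
  have "cmod (a j) powr q \<le> (\<Sum>j. cmod (a j) powr q)"
    using sum_le_suminf[OF assms(2), of "{j}"] by simp
  then have "(cmod (a j) powr q) powr (1 / q) \<le> lq_norm q a"
    unfolding lq_norm_def using assms(1) by (intro powr_mono2) auto
  then show ?thesis using assms(1) by (simp add: powr_powr_cancel)
qed

lemma lq_norm_mono:
  assumes "0 < q" "summable (\<lambda>j. cmod (b j) powr q)" "\<And>j. cmod (a j) \<le> cmod (b j)"
  shows "summable (\<lambda>j. cmod (a j) powr q)" "lq_norm q a \<le> lq_norm q b"
proof -
  have le: "cmod (a j) powr q \<le> cmod (b j) powr q" for j
    using assms by (intro powr_mono2) auto
  show s: "summable (\<lambda>j. cmod (a j) powr q)"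
    by (rule summable_comparison_test'[OF assms(2), of 0]) (use le in auto)
  have "(\<Sum>j. cmod (a j) powr q) \<le> (\<Sum>j. cmod (b j) powr q)"
    by (rule suminf_le[OF le s assms(2)])
  then show "lq_norm q a \<le> lq_norm q b"
    unfolding lq_norm_def using assms(1) s by (intro powr_mono2) (auto intro: suminf_nonneg)
qed

lemma lq_norm_triangle:
  assumes q: "1 \<le> q" and a: "summable (\<lambda>j. cmod (a j) powr q)" and b: "summable (\<lambda>j. cmod (b j) powr q)"
  shows "summable (\<lambda>j. cmod (a j + b j) powr q)" "lq_norm q (\<lambda>j. a j + b j) \<le> lq_norm q a + lq_norm q b"
proof -
  note M = suminf_Minkowski[of q "\<lambda>j. cmod (a j)" "\<lambda>j. cmod (b j)", OF q _ _ a b]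
  have s: "summable (\<lambda>j. cmod (of_real (cmod (a j) + cmod (b j))) powr q)"
    using M(1) by (simp del: of_real_add)
  have le: "cmod (a j + b j) \<le> cmod (of_real (cmod (a j) + cmod (b j)))" for j
    by (simp add: norm_triangle_ineq del: of_real_add)
  show "summable (\<lambda>j. cmod (a j + b j) powr q)"
    by (rule lq_norm_mono(1)[OF _ s le]) (use q in simp)
  have "lq_norm q (\<lambda>j. a j + b j) \<le> lq_norm q (\<lambda>j. of_real (cmod (a j) + cmod (b j)))"
    by (rule lq_norm_mono(2)[OF _ s le]) (use q in simp)
  also have "\<dots> \<le> lq_norm q a + lq_norm q b"
    using M(2) by (simp add: lq_norm_def del: of_real_add)
  finally show "lq_norm q (\<lambda>j. a j + b j) \<le> lq_norm q a + lq_norm q b" .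
qed

lemma lq_norm_cmult:
  assumes q: "0 < q" and a: "summable (\<lambda>j. cmod (a j) powr q)"
  shows "summable (\<lambda>j. cmod (c * a j) powr q)" "lq_norm q (\<lambda>j. c * a j) = cmod c * lq_norm q a"
proof -
  have eq: "(\<lambda>j. cmod (c * a j) powr q) = (\<lambda>j. cmod c powr q * cmod (a j) powr q)"
    by (simp add: norm_mult powr_mult)
  show "summable (\<lambda>j. cmod (c * a j) powr q)"
    unfolding eq using a by (rule summable_mult)
  have "(\<Sum>j. cmod (c * a j) powr q) = cmod c powr q * (\<Sum>j. cmod (a j) powr q)"
    unfolding eq using a by (rule suminf_mult)
  then show "lq_norm q (\<lambda>j. c * a j) = cmod c * lq_norm q a"
    using q a by (simp add: lq_norm_def powr_mult suminf_nonneg powr_powr)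
qed

lemma lq_norm_Hoelder:
  assumes q: "1 < q" "1 / q + 1 / q' = 1"
    and a: "summable (\<lambda>j. cmod (a j) powr q)" and b: "summable (\<lambda>j. cmod (b j) powr q')"
  shows "summable (\<lambda>j. a j * b j)" "cmod (\<Sum>j. a j * b j) \<le> lq_norm q a * lq_norm q' b"
proof -
  note H = suminf_Hoelder[of q q' "\<lambda>j. cmod (a j)" "\<lambda>j. cmod (b j)", OF q _ _ a b]
  have s: "summable (\<lambda>j. norm (a j * b j))" using H(1) by (simp add: norm_mult)
  then show "summable (\<lambda>j. a j * b j)" by (rule summable_norm_cancel)
  have "cmod (\<Sum>j. a j * b j) \<le> (\<Sum>j. norm (a j * b j))" using s by (rule summable_norm)
  also have "\<dots> \<le> lq_norm q a * lq_norm q' b" using H(2) by (simp add: norm_mult lq_norm_def)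
  finally show "cmod (\<Sum>j. a j * b j) \<le> lq_norm q a * lq_norm q' b" .
qed

lemma lq_norm_finite:
  assumes "\<And>j. j \<ge> m \<Longrightarrow> a j = 0"
  shows "summable (\<lambda>j. cmod (a j) powr q)" "(\<Sum>j. cmod (a j) powr q) = (\<Sum>j<m. cmod (a j) powr q)"
proof -
  have "(\<lambda>j. cmod (a j) powr q) sums (\<Sum>j<m. cmod (a j) powr q)"
    by (rule sums_finite) (use assms in \<open>auto simp: not_less\<close>)
  then show "summable (\<lambda>j. cmod (a j) powr q)" "(\<Sum>j. cmod (a j) powr q) = (\<Sum>j<m. cmod (a j) powr q)"
    by (auto simp: sums_iff)
qed

lemma lq_norm_finite_le:
  assumes "0 < q" "\<And>j. j \<ge> m \<Longrightarrow> a j = 0" "\<And>j. cmod (a j) \<le> B"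
  shows "lq_norm q a \<le> real m powr (1 / q) * B"
proof -
  have B: "0 \<le> B" using assms(3)[of 0] norm_ge_zero order_trans by blast
  have "(\<Sum>j. cmod (a j) powr q) = (\<Sum>j<m. cmod (a j) powr q)"
    by (rule lq_norm_finite(2)) (rule assms(2))
  also have "\<dots> \<le> (\<Sum>j<m. B powr q)"
    by (rule sum_mono) (use assms in \<open>auto intro!: powr_mono2\<close>)
  also have "\<dots> = real m * B powr q" by simp
  finally have "lq_norm q a \<le> (real m * B powr q) powr (1 / q)"
    unfolding lq_norm_def using assms
    by (intro powr_mono2) (auto intro!: suminf_nonneg lq_norm_finite)
  then show ?thesis using assms(1) B by (simp add: powr_mult powr_powr)
qed

lemma lq_norm_single:
  assumes "0 < q" shows "lq_norm q (\<lambda>k. if k = j then z else 0) = cmod z"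
proof -
  have "(\<lambda>k. cmod (if k = j then z else 0) powr q) = (\<lambda>k. if k = j then cmod z powr q else 0)"
    by auto
  moreover have "(\<lambda>k. if k = j then cmod z powr q else 0) sums (cmod z powr q)"
    using sums_single[of j "\<lambda>_. cmod z powr q"] by simp
  ultimately show ?thesis using assms by (simp add: lq_norm_def sums_iff powr_powr)
qed

text \<open>Tannery's theorem for the \<open>q\<close>-th powers, that is, dominated convergence
  over the counting measure.\<close>

lemma lq_norm_dominated_tendsto_0:
  assumes q: "0 < q" and b: "summable (\<lambda>j. cmod (b j) powr q)"
    and le: "\<And>n j. cmod (a n j) \<le> cmod (b j)" and lim: "\<And>j. (\<lambda>n. a n j) \<longlonglongrightarrow> 0"
  shows "(\<lambda>n. lq_norm q (a n)) \<longlonglongrightarrow> 0"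
proof -
  have "(\<lambda>n. \<Sum>j. cmod (a n j) powr q) \<longlonglongrightarrow> (\<Sum>j. 0)"
  proof (rule tannerys_theorem[THEN conjunct2, THEN conjunct2])
    show "(\<lambda>n. cmod (a n j) powr q) \<longlonglongrightarrow> 0" for j
    proof -
      have "(\<lambda>n. cmod (a n j)) \<longlonglongrightarrow> 0" using lim[of j] by (rule tendsto_norm_zero)
      then have "(\<lambda>n. cmod (a n j) powr q) \<longlonglongrightarrow> 0 powr q"
        using q by (intro tendsto_powr') auto
      then show ?thesis using q by simp
    qed
    show "\<forall>\<^sub>F (j, n) in at_top \<times>\<^sub>F sequentially. norm (cmod (a n j) powr q) \<le> cmod (b j) powr q"
      using le q by (intro always_eventually) (auto intro!: powr_mono2)
  qed (use b in auto)
  then have "(\<lambda>n. (\<Sum>j. cmod (a n j) powr q) powr (1 / q)) \<longlonglongrightarrow> 0 powr (1 / q)"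
    using q lq_norm_mono(1)[OF q b le]
    by (intro tendsto_powr') (auto intro!: suminf_nonneg always_eventually)
  then show ?thesis using q by (simp add: lq_norm_def)
qed

lemma borel_measurable_lq_norm [measurable (raw)]:
  assumes [measurable]: "\<And>j. f j \<in> borel_measurable M"
  shows "(\<lambda>x. lq_norm q (\<lambda>j. f j x)) \<in> borel_measurable M"
  unfolding lq_norm_def by measurable

text \<open>Fatou: an integral bound uniform in \<open>n\<close> passes to an almost everywhere
  limit. It removes truncations later on.\<close>

lemma nn_integral_limit_le:
  fixes f :: "nat \<Rightarrow> 'a \<Rightarrow> ennreal"
  assumes [measurable]: "\<And>n. f n \<in> borel_measurable M"
    and "AE x in M. (\<lambda>n. f n x) \<longlonglongrightarrow> F x" and le: "\<And>n. (\<integral>\<^sup>+x. f n x \<partial>M) \<le> C"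
  shows "(\<integral>\<^sup>+x. F x \<partial>M) \<le> C"
proof -
  have "AE x in M. F x = liminf (\<lambda>n. f n x)"
    using assms(2)
    by eventually_elim (metis lim_imp_Liminf trivial_limit_sequentially)
  then have "(\<integral>\<^sup>+x. F x \<partial>M) = (\<integral>\<^sup>+x. liminf (\<lambda>n. f n x) \<partial>M)" by (rule nn_integral_cong_AE)
  also have "\<dots> \<le> liminf (\<lambda>n. \<integral>\<^sup>+x. f n x \<partial>M)" by (rule nn_integral_liminf) measurable
  also have "\<dots> \<le> C"
  proof -
    have "liminf (\<lambda>n. \<integral>\<^sup>+x. f n x \<partial>M) \<le> liminf (\<lambda>n. C)"
      by (rule Liminf_mono) (use le in auto)
    then show ?thesis by (simp add: Liminf_const)
  qed
  finally show ?thesis .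
qed

section \<open>Duality for sequences of functions\<close>

text \<open>\<open>Q_cover\<close> turns statements on each \<open>Q i\<close> into statements
  almost everywhere; \<open>Q_finite\<close> makes bounded functions on \<open>Q i\<close>
  integrable, as needed for the truncated extremal functions. By \<open>v_block\<close> every
  measurable function dominated by a multiple of \<open>v\<close> has finite block norm.\<close>

locale block_seq_system = block_system M Q \<kappa> p p'
  for M :: "'a measure" and Q \<kappa> p p' +
  fixes q q' :: real and v :: "'a \<Rightarrow> real"
  assumes q: "1 < q" "1 / q + 1 / q' = 1"
    and Q_cover: "(\<Union>i. Q i) = space M" and Q_finite: "\<And>i. emeasure M (Q i) < \<infinity>"
    and v_measurable [measurable]: "v \<in> borel_measurable M" and v_pos: "\<And>x. 0 < v x"
    and v_block: "block_fun v" and v_morrey: "\<exists>S. morrey_bound v S"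
begin

definition block_seq :: "(nat \<Rightarrow> 'a \<Rightarrow> complex) \<Rightarrow> bool" where
  "block_seq f \<longleftrightarrow> (\<forall>j. f j \<in> borel_measurable M) \<and>
     (AE x in M. summable (\<lambda>j. cmod (f j x) powr q')) \<and> block_fun (\<lambda>x. lq_norm q' (\<lambda>j. f j x))"

definition block_seq_norm :: "(nat \<Rightarrow> 'a \<Rightarrow> complex) \<Rightarrow> real" where
  "block_seq_norm f = block_norm (\<lambda>x. lq_norm q' (\<lambda>j. f j x))"

definition morrey_seq_bound :: "(nat \<Rightarrow> 'a \<Rightarrow> complex) \<Rightarrow> real \<Rightarrow> bool" where
  "morrey_seq_bound g S \<longleftrightarrow> (\<forall>j. g j \<in> borel_measurable M) \<and>
     (AE x in M. summable (\<lambda>j. cmod (g j x) powr q)) \<and> morrey_bound (\<lambda>x. lq_norm q (\<lambda>j. g j x)) S"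

definition seq_pairing :: "(nat \<Rightarrow> 'a \<Rightarrow> complex) \<Rightarrow> (nat \<Rightarrow> 'a \<Rightarrow> complex) \<Rightarrow> complex" where
  "seq_pairing g f = (\<integral>x. (\<Sum>j. g j x * f j x) \<partial>M)"

text \<open>The constant is explicit because it becomes the Morrey bound of the representing
  sequence.\<close>

definition bounded_functional :: "((nat \<Rightarrow> 'a \<Rightarrow> complex) \<Rightarrow> complex) \<Rightarrow> real \<Rightarrow> bool" where
  "bounded_functional \<Lambda> C \<longleftrightarrow>
     (\<forall>f g. block_seq f \<longrightarrow> block_seq g \<longrightarrow> \<Lambda> (\<lambda>j x. f j x + g j x) = \<Lambda> f + \<Lambda> g) \<and>
     (\<forall>c f. block_seq f \<longrightarrow> \<Lambda> (\<lambda>j x. c * f j x) = c * \<Lambda> f) \<and>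
     (\<forall>f. block_seq f \<longrightarrow> cmod (\<Lambda> f) \<le> C * block_seq_norm f)"

text \<open>Pairing with such a sequence is a finite sum of integrals, and these sequences are dense
  in the block norm; comparisons of functionals and of representing sequences are made on
  them.\<close>

definition test_seq :: "nat \<Rightarrow> real \<Rightarrow> (nat \<Rightarrow> 'a \<Rightarrow> complex) \<Rightarrow> bool" where
  "test_seq m B f \<longleftrightarrow> (\<forall>j. f j \<in> borel_measurable M) \<and> (\<forall>j\<ge>m. \<forall>x. f j x = 0) \<and>
     (\<forall>j x. cmod (f j x) \<le> B * v x)"

lemma q': "1 < q'"
  by (rule conjugate_exponent_gt_1[OF q])

lemma block_seq_measurable: "block_seq f \<Longrightarrow> f j \<in> borel_measurable M"
  by (simp add: block_seq_def)

lemma block_seq_norm_nonneg: "block_seq f \<Longrightarrow> 0 \<le> block_seq_norm f"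
  by (simp add: block_seq_def block_seq_norm_def block_norm_nonneg)

section \<open>Linear structure of block sequences\<close>

lemma block_seq_add:
  assumes f: "block_seq f" and g: "block_seq g"
  shows "block_seq (\<lambda>j x. f j x + g j x)"
    "block_seq_norm (\<lambda>j x. f j x + g j x) \<le> block_seq_norm f + block_seq_norm g"
proof -
  have *: "AE x in M. summable (\<lambda>j. cmod (f j x + g j x) powr q') \<and>
      lq_norm q' (\<lambda>j. f j x + g j x) \<le> lq_norm q' (\<lambda>j. f j x) + lq_norm q' (\<lambda>j. g j x)"
    using f[unfolded block_seq_def, THEN conjunct2, THEN conjunct1]
      g[unfolded block_seq_def, THEN conjunct2, THEN conjunct1]
    by eventually_elim (use q' in \<open>simp add: lq_norm_triangle\<close>)
  have bf: "block_fun (\<lambda>x. lq_norm q' (\<lambda>j. f j x))" "block_fun (\<lambda>x. lq_norm q' (\<lambda>j. g j x))"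
    using f g by (auto simp: block_seq_def)
  note sum = block_fun_add[OF bf lq_norm_nonneg lq_norm_nonneg]
  have [measurable]: "f j \<in> borel_measurable M" "g j \<in> borel_measurable M" for j
    using f g by (auto intro: block_seq_measurable)
  have "AE x in M. summable (\<lambda>j. cmod (f j x + g j x) powr q')" using * by (rule AE_mp) simp
  moreover have "block_fun (\<lambda>x. lq_norm q' (\<lambda>j. f j x + g j x))"
    by (rule block_fun_mono[OF sum(1)]) (use * in \<open>eventually_elim, simp\<close>)
  ultimately show "block_seq (\<lambda>j x. f j x + g j x)" unfolding block_seq_def by simp
  have "block_seq_norm (\<lambda>j x. f j x + g j x) \<le> block_norm (\<lambda>x. lq_norm q' (\<lambda>j. f j x) + lq_norm q' (\<lambda>j. g j x))"
    unfolding block_seq_norm_def by (rule block_norm_mono[OF sum(1)]) (use * in auto)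
  also note sum(2)
  finally show "block_seq_norm (\<lambda>j x. f j x + g j x) \<le> block_seq_norm f + block_seq_norm g"
    by (simp add: block_seq_norm_def)
qed

lemma block_seq_cmult:
  assumes f: "block_seq f"
  shows "block_seq (\<lambda>j x. c * f j x)" "block_seq_norm (\<lambda>j x. c * f j x) = cmod c * block_seq_norm f"
proof -
  have *: "AE x in M. summable (\<lambda>j. cmod (c * f j x) powr q') \<and>
      lq_norm q' (\<lambda>j. c * f j x) = cmod c * lq_norm q' (\<lambda>j. f j x)"
    using f[unfolded block_seq_def, THEN conjunct2, THEN conjunct1]
    by eventually_elim (use q' in \<open>simp add: lq_norm_cmult\<close>)
  have bf: "block_fun (\<lambda>x. lq_norm q' (\<lambda>j. f j x))" using f by (auto simp: block_seq_def)
  note mult = block_fun_cmult[OF bf norm_ge_zero[of c]]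
  have [measurable]: "f j \<in> borel_measurable M" for j
    using f by (rule block_seq_measurable)
  have "AE x in M. summable (\<lambda>j. cmod (c * f j x) powr q')" using * by (rule AE_mp) simp
  moreover have "block_fun (\<lambda>x. lq_norm q' (\<lambda>j. c * f j x))"
    by (rule block_fun_mono[OF mult(1)]) (use * in \<open>eventually_elim, simp\<close>)
  ultimately show "block_seq (\<lambda>j x. c * f j x)" unfolding block_seq_def by simp
  have "block_seq_norm (\<lambda>j x. c * f j x) = block_norm (\<lambda>x. cmod c * lq_norm q' (\<lambda>j. f j x))"
    unfolding block_seq_norm_def by (rule block_norm_cong) (use * in auto)
  then show "block_seq_norm (\<lambda>j x. c * f j x) = cmod c * block_seq_norm f"
    using mult(2) by (simp add: block_seq_norm_def)
qed

lemma block_seq_zero: "block_seq (\<lambda>j x. 0)" "block_seq_norm (\<lambda>j x. 0) = 0"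
  using block_fun_zero block_norm_zero by (auto simp: block_seq_def block_seq_norm_def lq_norm_def)

lemma block_seq_single:
  assumes [measurable]: "\<phi> \<in> borel_measurable M" and "block_fun (\<lambda>x. cmod (\<phi> x))"
  shows "block_seq (\<lambda>k x. if k = j then \<phi> x else 0)"
    "block_seq_norm (\<lambda>k x. if k = j then \<phi> x else 0) = block_norm (\<lambda>x. cmod (\<phi> x))"
proof -
  have eq: "(\<lambda>x. lq_norm q' (\<lambda>k. if k = j then \<phi> x else 0)) = (\<lambda>x. cmod (\<phi> x))"
    using q' by (simp add: lq_norm_single)
  have "summable (\<lambda>k. cmod (if k = j then \<phi> x else 0) powr q')" for x
    by (rule lq_norm_finite[of "Suc j"]) auto
  then show "block_seq (\<lambda>k x. if k = j then \<phi> x else 0)"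
    "block_seq_norm (\<lambda>k x. if k = j then \<phi> x else 0) = block_norm (\<lambda>x. cmod (\<phi> x))"
    using assms by (simp_all add: block_seq_def block_seq_norm_def eq)
qed

lemma test_seq_lq_norm:
  assumes "test_seq m B f"
  shows "summable (\<lambda>j. cmod (f j x) powr q')"
    and "lq_norm q' (\<lambda>j. f j x) \<le> (real m powr (1 / q') * \<bar>B\<bar>) * v x"
proof -
  have 1: "f j \<in> borel_measurable M" "\<And>j x. j \<ge> m \<Longrightarrow> f j x = 0" "cmod (f j x) \<le> B * v x" for j x
    using assms by (auto simp: test_seq_def)
  show "summable (\<lambda>j. cmod (f j x) powr q')"
    by (rule lq_norm_finite[of m]) (use 1 in auto)
  have "lq_norm q' (\<lambda>j. f j x) \<le> real m powr (1 / q') * (\<bar>B\<bar> * v x)"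
  proof (rule lq_norm_finite_le)
    fix j
    have "B * v x \<le> \<bar>B\<bar> * v x" using v_pos[of x] by (intro mult_right_mono) auto
    then show "cmod (f j x) \<le> \<bar>B\<bar> * v x" using 1(3)[of j x] by linarith
  qed (use 1 q' in auto)
  then show "lq_norm q' (\<lambda>j. f j x) \<le> (real m powr (1 / q') * \<bar>B\<bar>) * v x" by (simp add: mult.assoc)
qed

lemma test_seq_block_seq:
  assumes f: "test_seq m B f" shows "block_seq f"
proof -
  have "block_fun (\<lambda>x. lq_norm q' (\<lambda>j. f j x))"
    using block_fun_mono[OF block_fun_cmult(1)[OF v_block, of "real m powr (1 / q') * \<bar>B\<bar>"]]
      test_seq_lq_norm(2)[OF f] by auto
  then show ?thesis using f test_seq_lq_norm(1)[OF f] by (auto simp: block_seq_def test_seq_def)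
qed

section \<open>The pairing as a bounded functional\<close>

lemma morrey_seq_bound_AE_pairing:
  assumes f: "block_seq f" and g: "morrey_seq_bound g S"
  shows "AE x in M. summable (\<lambda>j. g j x * f j x) \<and>
    cmod (\<Sum>j. g j x * f j x) \<le> lq_norm q' (\<lambda>j. f j x) * lq_norm q (\<lambda>j. g j x)"
  using f[unfolded block_seq_def, THEN conjunct2, THEN conjunct1]
    g[unfolded morrey_seq_bound_def, THEN conjunct2, THEN conjunct1]
proof eventually_elim
  case (elim x)
  show ?case using lq_norm_Hoelder[OF q elim(2) elim(1)] by (simp add: mult.commute)
qed

text \<open>Two Hoelder inequalities in succession: pointwise over the index \<open>j\<close>, then
  in \<open>x\<close> through the pairing of block functions with Morrey bounds.\<close>

lemma seq_pairing_bound: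
  assumes f: "block_seq f" and g: "morrey_seq_bound g S"
  shows "integrable M (\<lambda>x. \<Sum>j. g j x * f j x)" "cmod (seq_pairing g f) \<le> S * block_seq_norm f"
proof -
  have [measurable]: "f j \<in> borel_measurable M" "g j \<in> borel_measurable M" for j
    using f g by (auto simp: block_seq_def morrey_seq_bound_def)
  have bf: "block_fun (\<lambda>x. lq_norm q' (\<lambda>j. f j x))" and mb: "morrey_bound (\<lambda>x. lq_norm q (\<lambda>j. g j x)) S"
    using f g by (auto simp: block_seq_def morrey_seq_bound_def)
  note I = block_fun_pairing_integrable[OF bf _ lq_norm_nonneg mb _ lq_norm_nonneg]
  have AE: "AE x in M. norm (\<Sum>j. g j x * f j x) \<le> lq_norm q' (\<lambda>j. f j x) * lq_norm q (\<lambda>j. g j x)"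
    using morrey_seq_bound_AE_pairing[OF f g] by auto
  show int: "integrable M (\<lambda>x. \<Sum>j. g j x * f j x)"
    by (rule Bochner_Integration.integrable_bound[OF I(1)])
      (use AE in \<open>auto simp: abs_mult elim!: eventually_mono\<close>)
  have "cmod (seq_pairing g f) \<le> (\<integral>x. norm (\<Sum>j. g j x * f j x) \<partial>M)"
    unfolding seq_pairing_def by (rule integral_norm_bound)
  also have "\<dots> \<le> (\<integral>x. lq_norm q' (\<lambda>j. f j x) * lq_norm q (\<lambda>j. g j x) \<partial>M)"
    by (rule integral_mono_AE) (use int I(1) AE in auto)
  also have "\<dots> \<le> S * block_seq_norm f" unfolding block_seq_norm_def by (rule I(2)) auto
  finally show "cmod (seq_pairing g f) \<le> S * block_seq_norm f" .
qed

lemma bounded_functional_seq_pairing: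
  assumes g: "morrey_seq_bound g S"
  shows "bounded_functional (seq_pairing g) S"
  unfolding bounded_functional_def
proof (intro conjI allI impI)
  fix f h assume fh: "block_seq f" "block_seq h"
  have [measurable]: "f j \<in> borel_measurable M" "g j \<in> borel_measurable M" "h j \<in> borel_measurable M" for j
    using fh g by (auto simp: block_seq_def morrey_seq_bound_def)
  have "AE x in M. (\<Sum>j. g j x * (f j x + h j x)) = (\<Sum>j. g j x * f j x) + (\<Sum>j. g j x * h j x)"
    using morrey_seq_bound_AE_pairing[OF fh(1) g] morrey_seq_bound_AE_pairing[OF fh(2) g]
    by eventually_elim (auto simp: distrib_left suminf_add)
  then have "seq_pairing g (\<lambda>j x. f j x + h j x) = (\<integral>x. (\<Sum>j. g j x * f j x) + (\<Sum>j. g j x * h j x) \<partial>M)"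
    unfolding seq_pairing_def by (intro integral_cong_AE) measurable
  also have "\<dots> = seq_pairing g f + seq_pairing g h"
    unfolding seq_pairing_def
    by (rule Bochner_Integration.integral_add) (intro seq_pairing_bound(1)[OF _ g] fh)+
  finally show "seq_pairing g (\<lambda>j x. f j x + h j x) = seq_pairing g f + seq_pairing g h" .
next
  fix c f assume f: "block_seq f"
  have [measurable]: "f j \<in> borel_measurable M" "g j \<in> borel_measurable M" for j
    using f g by (auto simp: block_seq_def morrey_seq_bound_def)
  have "AE x in M. (\<Sum>j. g j x * (c * f j x)) = c * (\<Sum>j. g j x * f j x)"
    using morrey_seq_bound_AE_pairing[OF f g]
    by eventually_elim (auto simp: mult.left_commute suminf_mult)
  then have "seq_pairing g (\<lambda>j x. c * f j x) = (\<integral>x. c * (\<Sum>j. g j x * f j x) \<partial>M)"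
    unfolding seq_pairing_def by (intro integral_cong_AE) measurable
  then show "seq_pairing g (\<lambda>j x. c * f j x) = c * seq_pairing g f"
    by (simp add: seq_pairing_def)
qed (rule seq_pairing_bound(2)[OF _ g])

section \<open>Density of the test sequences\<close>

lemma bounded_functional_diff:
  assumes L: "bounded_functional \<Lambda> C" "block_seq f" "block_seq g"
  shows "\<Lambda> (\<lambda>j x. f j x - g j x) = \<Lambda> f - \<Lambda> g"
proof -
  have "\<Lambda> (\<lambda>j x. f j x + (-1) * g j x) = \<Lambda> f + (-1) * \<Lambda> g"
    using L block_seq_cmult(1)[OF L(3), of "-1"] unfolding bounded_functional_def by metis
  then show ?thesis by simp
qed

text \<open>Values that are too large are replaced by 0, so the error is either 0 or
  \<open>f\<close> and hence dominated by \<open>f\<close>. As \<open>v\<close> is positive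
  everywhere, the truncation agrees with \<open>f\<close> at each point and index once
  \<open>n\<close> is large.\<close>

definition truncate_seq :: "nat \<Rightarrow> (nat \<Rightarrow> 'a \<Rightarrow> complex) \<Rightarrow> nat \<Rightarrow> 'a \<Rightarrow> complex" where
  "truncate_seq n f j x = (if j < n \<and> cmod (f j x) \<le> real n * v x then f j x else 0)"

lemma test_seq_truncate:
  assumes "\<And>j. f j \<in> borel_measurable M"
  shows "test_seq n (real n) (truncate_seq n f)"
proof -
  note [measurable] = assms
  have "truncate_seq n f j \<in> borel_measurable M" for j
    unfolding truncate_seq_def by measurable
  then show ?thesis using v_pos by (auto simp: test_seq_def truncate_seq_def less_imp_le)
qed

text \<open>Order continuity of the norm; the pointwise convergence it asks for is dominated
  convergence over the index.\<close>

lemma truncate_seq_tendsto: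
  assumes f: "block_seq f"
  shows "(\<lambda>n. block_seq_norm (\<lambda>j x. f j x - truncate_seq n f j x)) \<longlonglongrightarrow> 0"
  unfolding block_seq_norm_def
proof (rule block_norm_order_continuous)
  show "block_fun (\<lambda>x. lq_norm q' (\<lambda>j. f j x))" using f by (simp add: block_seq_def)
  have m[measurable]: "f j \<in> borel_measurable M" for j using f by (rule block_seq_measurable)
  have [measurable]: "truncate_seq n f j \<in> borel_measurable M" for n j
    using test_seq_truncate[OF m] by (auto simp: test_seq_def)
  show "(\<lambda>x. lq_norm q' (\<lambda>j. f j x)) \<in> borel_measurable M"
    "(\<lambda>x. lq_norm q' (\<lambda>j. f j x - truncate_seq n f j x)) \<in> borel_measurable M" for n by measurable
  have le: "cmod (f j x - truncate_seq n f j x) \<le> cmod (f j x)" for n j x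
    by (auto simp: truncate_seq_def)
  note s = f[unfolded block_seq_def, THEN conjunct2, THEN conjunct1]
  show "AE x in M. lq_norm q' (\<lambda>j. f j x - truncate_seq n f j x) \<le> lq_norm q' (\<lambda>j. f j x)" for n
    using s by eventually_elim (use q' le in \<open>auto intro!: lq_norm_mono(2)\<close>)
  show "AE x in M. (\<lambda>n. lq_norm q' (\<lambda>j. f j x - truncate_seq n f j x)) \<longlonglongrightarrow> 0"
    using s
  proof eventually_elim
    case (elim x)
    show ?case
    proof (rule lq_norm_dominated_tendsto_0[OF _ elim])
      fix j
      obtain N where N: "cmod (f j x) / v x \<le> real N" using real_arch_simple by blast
      have "f j x - truncate_seq n f j x = 0" if n: "n \<ge> max N (Suc j)" for n
      proof -
        have "cmod (f j x) / v x \<le> real n" using N n by (auto intro: order_trans)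
        then have "cmod (f j x) \<le> real n * v x" using v_pos[of x] by (simp add: field_simps)
        then show ?thesis using n by (simp add: truncate_seq_def)
      qed
      then show "(\<lambda>n. f j x - truncate_seq n f j x) \<longlonglongrightarrow> 0"
        by (intro tendsto_eventually eventually_sequentiallyI)
    qed (use q' le in auto)
  qed
qed auto

text \<open>As both functionals agree on each truncation, they differ at \<open>f\<close> by what
  they do on \<open>f\<close> minus its truncation, which tends to 0 in norm. This is the density
  statement behind extension and uniqueness.\<close>

lemma bounded_functional_eqI:
  assumes L: "bounded_functional \<Lambda> C" "bounded_functional \<Lambda>' C'"
    and eq: "\<And>m B f. test_seq m B f \<Longrightarrow> \<Lambda> f = \<Lambda>' f"
    and f: "block_seq f"
  shows "\<Lambda> f = \<Lambda>' f"
proof -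
  define e where "e n = block_seq_norm (\<lambda>j x. f j x - truncate_seq n f j x)" for n
  have t: "test_seq n (real n) (truncate_seq n f)" for n
    by (rule test_seq_truncate) (rule block_seq_measurable[OF f])
  have bt: "block_seq (truncate_seq n f)" for n by (rule test_seq_block_seq[OF t])
  have bd: "block_seq (\<lambda>j x. f j x - truncate_seq n f j x)" for n
    using block_seq_add(1)[OF f block_seq_cmult(1)[OF bt, of "-1" n]] by simp
  have "cmod (\<Lambda> f - \<Lambda>' f) \<le> (C + C') * e n" for n
  proof -
    have "\<Lambda> f - \<Lambda>' f = \<Lambda> (\<lambda>j x. f j x - truncate_seq n f j x) - \<Lambda>' (\<lambda>j x. f j x - truncate_seq n f j x)"
      using bounded_functional_diff[OF L(1) f bt] bounded_functional_diff[OF L(2) f bt] eq[OF t] by simp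
    also have "cmod \<dots> \<le> cmod (\<Lambda> (\<lambda>j x. f j x - truncate_seq n f j x)) + cmod (\<Lambda>' (\<lambda>j x. f j x - truncate_seq n f j x))"
      by (rule norm_triangle_ineq4)
    also have "\<dots> \<le> C * e n + C' * e n"
      unfolding e_def using L bd by (intro add_mono) (auto simp: bounded_functional_def)
    finally show ?thesis by (simp add: distrib_right)
  qed
  moreover have "(\<lambda>n. (C + C') * e n) \<longlonglongrightarrow> (C + C') * 0"
    unfolding e_def by (intro tendsto_mult tendsto_const truncate_seq_tendsto[OF f])
  ultimately have "cmod (\<Lambda> f - \<Lambda>' f) \<le> (C + C') * 0"
    by (intro LIMSEQ_le_const) auto
  then show ?thesis by simp
qed


text \<open>The assumption is integrability of \<open>g j * v\<close>, since this is applied before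
  \<open>g\<close> is known to have a Morrey bound.\<close>

lemma seq_pairing_test_seq:
  assumes f: "test_seq m B f" and [measurable]: "\<And>j. g j \<in> borel_measurable M"
    and int: "\<And>j. integrable M (\<lambda>x. g j x * of_real (v x))"
  shows "integrable M (\<lambda>x. g j x * f j x)" "seq_pairing g f = (\<Sum>j<m. \<integral>x. g j x * f j x \<partial>M)"
proof -
  have f': "f j \<in> borel_measurable M" "\<And>j x. j \<ge> m \<Longrightarrow> f j x = 0" "cmod (f j x) \<le> B * v x" for j x
    using f by (auto simp: test_seq_def)
  note [measurable] = f'(1)
  have *: "integrable M (\<lambda>x. g j x * f j x)" for j
  proof (rule Bochner_Integration.integrable_bound[OF integrable_mult_right[OF int[of j], of "of_real B"]])
    show "AE x in M. norm (g j x * f j x) \<le> norm (of_real B * (g j x * of_real (v x)))"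
    proof (rule AE_I2)
      fix x
      have "cmod (f j x) \<le> \<bar>B\<bar> * v x"
        using f'(3)[of j x] v_pos[of x] by (smt (verit) mult_right_mono)
      then have "cmod (g j x) * cmod (f j x) \<le> cmod (g j x) * (\<bar>B\<bar> * v x)"
        by (intro mult_left_mono) auto
      then show "norm (g j x * f j x) \<le> norm (of_real B * (g j x * of_real (v x)))"
        using v_pos[of x] by (simp add: norm_mult mult_ac)
    qed
  qed measurable
  then show "integrable M (\<lambda>x. g j x * f j x)" .
  have "(\<Sum>j. g j x * f j x) = (\<Sum>j<m. g j x * f j x)" for x
    by (rule suminf_finite) (use f'(2) in \<open>auto simp: not_less\<close>)
  then show "seq_pairing g f = (\<Sum>j<m. \<integral>x. g j x * f j x \<partial>M)"
    unfolding seq_pairing_def using * by simp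
qed

lemma morrey_seq_bound_integrable:
  assumes g: "morrey_seq_bound g S"
  shows "integrable M (\<lambda>x. g j x * of_real (v x))"
proof -
  have [measurable]: "g j \<in> borel_measurable M" for j
    using g by (auto simp: morrey_seq_bound_def)
  have mb: "morrey_bound (\<lambda>x. lq_norm q (\<lambda>j. g j x)) S"
    using g by (auto simp: morrey_seq_bound_def)
  have I: "integrable M (\<lambda>x. v x * lq_norm q (\<lambda>j. g j x))"
    by (rule block_fun_pairing_integrable(1)[OF v_block _ _ mb]) (use v_pos less_imp_le in auto)
  show ?thesis
  proof (rule Bochner_Integration.integrable_bound[OF I])
    show "AE x in M. norm (g j x * of_real (v x)) \<le> norm (v x * lq_norm q (\<lambda>j. g j x))"
      using g[unfolded morrey_seq_bound_def, THEN conjunct2, THEN conjunct1]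
    proof eventually_elim
      case (elim x)
      have "cmod (g j x) \<le> lq_norm q (\<lambda>j. g j x)"
        by (rule lq_norm_ge[OF _ elim]) (use q in simp)
      then show ?case using v_pos[of x] by (simp add: norm_mult abs_mult mult.commute)
    qed
  qed measurable
qed

text \<open>
  The extremal function of the duality between \<open>L\<^sub>p(\<ell>\<^sub>q)\<close> and \<open>L\<^sub>p\<^sub>'(\<ell>\<^sub>q\<^sub>')\<close>, cut off so that it becomes
  a test sequence.
\<close>

lemma truncated_morrey_bound:
  fixes m n i :: nat
  defines "G \<equiv> \<lambda>g x. lq_norm q (\<lambda>j. if j < m then g j x else 0)"
  defines "A \<equiv> \<lambda>g. {x \<in> space M. x \<in> Q i \<and> G g x \<le> real n \<and> 1 \<le> real n * v x}"
  assumes g_meas: "\<And>j. g j \<in> borel_measurable M"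
    and int: "\<And>j. integrable M (\<lambda>x. g j x * of_real (v x))"
    and S: "0 \<le> S"
    and le: "\<And>m B f. test_seq m B f \<Longrightarrow> cmod (seq_pairing g f) \<le> S * block_seq_norm f"
  shows "(\<integral>\<^sup>+x. ennreal (G g x powr p * indicator (A g) x) \<partial>M) \<le> ennreal ((S / \<kappa> i) powr p)"
proof -
  define \<Gamma> where "\<Gamma> = G g"
  define \<A> where "\<A> = A g"
  note [measurable] = g_meas
  have \<Gamma>_def': "\<Gamma> x = lq_norm q (\<lambda>j. if j < m then g j x else 0)" for x by (simp add: \<Gamma>_def G_def)
  have \<A>_def': "\<A> = {x \<in> space M. x \<in> Q i \<and> \<Gamma> x \<le> real n \<and> 1 \<le> real n * v x}"
    by (simp add: \<Gamma>_def \<A>_def A_def)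
  have [measurable]: "\<Gamma> \<in> borel_measurable M"
    unfolding \<Gamma>_def'[abs_def] by measurable
  have \<A>_sets[measurable]: "\<A> \<in> sets M"
    unfolding \<A>_def' by measurable
  have \<A>Q: "x \<in> \<A> \<Longrightarrow> x \<in> Q i" for x by (simp add: \<A>_def')
  have \<Gamma>_nn: "0 \<le> \<Gamma> x" for x by (simp add: \<Gamma>_def')
  have sum: "summable (\<lambda>j. cmod (if j < m then g j x else 0) powr q)" for x
    by (rule lq_norm_finite(1)[of m]) auto
  have \<Gamma>_q: "\<Gamma> x powr q = (\<Sum>j<m. cmod (g j x) powr q)" for x
  proof -
    have "\<Gamma> x powr q = (\<Sum>j. cmod (if j < m then g j x else 0) powr q)"
      unfolding \<Gamma>_def' by (rule lq_norm_powr) (use q sum in auto)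
    also have "\<dots> = (\<Sum>j<m. cmod (if j < m then g j x else 0) powr q)"
      by (rule lq_norm_finite(2)) auto
    finally show ?thesis by simp
  qed
  have g_le: "cmod (g j x) \<le> \<Gamma> x" if "j < m" for j x
    using lq_norm_ge[OF _ sum, of j x] q that by (simp add: \<Gamma>_def')
  \<comment> \<open>The conjugate phase of \<open>g j x\<close>, written as
    \<open>cmod z / z\<close>, which is 0 at \<open>z = 0\<close> by the convention for division. On
    \<open>\<A>\<close> the powers make the products \<open>g j x * f j x\<close> sum to
    \<open>\<Gamma> x powr p\<close> and the \<open>q'\<close>-norm of \<open>f\<close> equal to
    \<open>\<Gamma> x powr (p - 1)\<close>.\<close>
  define f where "f j x = (if j < m \<and> x \<in> \<A> then (of_real (cmod (g j x)) / g j x) * of_real (cmod (g j x) powr (q-1) * \<Gamma> x powr (p-q)) else 0)" for j x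
  have [measurable]: "f j \<in> borel_measurable M" for j
    unfolding f_def by measurable
  have f_norm: "cmod (f j x) = cmod (g j x) powr (q-1) * \<Gamma> x powr (p-q)" if "j < m" "x \<in> \<A>" for j x
    using that by (simp add: f_def norm_mult norm_divide)
  \<comment> \<open>Both cut-offs in \<open>\<A>\<close> act here: \<open>\<Gamma> x \<le> n\<close>
    bounds the value by a constant, and \<open>1 \<le> n * v x\<close> turns the constant into a
    multiple of \<open>v x\<close>.\<close>
  have f_le: "cmod (f j x) \<le> (real n powr (p - 1) * real n) * v x" for j x
  proof (cases "j < m \<and> x \<in> \<A>")
    case True
    have "cmod (g j x) powr (q-1) * \<Gamma> x powr (p-q) \<le> \<Gamma> x powr (q-1) * \<Gamma> x powr (p-q)"
      using g_le True q by (intro mult_right_mono powr_mono2) auto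
    also have "\<dots> = \<Gamma> x powr (p - 1)" by (simp flip: powr_add)
    also have "\<dots> \<le> real n powr (p - 1)"
      using True p \<Gamma>_nn by (intro powr_mono2) (auto simp: \<A>_def')
    also have "\<dots> \<le> real n powr (p - 1) * (real n * v x)"
      using True mult_left_mono[of 1 "real n * v x" "real n powr (p - 1)"] by (auto simp: \<A>_def')
    finally show ?thesis using f_norm True by (simp add: mult.assoc)
  next
    case False
    then show ?thesis using v_pos[of x] by (auto simp: f_def intro!: mult_nonneg_nonneg less_imp_le)
  qed
  have f: "test_seq m (real n powr (p - 1) * real n) f"
    using f_le by (auto simp: test_seq_def f_def)
  have f_lq: "lq_norm q' (\<lambda>j. f j x) = \<Gamma> x powr (p - 1) * indicator \<A> x" for x
  proof (cases "x \<in> \<A>")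
    case True
    have "(\<Sum>j. cmod (f j x) powr q') = (\<Sum>j<m. cmod (f j x) powr q')"
      by (rule lq_norm_finite(2)) (auto simp: f_def)
    also have "\<dots> = (\<Sum>j<m. cmod (g j x) powr q * \<Gamma> x powr ((p - q) * q'))"
    proof (rule sum.cong)
      fix j assume "j \<in> {..<m}"
      then have "cmod (f j x) powr q' = cmod (g j x) powr ((q - 1) * q') * \<Gamma> x powr ((p - q) * q')"
        using f_norm[of j x] True by (simp add: powr_mult powr_powr)
      then show "cmod (f j x) powr q' = cmod (g j x) powr q * \<Gamma> x powr ((p - q) * q')"
        using conjugate_exponent_eq[OF q] by simp
    qed simp
    also have "\<dots> = \<Gamma> x powr q * \<Gamma> x powr ((p - q) * q')"
      by (simp add: \<Gamma>_q sum_distrib_right)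
    also have "\<dots> = \<Gamma> x powr ((p - 1) * q')"
      using conjugate_exponent_eq[OF q] by (simp flip: powr_add add: algebra_simps)
    finally show ?thesis using True q' by (simp add: lq_norm_def powr_powr)
  next
    case False
    then show ?thesis by (simp add: f_def lq_norm_def)
  qed
  \<comment> \<open>Finiteness of the integral \<open>J\<close> below is a purpose of the
    truncation: the concluding step cancels a power of \<open>J\<close>.\<close>
  have fin: "integrable M (\<lambda>x. \<Gamma> x powr p * indicator \<A> x)"
  proof (rule Bochner_Integration.integrable_bound)
    have "emeasure M \<A> \<le> emeasure M (Q i)" by (rule emeasure_mono) (auto simp: \<A>Q)
    then have "emeasure M \<A> < \<infinity>" using Q_finite[of i] by (rule le_less_trans)
    then show "integrable M (\<lambda>x. real n powr p * indicator \<A> x :: real)" by simp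
    show "AE x in M. norm (\<Gamma> x powr p * indicator \<A> x) \<le> norm (real n powr p * indicator \<A> x :: real)"
      using p \<Gamma>_nn by (intro AE_I2) (auto simp: \<A>_def' indicator_def intro!: powr_mono2)
  qed measurable
  define J where "J = (\<integral>x. \<Gamma> x powr p * indicator \<A> x \<partial>M)"
  have J_nn: "0 \<le> J" unfolding J_def by (rule integral_nonneg_AE) auto
  have J: "(\<integral>\<^sup>+x. ennreal (\<Gamma> x powr p * indicator \<A> x) \<partial>M) = ennreal J"
    unfolding J_def by (rule nn_integral_eq_integral[OF fin]) auto
  have pair: "seq_pairing g f = of_real J"
  proof -
    have "(\<Sum>j. g j x * f j x) = of_real (\<Gamma> x powr p * indicator \<A> x)" for x
    proof (cases "x \<in> \<A>")
      case True
      have "(\<Sum>j. g j x * f j x) = (\<Sum>j<m. g j x * f j x)"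
        by (rule suminf_finite) (auto simp: f_def)
      also have "\<dots> = (\<Sum>j<m. of_real (cmod (g j x) powr q * \<Gamma> x powr (p - q)))"
      proof (rule sum.cong)
        fix j assume "j \<in> {..<m}"
        then have "g j x * f j x = (g j x * (of_real (cmod (g j x)) / g j x)) * of_real (cmod (g j x) powr (q-1) * \<Gamma> x powr (p-q))"
          using True by (simp add: f_def)
        also have "\<dots> = of_real (cmod (g j x) * (cmod (g j x) powr (q-1) * \<Gamma> x powr (p-q)))"
          by (cases "g j x = 0") simp_all
        also have "cmod (g j x) * (cmod (g j x) powr (q-1) * \<Gamma> x powr (p-q)) = cmod (g j x) powr q * \<Gamma> x powr (p - q)"
          using powr_add[of "cmod (g j x)" 1 "q - 1"] by simp
        finally show "g j x * f j x = of_real (cmod (g j x) powr q * \<Gamma> x powr (p - q))" .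
      qed simp
      also have "\<dots> = of_real (\<Gamma> x powr q * \<Gamma> x powr (p - q))"
        by (simp add: \<Gamma>_q sum_distrib_right)
      also have "\<Gamma> x powr q * \<Gamma> x powr (p - q) = \<Gamma> x powr p" by (simp flip: powr_add)
      finally show ?thesis using True by simp
    next
      case False
      then show ?thesis by (simp add: f_def)
    qed
    then show ?thesis unfolding seq_pairing_def J_def by (simp only: integral_complex_of_real)
  qed
  \<comment> \<open>By \<open>(p - 1) * p' = p\<close> the \<open>p'\<close>-th power of the
    \<open>q'\<close>-norm of \<open>f\<close> integrates to \<open>J\<close>, and \<open>f\<close>
    lives in the single set \<open>Q i\<close>.\<close>
  define T where "T = J powr (1 / p') / \<kappa> i"
  have "block_seq_norm f \<le> T"
    unfolding block_seq_norm_def f_lq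
  proof (rule block_norm_single_le)
    have "(\<integral>\<^sup>+x. ennreal ((\<Gamma> x powr (p - 1) * indicator \<A> x) powr p') \<partial>M) =
        (\<integral>\<^sup>+x. ennreal (\<Gamma> x powr p * indicator \<A> x) \<partial>M)"
      using conjugate_exponent_eq[OF p] by (intro nn_integral_cong) (auto simp: indicator_def powr_powr)
    also have "\<dots> = ennreal ((\<kappa> i * T) powr p')"
      using J J_nn \<kappa>_pos[of i] p' by (simp add: T_def powr_powr)
    finally show "(\<integral>\<^sup>+x. ennreal ((\<Gamma> x powr (p - 1) * indicator \<A> x) powr p') \<partial>M)
        \<le> ennreal ((\<kappa> i * T) powr p')" by simp
    show "0 \<le> T" using \<kappa>_pos[of i] by (simp add: T_def)
  qed (use \<A>Q in \<open>auto simp: indicator_def\<close>)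
  then have "S * block_seq_norm f \<le> S * T" using S by (rule mult_left_mono)
  then have J_le: "J \<le> S * T" using le[OF f] J_nn by (simp add: pair)
  \<comment> \<open>From \<open>J \<le> S * J powr (1 / p') / \<kappa> i\<close>, cancelling
    \<open>J powr (1 / p')\<close> leaves
    \<open>J powr (1 / p) \<le> S / \<kappa> i\<close>.\<close>
  have "J \<le> (S / \<kappa> i) powr p"
  proof (cases "J = 0")
    case False
    then have Jpos: "0 < J" using J_nn by simp
    have "1 = 1 / p' + 1 / p" using p by simp
    then have "J = J powr (1 / p') * J powr (1 / p)"
      using Jpos powr_add[of J "1 / p'" "1 / p"] by simp
    then have "J powr (1 / p') * J powr (1 / p) \<le> J powr (1 / p') * (S / \<kappa> i)"
      using J_le by (simp add: T_def mult.commute)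
    then have "J powr (1 / p) \<le> S / \<kappa> i"
      by (rule mult_left_le_imp_le) (use Jpos in simp)
    then have "(J powr (1 / p)) powr p \<le> (S / \<kappa> i) powr p" using p by (intro powr_mono2) auto
    then show ?thesis using p J_nn by (simp add: powr_powr)
  qed simp
  then show ?thesis using J by (simp add: \<Gamma>_def \<A>_def ennreal_leI)
qed

text \<open>Converse of the pairing estimate. The truncations are removed by Fatou in two stages,
  first the cut-off \<open>n\<close> and then the number \<open>m\<close> of components;
  \<open>q\<close>-summability of \<open>g\<close> is not given and has to come out in
  between.\<close>

lemma morrey_seq_boundI:
  assumes g_meas: "\<And>j. g j \<in> borel_measurable M"
    and int: "\<And>j. integrable M (\<lambda>x. g j x * of_real (v x))"
    and S: "0 \<le> S"
    and le: "\<And>m B f. test_seq m B f \<Longrightarrow> cmod (seq_pairing g f) \<le> S * block_seq_norm f"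
  shows "morrey_seq_bound g S"
proof -
  note [measurable] = g_meas
  define G where "G m x = lq_norm q (\<lambda>j. if j < m then g j x else 0)" for m x
  have [measurable]: "G m \<in> borel_measurable M" for m
    unfolding G_def by measurable
  have G_nn: "0 \<le> G m x" for m x by (simp add: G_def)
  have G_q: "G m x powr q = (\<Sum>j<m. cmod (g j x) powr q)" for m x
  proof -
    have s: "summable (\<lambda>j. cmod (if j < m then g j x else 0) powr q)"
      by (rule lq_norm_finite(1)[of m]) auto
    have "G m x powr q = (\<Sum>j. cmod (if j < m then g j x else 0) powr q)"
      unfolding G_def by (rule lq_norm_powr) (use q s in auto)
    also have "\<dots> = (\<Sum>j<m. cmod (if j < m then g j x else 0) powr q)"
      by (rule lq_norm_finite(2)) auto
    finally show ?thesis by simp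
  qed
  have G_eq: "G m x = (\<Sum>j<m. cmod (g j x) powr q) powr (1 / q)" for m x
    using powr_powr_cancel(2)[OF G_nn, of q m x] q by (simp add: G_q)
  have step: "(\<integral>\<^sup>+x. ennreal (G m x powr p * indicator (Q i) x) \<partial>M) \<le> ennreal ((S / \<kappa> i) powr p)" for m i
  proof (rule nn_integral_limit_le)
    define A where "A n = {x \<in> space M. x \<in> Q i \<and> G m x \<le> real n \<and> 1 \<le> real n * v x}" for n
    have [measurable]: "A n \<in> sets M" for n unfolding A_def by measurable
    show "(\<lambda>x. ennreal (G m x powr p * indicator (A n) x)) \<in> borel_measurable M" for n by measurable
    show "(\<integral>\<^sup>+x. ennreal (G m x powr p * indicator (A n) x) \<partial>M) \<le> ennreal ((S / \<kappa> i) powr p)" for n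
      using truncated_morrey_bound[where m = m and n = n and i = i, OF g_meas int S le]
      by (simp add: G_def A_def)
    show "AE x in M. (\<lambda>n. ennreal (G m x powr p * indicator (A n) x)) \<longlonglongrightarrow>
        ennreal (G m x powr p * indicator (Q i) x)"
    proof (rule AE_I2)
      fix x assume x: "x \<in> space M"
      obtain N1 where N1: "G m x \<le> real N1" using real_arch_simple by blast
      obtain N2 where N2: "1 / v x \<le> real N2" using real_arch_simple by blast
      have "indicator (A n) x = (indicator (Q i) x :: real)" if n: "n \<ge> max N1 N2" for n
      proof -
        have "G m x \<le> real n" "1 / v x \<le> real n" using N1 N2 n by auto
        then show ?thesis using x v_pos[of x] by (auto simp: A_def indicator_def field_simps)
      qed
      then show "(\<lambda>n. ennreal (G m x powr p * indicator (A n) x)) \<longlonglongrightarrow>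
        ennreal (G m x powr p * indicator (Q i) x)"
        by (intro tendsto_eventually eventually_sequentiallyI[of "max N1 N2"]) simp
    qed
  qed
  \<comment> \<open>The norms of the first \<open>m\<close> components increase with
    \<open>m\<close>, so by monotone convergence their supremum is finite almost everywhere on
    \<open>Q i\<close>, and bounded partial sums of nonnegative terms converge.\<close>
  have AE_Q: "AE x in M. x \<in> Q i \<longrightarrow> summable (\<lambda>j. cmod (g j x) powr q)" for i
  proof -
    have inc: "incseq (\<lambda>m x. ennreal (G m x powr p * indicator (Q i) x))"
    proof (intro incseq_SucI le_funI ennreal_leI mult_right_mono powr_mono2)
      fix m x
      show "G m x \<le> G (Suc m) x"
        unfolding G_eq using q by (intro powr_mono2) (auto intro!: sum_nonneg)
    qed (use p G_nn in auto)
    have "(\<integral>\<^sup>+x. (SUP m. ennreal (G m x powr p * indicator (Q i) x)) \<partial>M)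
        = (SUP m. \<integral>\<^sup>+x. ennreal (G m x powr p * indicator (Q i) x) \<partial>M)"
      by (rule nn_integral_monotone_convergence_SUP[OF inc]) measurable
    also have "\<dots> \<le> ennreal ((S / \<kappa> i) powr p)" by (intro SUP_least step)
    finally have "(\<integral>\<^sup>+x. (SUP m. ennreal (G m x powr p * indicator (Q i) x)) \<partial>M) \<noteq> \<infinity>"
      by (auto simp: top_unique)
    then have "AE x in M. (SUP m. ennreal (G m x powr p * indicator (Q i) x)) \<noteq> \<infinity>"
      by (intro nn_integral_noteq_infinite) auto
    then show ?thesis
    proof eventually_elim
      case (elim x)
      show ?case
      proof
        assume x: "x \<in> Q i"
        obtain H where H: "0 \<le> H" "(SUP m. ennreal (G m x powr p * indicator (Q i) x)) = ennreal H"
          using elim by (cases "SUP m. ennreal (G m x powr p * indicator (Q i) x)") auto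
        have "(\<Sum>j<m. cmod (g j x) powr q) \<le> (H powr (1 / p)) powr q" for m
        proof -
          have "ennreal (G m x powr p * indicator (Q i) x) \<le> ennreal H"
            unfolding H(2)[symmetric] by (rule SUP_upper) simp
          then have "G m x powr p \<le> H" using x H(1) by simp
          then have "(G m x powr p) powr (1 / p) \<le> H powr (1 / p)"
            using p by (intro powr_mono2) auto
          then have "G m x \<le> H powr (1 / p)" using p G_nn by (simp add: powr_powr)
          then have "G m x powr q \<le> (H powr (1 / p)) powr q"
            using q G_nn by (intro powr_mono2) auto
          then show ?thesis by (simp add: G_q)
        qed
        then show "summable (\<lambda>j. cmod (g j x) powr q)"
          by (intro summableI_nonneg_bounded) auto
      qed
    qed
  qed
  have sum: "AE x in M. summable (\<lambda>j. cmod (g j x) powr q)"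
  proof -
    have "AE x in M. \<forall>i. x \<in> Q i \<longrightarrow> summable (\<lambda>j. cmod (g j x) powr q)"
      unfolding AE_all_countable by (intro allI AE_Q)
    then show ?thesis using AE_space by eventually_elim (use Q_cover in blast)
  qed
  have "morrey_bound (\<lambda>x. lq_norm q (\<lambda>j. g j x)) S"
    unfolding morrey_bound_def
  proof (intro conjI allI S)
    fix i
    show "(\<integral>\<^sup>+x. ennreal (lq_norm q (\<lambda>j. g j x) powr p * indicator (Q i) x) \<partial>M) \<le> ennreal ((S / \<kappa> i) powr p)"
    proof (rule nn_integral_limit_le[OF _ _ step])
      show "AE x in M. (\<lambda>m. ennreal (G m x powr p * indicator (Q i) x)) \<longlonglongrightarrow>
         ennreal (lq_norm q (\<lambda>j. g j x) powr p * indicator (Q i) x)"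
        using sum
      proof eventually_elim
        case (elim x)
        have "(\<lambda>m. G m x) \<longlonglongrightarrow> lq_norm q (\<lambda>j. g j x)"
          unfolding G_eq lq_norm_def using q elim
          by (intro tendsto_powr') (auto intro!: summable_LIMSEQ always_eventually sum_nonneg)
        then have "(\<lambda>m. G m x powr p) \<longlonglongrightarrow> lq_norm q (\<lambda>j. g j x) powr p"
          using p G_nn by (intro tendsto_powr') auto
        then show ?case by (intro tendsto_ennrealI tendsto_mult tendsto_const)
      qed
    qed measurable
  qed
  then show ?thesis using sum g_meas by (simp add: morrey_seq_bound_def)
qed


section \<open>Representation of bounded functionals\<close>

lemma bounded_functionalD:
  assumes "bounded_functional \<Lambda> C"
  shows "block_seq f \<Longrightarrow> block_seq g \<Longrightarrow> \<Lambda> (\<lambda>j x. f j x + g j x) = \<Lambda> f + \<Lambda> g"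
    "block_seq f \<Longrightarrow> \<Lambda> (\<lambda>j x. c * f j x) = c * \<Lambda> f"
    "block_seq f \<Longrightarrow> cmod (\<Lambda> f) \<le> C * block_seq_norm f"
  using assms by (auto simp: bounded_functional_def)

text \<open>The factor \<open>v\<close> lets \<open>\<psi>\<close> range over bounded measurable
  functions on the whole space, indicators of arbitrary measurable sets included, with finite
  norm.\<close>

definition single_seq :: "nat \<Rightarrow> ('a \<Rightarrow> complex) \<Rightarrow> nat \<Rightarrow> 'a \<Rightarrow> complex" where
  "single_seq j \<psi> k x = (if k = j then \<psi> x * of_real (v x) else 0)"

lemma single_seq_add: "single_seq j (\<lambda>x. \<psi> x + \<phi> x) = (\<lambda>k x. single_seq j \<psi> k x + single_seq j \<phi> k x)"
  and single_seq_cmult: "single_seq j (\<lambda>x. c * \<psi> x) = (\<lambda>k x. c * single_seq j \<psi> k x)"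
  by (auto simp: single_seq_def fun_eq_iff distrib_right)

lemma block_seq_single_seq:
  assumes [measurable]: "\<psi> \<in> borel_measurable M" and B: "\<And>x. x \<in> space M \<Longrightarrow> cmod (\<psi> x) \<le> B"
  shows "block_seq (single_seq j \<psi>)" "block_seq_norm (single_seq j \<psi>) = block_norm (\<lambda>x. cmod (\<psi> x) * v x)"
proof -
  have eq: "(\<lambda>x. cmod (\<psi> x * of_real (v x))) = (\<lambda>x. cmod (\<psi> x) * v x)"
    using v_pos by (auto simp: norm_mult less_imp_le)
  have "AE x in M. cmod (\<psi> x) * v x \<le> \<bar>B\<bar> * v x"
  proof (rule AE_I2)
    fix x assume "x \<in> space M"
    then have "cmod (\<psi> x) \<le> \<bar>B\<bar>" using B[of x] by linarith
    then show "cmod (\<psi> x) * v x \<le> \<bar>B\<bar> * v x" using v_pos[of x] by (intro mult_right_mono) auto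
  qed
  then have "block_fun (\<lambda>x. cmod (\<psi> x) * v x)"
    by (rule block_fun_mono[OF block_fun_cmult(1)[OF v_block], rotated]) simp
  then show "block_seq (single_seq j \<psi>)" "block_seq_norm (single_seq j \<psi>) = block_norm (\<lambda>x. cmod (\<psi> x) * v x)"
    using block_seq_single[of "\<lambda>x. \<psi> x * of_real (v x)" j] by (simp_all add: eq single_seq_def[abs_def])
qed

lemma bounded_functional_density:
  assumes L: "bounded_functional \<Lambda> C"
  shows "\<exists>h :: 'a \<Rightarrow> complex. integrable M h \<and>
    (\<forall>A\<in>sets M. \<Lambda> (single_seq j (indicator A)) = (\<integral>x. indicator A x * h x \<partial>M))"
proof -
  note LD = bounded_functionalD[OF L]
  define \<nu> where "\<nu> A = \<Lambda> (single_seq j (indicator A))" for A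
  \<comment> \<open>The absolute value is taken because \<open>bounded_functional\<close> admits a
    negative \<open>C\<close>. Monotonicity, invariance under null sets and order continuity of the
    block norm are what the density lemma asks of \<open>\<tau>\<close>; real and imaginary part
    share it.\<close>
  define \<tau> where "\<tau> A = \<bar>C\<bar> * block_norm (\<lambda>x. indicator A x * v x)" for A :: "'a set"
  have b: "block_seq (single_seq j (indicator A))"
    "block_seq_norm (single_seq j (indicator A)) = block_norm (\<lambda>x. indicator A x * v x)" if "A \<in> sets M" for A
  proof -
    have e: "cmod (indicator A x) = indicator A x" for x by (simp add: indicator_def)
    have "cmod (indicator A x) \<le> 1" for x by (simp add: indicator_def)
    then show "block_seq (single_seq j (indicator A))"
      "block_seq_norm (single_seq j (indicator A)) = block_norm (\<lambda>x. indicator A x * v x)"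
      using block_seq_single_seq[of "indicator A" 1 j] that unfolding e by auto
  qed
  have bf: "block_fun (\<lambda>x. indicator A x * v x)" for A
    by (rule block_fun_mono[OF v_block]) (use v_pos less_imp_le in \<open>auto simp: indicator_def\<close>)
  have add: "\<nu> (A \<union> B) = \<nu> A + \<nu> B" if AB: "A \<in> sets M" "B \<in> sets M" "A \<inter> B = {}" for A B
  proof -
    have "(indicator (A \<union> B) :: 'a \<Rightarrow> complex) = (\<lambda>x. indicator A x + indicator B x)"
      using AB by (auto simp: indicator_def fun_eq_iff)
    then show ?thesis
      unfolding \<nu>_def using LD(1)[OF b(1)[OF AB(1)] b(1)[OF AB(2)]] by (simp add: single_seq_add)
  qed
  have bound: "cmod (\<nu> A) \<le> \<tau> A" if A: "A \<in> sets M" for A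
  proof -
    have "cmod (\<nu> A) \<le> C * block_norm (\<lambda>x. indicator A x * v x)"
      unfolding \<nu>_def using LD(3)[OF b(1)[OF A]] b(2)[OF A] by simp
    also have "\<dots> \<le> \<tau> A"
      unfolding \<tau>_def using block_norm_nonneg[OF bf] by (intro mult_right_mono) auto
    finally show ?thesis .
  qed
  have mono: "\<tau> A \<le> \<tau> B" if "A \<subseteq> B" for A B
    unfolding \<tau>_def
    by (intro mult_left_mono block_norm_mono[OF bf])
      (use that v_pos less_imp_le in \<open>auto simp: indicator_def\<close>)
  have null: "\<tau> A = 0" if "A \<in> null_sets M" for A
  proof -
    have "block_norm (\<lambda>x. indicator A x * v x) = block_norm (\<lambda>x. 0)"
      by (rule block_norm_cong) (use AE_not_in[OF that] in \<open>eventually_elim, simp\<close>)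
    then show ?thesis by (simp add: \<tau>_def block_norm_zero)
  qed
  have cont: "(\<lambda>i. \<tau> (A i)) \<longlonglongrightarrow> 0"
    if A: "range A \<subseteq> sets M" "decseq A" "(\<Inter>i. A i) = {}" for A
  proof -
    have [measurable]: "A i \<in> sets M" for i using A by auto
    have "(\<lambda>i. block_norm (\<lambda>x. indicator (A i) x * v x)) \<longlonglongrightarrow> 0"
    proof (rule block_norm_order_continuous[OF v_block])
      show "AE x in M. (\<lambda>i. indicator (A i) x * v x) \<longlonglongrightarrow> 0"
      proof (rule AE_I2)
        fix x
        obtain i where "x \<notin> A i" using A(3) by auto
        then have "indicator (A k) x * v x = 0" if "k \<ge> i" for k
          using A(2) that by (auto simp: decseq_def indicator_def)
        then show "(\<lambda>i. indicator (A i) x * v x) \<longlonglongrightarrow> 0"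
          by (intro tendsto_eventually eventually_sequentiallyI)
      qed
      show "AE x in M. indicator (A n) x * v x \<le> v x" "0 \<le> indicator (A n) x * v x" for n x
        using v_pos less_imp_le by (auto simp: indicator_def)
    qed measurable
    then have "(\<lambda>i. \<bar>C\<bar> * block_norm (\<lambda>x. indicator (A i) x * v x)) \<longlonglongrightarrow> \<bar>C\<bar> * 0"
      by (rule tendsto_mult_left)
    then show ?thesis by (simp add: \<tau>_def)
  qed
  have "\<exists>h. integrable M h \<and> (\<forall>A\<in>sets M. Re (\<nu> A) = (\<integral>x. indicator A x * h x \<partial>M))"
    by (rule signed_set_function_density[of _ \<tau>])
      (use add mono null cont order_trans[OF abs_Re_le_cmod bound] in auto)
  then obtain h1 where h1: "integrable M h1" "\<And>A. A \<in> sets M \<Longrightarrow> Re (\<nu> A) = (\<integral>x. indicator A x * h1 x \<partial>M)"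
    by blast
  have "\<exists>h. integrable M h \<and> (\<forall>A\<in>sets M. Im (\<nu> A) = (\<integral>x. indicator A x * h x \<partial>M))"
    by (rule signed_set_function_density[of _ \<tau>])
      (use add mono null cont order_trans[OF abs_Im_le_cmod bound] in auto)
  then obtain h2 where h2: "integrable M h2" "\<And>A. A \<in> sets M \<Longrightarrow> Im (\<nu> A) = (\<integral>x. indicator A x * h2 x \<partial>M)"
    by blast
  show ?thesis
  proof (intro exI[of _ "\<lambda>x. of_real (h1 x) + \<i> * of_real (h2 x)"] conjI ballI)
    show "integrable M (\<lambda>x. of_real (h1 x) + \<i> * of_real (h2 x) :: complex)"
      using h1(1) h2(1) by (intro Bochner_Integration.integrable_add integrable_mult_right integrable_of_real)
    fix A assume A: "A \<in> sets M"
    have i: "integrable M (\<lambda>x. indicator A x * h1 x)" "integrable M (\<lambda>x. indicator A x * h2 x)"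
      using integrable_mult_indicator[OF A h1(1)] integrable_mult_indicator[OF A h2(1)] by simp_all
    have "(\<integral>x. indicator A x * (of_real (h1 x) + \<i> * of_real (h2 x)) \<partial>M)
        = (\<integral>x. of_real (indicator A x * h1 x) + \<i> * of_real (indicator A x * h2 x) \<partial>M)"
      by (rule Bochner_Integration.integral_cong) (auto simp: indicator_def)
    also have "\<dots> = (\<integral>x. of_real (indicator A x * h1 x) \<partial>M) + (\<integral>x. \<i> * of_real (indicator A x * h2 x) \<partial>M)"
      by (rule Bochner_Integration.integral_add)
        (intro integrable_mult_right integrable_of_real i)+
    also have "\<dots> = of_real (Re (\<nu> A)) + \<i> * of_real (Im (\<nu> A))"
      unfolding h1(2)[OF A] h2(2)[OF A] by (simp only: integral_mult_right_zero integral_complex_of_real)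
    also have "\<dots> = \<nu> A" by (simp flip: complex_eq)
    finally show "\<Lambda> (single_seq j (indicator A)) = (\<integral>x. indicator A x * (of_real (h1 x) + \<i> * of_real (h2 x)) \<partial>M)"
      by (simp add: \<nu>_def)
  qed
qed

lemma integrable_bounded_mult:
  fixes h :: "'a \<Rightarrow> complex"
  assumes h: "integrable M h" and [measurable]: "\<psi> \<in> borel_measurable M"
    and B: "\<And>x. x \<in> space M \<Longrightarrow> cmod (\<psi> x) \<le> B"
  shows "integrable M (\<lambda>x. \<psi> x * h x)"
proof (rule Bochner_Integration.integrable_bound)
  show "integrable M (\<lambda>x. of_real B * h x)" using h by (rule integrable_mult_right)
  show "(\<lambda>x. \<psi> x * h x) \<in> borel_measurable M" using h by measurable
  show "AE x in M. norm (\<psi> x * h x) \<le> norm (of_real B * h x)"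
    using B by (intro AE_I2) (auto simp: norm_mult intro!: mult_right_mono order_trans[OF _ abs_ge_self])
qed

text \<open>The step from indicators to bounded functions. In the limit case the functional
  converges by order continuity of the norm and the integral by dominated convergence, the bound
  being inherited by all approximants.\<close>

lemma bounded_functional_eq_integral_nonneg:
  assumes L: "bounded_functional \<Lambda> C" and h: "integrable M h"
    and ind: "\<And>A. A \<in> sets M \<Longrightarrow> \<Lambda> (single_seq j (indicator A)) = (\<integral>x. indicator A x * h x \<partial>M)"
    and u: "u \<in> borel_measurable M" "\<And>x. 0 \<le> u x" "\<And>x. x \<in> space M \<Longrightarrow> u x \<le> B"
  shows "\<Lambda> (single_seq j (\<lambda>x. of_real (u x))) = (\<integral>x. of_real (u x) * h x \<partial>M)"
proof -
  note LD = bounded_functionalD[OF L]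
  have bs: "block_seq (single_seq j (\<lambda>x. of_real (u x)))"
    "block_seq_norm (single_seq j (\<lambda>x. of_real (u x))) = block_norm (\<lambda>x. u x * v x)"
    "integrable M (\<lambda>x. of_real (u x) * h x)"
    if "u \<in> borel_measurable M" "\<And>x. 0 \<le> u x" "\<And>x. x \<in> space M \<Longrightarrow> u x \<le> B" for u B
    using block_seq_single_seq[of "\<lambda>x. of_real (u x)" B j] that
      integrable_bounded_mult[OF h, of "\<lambda>x. of_real (u x)" B] by auto
  note [measurable] = borel_measurable_integrable[OF h]
  \<comment> \<open>The bound \<open>B\<close> is quantified inside \<open>P\<close>, since the
    induction runs over all nonnegative measurable functions and the bound changes under
    scaling.\<close>
  define P where "P u \<longleftrightarrow> (\<forall>B. (\<forall>x\<in>space M. u x \<le> B) \<longrightarrow>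
      \<Lambda> (single_seq j (\<lambda>x. of_real (u x))) = (\<integral>x. of_real (u x) * h x \<partial>M))" for u :: "'a \<Rightarrow> real"
  have "P u"
    using u(1,2)
  proof (induction u rule: borel_measurable_induct_real)
    case (set A)
    have e: "(of_real (indicator A x) :: complex) = indicator A x" for x by (simp add: indicator_def)
    show ?case unfolding P_def e using ind[OF set] by simp
  next
    case (mult u c)
    show ?case
      unfolding P_def
    proof (intro allI impI)
      fix B assume B: "\<forall>x\<in>space M. c * u x \<le> B"
      show "\<Lambda> (single_seq j (\<lambda>x. of_real (c * u x))) = (\<integral>x. of_real (c * u x) * h x \<partial>M)"
      \<comment> \<open>For \<open>c = 0\<close> a bound on \<open>c * u\<close> says nothing about
        \<open>u\<close>.\<close>
      proof (cases "c = 0")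
        case True
        \<comment> \<open>The zero sequence is written as a multiple by 0, so that homogeneity
          yields the value 0.\<close>
        have "single_seq j (\<lambda>x. 0) = (\<lambda>k x. 0 * 0)" by (auto simp: single_seq_def fun_eq_iff)
        then show ?thesis using True LD(2)[OF block_seq_zero(1), of 0] by simp
      next
        case False
        then have "\<forall>x\<in>space M. u x \<le> B / c" using B mult(1) by (auto simp: field_simps)
        then have "\<Lambda> (single_seq j (\<lambda>x. of_real (u x))) = (\<integral>x. of_real (u x) * h x \<partial>M)"
          "block_seq (single_seq j (\<lambda>x. of_real (u x)))"
          using mult bs[of u "B / c"] unfolding P_def by auto
        then show ?thesis
          using LD(2)[of "single_seq j (\<lambda>x. of_real (u x))" "of_real c"]
          by (simp add: single_seq_cmult mult.assoc)
      qed
    qed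
  next
    case (add u w)
    show ?case
      unfolding P_def
    proof (intro allI impI)
      fix B assume B: "\<forall>x\<in>space M. w x + u x \<le> B"
      have Bu: "u x \<le> B" "w x \<le> B" if "x \<in> space M" for x
        using B[rule_format, OF that] add(2)[of x] add(4)[of x] by linarith+
      have "\<Lambda> (single_seq j (\<lambda>x. of_real (w x + u x))) = \<Lambda> (single_seq j (\<lambda>x. of_real (w x))) + \<Lambda> (single_seq j (\<lambda>x. of_real (u x)))"
        using LD(1)[OF bs(1)[of w B] bs(1)[of u B]] add Bu by (simp add: single_seq_add)
      also have "\<dots> = (\<integral>x. of_real (w x) * h x \<partial>M) + (\<integral>x. of_real (u x) * h x \<partial>M)"
      proof -
        have "\<Lambda> (single_seq j (\<lambda>x. of_real (w x))) = (\<integral>x. of_real (w x) * h x \<partial>M)"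
          using add.IH Bu(2) unfolding P_def by blast
        moreover have "\<Lambda> (single_seq j (\<lambda>x. of_real (u x))) = (\<integral>x. of_real (u x) * h x \<partial>M)"
          using add.IH Bu(1) unfolding P_def by blast
        ultimately show ?thesis by simp
      qed
      also have "\<dots> = (\<integral>x. of_real (w x) * h x + of_real (u x) * h x \<partial>M)"
        by (rule Bochner_Integration.integral_add[symmetric]) (use bs(3) add Bu in auto)
      finally show "\<Lambda> (single_seq j (\<lambda>x. of_real (w x + u x))) = (\<integral>x. of_real (w x + u x) * h x \<partial>M)"
        by (simp add: distrib_right)
    qed
  next
    case (seq U)
    note U_meas[measurable] = seq(1)
    have [measurable]: "u \<in> borel_measurable M" by (rule u(1))
    show ?case
      unfolding P_def
    proof (intro allI impI)
      fix B assume B: "\<forall>x\<in>space M. u x \<le> B"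
      have Uu: "U i x \<le> u x" if "x \<in> space M" for i x
        using seq(3) incseq_le[of "\<lambda>i. U i x" "u x" i] seq(4)[OF that] by (simp add: incseq_def le_fun_def)
      then have UB: "U i x \<le> B" if "x \<in> space M" for i x
        using B that by (meson order_trans)
      have u_nn: "0 \<le> u x" for x by (rule u(2))
      have bu: "block_seq (single_seq j (\<lambda>x. of_real (u x)))" using bs(1)[of u B] B u_nn by auto
      have bU: "block_seq (single_seq j (\<lambda>x. of_real (U i x)))" for i using bs(1)[of "U i" B] UB seq by auto
      define w where "w i x = \<bar>u x - U i x\<bar>" for i x
      have [measurable]: "w i \<in> borel_measurable M" for i unfolding w_def by measurable
      have uv: "block_fun (\<lambda>x. u x * v x)"
      proof (rule block_fun_mono[OF block_fun_cmult(1)[OF v_block, of "\<bar>B\<bar>"]])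
        show "AE x in M. u x * v x \<le> \<bar>B\<bar> * v x"
        proof (rule AE_I2)
          fix x assume "x \<in> space M"
          then have "u x \<le> \<bar>B\<bar>" using B by fastforce
          then show "u x * v x \<le> \<bar>B\<bar> * v x" using v_pos[of x] by (intro mult_right_mono) auto
        qed
      qed simp
      have wlim: "(\<lambda>i. block_norm (\<lambda>x. w i x * v x)) \<longlonglongrightarrow> 0"
      proof (rule block_norm_order_continuous[OF uv])
        show "0 \<le> w i x * v x" for i x using v_pos[of x] by (simp add: w_def)
        show "AE x in M. w i x * v x \<le> u x * v x" for i
        proof (rule AE_I2)
          fix x assume "x \<in> space M"
          then have "w i x \<le> u x" using Uu[of x i] seq(2)[of i x] by (simp add: w_def)
          then show "w i x * v x \<le> u x * v x" using v_pos[of x] by (intro mult_right_mono) auto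
        qed
        show "AE x in M. (\<lambda>i. w i x * v x) \<longlonglongrightarrow> 0"
        proof (rule AE_I2)
          fix x assume "x \<in> space M"
          then have "(\<lambda>i. \<bar>u x - U i x\<bar> * v x) \<longlonglongrightarrow> \<bar>u x - u x\<bar> * v x"
            by (intro tendsto_intros seq(4))
          then show "(\<lambda>i. w i x * v x) \<longlonglongrightarrow> 0" by (simp add: w_def)
        qed
      qed measurable
      have d: "cmod (\<Lambda> (single_seq j (\<lambda>x. of_real (u x))) - \<Lambda> (single_seq j (\<lambda>x. of_real (U i x)))) \<le> C * block_norm (\<lambda>x. w i x * v x)" for i
      proof -
        have e: "(\<lambda>k x. single_seq j (\<lambda>x. of_real (u x)) k x - single_seq j (\<lambda>x. of_real (U i x)) k x) = single_seq j (\<lambda>x. of_real (u x - U i x))"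
          by (auto simp: single_seq_def fun_eq_iff left_diff_distrib)
        have "cmod (of_real (u x - U i x)) \<le> B" if "x \<in> space M" for x
          using Uu[OF that, of i] seq(2)[of i x] B that by (simp del: of_real_diff) (smt (verit))
        then have *: "block_seq (single_seq j (\<lambda>x. of_real (u x - U i x)))"
          "block_seq_norm (single_seq j (\<lambda>x. of_real (u x - U i x))) = block_norm (\<lambda>x. w i x * v x)"
          using block_seq_single_seq[of "\<lambda>x. of_real (u x - U i x)" B j] by (auto simp: w_def simp del: of_real_diff)
        have "\<Lambda> (single_seq j (\<lambda>x. of_real (u x))) - \<Lambda> (single_seq j (\<lambda>x. of_real (U i x))) = \<Lambda> (single_seq j (\<lambda>x. of_real (u x - U i x)))"
          using bounded_functional_diff[OF L bu bU[of i]] unfolding e by simp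
        then show ?thesis using LD(3)[OF *(1)] *(2) by simp
      qed
      have "(\<lambda>i. \<Lambda> (single_seq j (\<lambda>x. of_real (u x))) - \<Lambda> (single_seq j (\<lambda>x. of_real (U i x)))) \<longlonglongrightarrow> 0"
        by (rule tendsto_norm_zero_cancel, rule tendsto_sandwich[OF _ _ tendsto_const tendsto_mult_right_zero[OF wlim, of C]])
          (use d in auto)
      then have l1: "(\<lambda>i. \<Lambda> (single_seq j (\<lambda>x. of_real (U i x)))) \<longlonglongrightarrow> \<Lambda> (single_seq j (\<lambda>x. of_real (u x)))"
        using tendsto_diff[OF tendsto_const, of _ 0 sequentially "\<Lambda> (single_seq j (\<lambda>x. of_real (u x)))"] by fastforce
      have l2: "(\<lambda>i. \<integral>x. of_real (U i x) * h x \<partial>M) \<longlonglongrightarrow> (\<integral>x. of_real (u x) * h x \<partial>M)"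
      proof (rule integral_dominated_convergence)
        show "integrable M (\<lambda>x. \<bar>B\<bar> * norm (h x))" using h by auto
        show "AE x in M. (\<lambda>i. of_real (U i x) * h x) \<longlonglongrightarrow> of_real (u x) * h x"
          using seq(4) by (intro AE_I2 tendsto_intros)
        show "AE x in M. norm (of_real (U i x) * h x) \<le> \<bar>B\<bar> * norm (h x)" for i
        proof (rule AE_I2)
          fix x assume "x \<in> space M"
          then have "\<bar>U i x\<bar> \<le> \<bar>B\<bar>" using UB[of x i] seq(2)[of i x] by linarith
          then show "norm (of_real (U i x) * h x) \<le> \<bar>B\<bar> * norm (h x)"
            by (simp add: norm_mult mult_right_mono)
        qed
      qed measurable
      have "\<Lambda> (single_seq j (\<lambda>x. of_real (U i x))) = (\<integral>x. of_real (U i x) * h x \<partial>M)" for i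
        using seq.IH[of i] UB unfolding P_def by blast
      then show "\<Lambda> (single_seq j (\<lambda>x. of_real (u x))) = (\<integral>x. of_real (u x) * h x \<partial>M)"
        using LIMSEQ_unique[OF l1] l2 by simp
    qed
  qed
  then show ?thesis using u(3) by (auto simp: P_def)
qed

lemma bounded_functional_eq_integral:
  assumes L: "bounded_functional \<Lambda> C" and h: "integrable M h"
    and ind: "\<And>A. A \<in> sets M \<Longrightarrow> \<Lambda> (single_seq j (indicator A)) = (\<integral>x. indicator A x * h x \<partial>M)"
    and \<psi>[measurable]: "\<psi> \<in> borel_measurable M" and B: "\<And>x. cmod (\<psi> x) \<le> B"
  shows "\<Lambda> (single_seq j \<psi>) = (\<integral>x. \<psi> x * h x \<partial>M)"
proof -
  note LD = bounded_functionalD[OF L]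
  define good where "good \<phi> \<longleftrightarrow> block_seq (single_seq j \<phi>) \<and> integrable M (\<lambda>x. \<phi> x * h x) \<and>
      \<Lambda> (single_seq j \<phi>) = (\<integral>x. \<phi> x * h x \<partial>M)" for \<phi>
  have nonneg: "good (\<lambda>x. of_real (u x))"
    if "u \<in> borel_measurable M" "\<And>x. 0 \<le> u x" "\<And>x. u x \<le> D" for u D
    unfolding good_def
    using block_seq_single_seq[of "\<lambda>x. of_real (u x)" D j] that
      integrable_bounded_mult[OF h, of "\<lambda>x. of_real (u x)" D]
      bounded_functional_eq_integral_nonneg[OF L h ind, of u D] by auto
  have add: "good (\<lambda>x. \<phi> x + \<eta> x)" if "good \<phi>" "good \<eta>" for \<phi> \<eta>
    using that LD(1)[of "single_seq j \<phi>" "single_seq j \<eta>"] block_seq_add(1)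
    by (auto simp: good_def single_seq_add distrib_right)
  have cmult: "good (\<lambda>x. c * \<phi> x)" if "good \<phi>" for \<phi> c
    using that LD(2)[of "single_seq j \<phi>" c] block_seq_cmult(1)
    by (auto simp: good_def single_seq_cmult mult.assoc)
  have B0: "0 \<le> B" using B norm_ge_zero order_trans by blast
  have real: "good (\<lambda>x. of_real (u x))" if [measurable]: "u \<in> borel_measurable M" and u: "\<And>x. \<bar>u x\<bar> \<le> B" for u
  proof -
    \<comment> \<open>Adding the constant \<open>B\<close> makes the function nonnegative; the
      constant is itself covered and is subtracted again by linearity.\<close>
    have "good (\<lambda>x. of_real (u x + B))"
    proof (rule nonneg)
      show "0 \<le> u x + B" "u x + B \<le> 2 * B" for x using u[of x] by linarith+
    qed measurable
    moreover have "good (\<lambda>x. of_real B)" by (rule nonneg[of _ B]) (use B0 in auto)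
    ultimately have "good (\<lambda>x. of_real (u x + B) + (-1) * of_real B)" by (intro add cmult)
    then show ?thesis by simp
  qed
  have "good (\<lambda>x. of_real (Re (\<psi> x)))"
    by (rule real) (use order_trans[OF abs_Re_le_cmod B] in auto)
  moreover have "good (\<lambda>x. of_real (Im (\<psi> x)))"
    by (rule real) (use order_trans[OF abs_Im_le_cmod B] in auto)
  ultimately have "good (\<lambda>x. of_real (Re (\<psi> x)) + \<i> * of_real (Im (\<psi> x)))"
    by (intro add cmult)
  then show ?thesis by (simp add: good_def flip: complex_eq)
qed

text \<open>The order matters: the representation is established on test sequences, where
  integrability of \<open>g j * v\<close> suffices; with it \<open>morrey_seq_boundI\<close> yields
  the Morrey bound, and only then is the pairing a bounded functional to which the density argument
  applies.\<close>

theorem bounded_functional_representation: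
  assumes L: "bounded_functional \<Lambda> C" and C: "0 \<le> C"
  shows "\<exists>g. morrey_seq_bound g C \<and> (\<forall>f. block_seq f \<longrightarrow> \<Lambda> f = seq_pairing g f)"
proof -
  note LD = bounded_functionalD[OF L]
  obtain H :: "nat \<Rightarrow> 'a \<Rightarrow> complex" where H: "\<And>j. integrable M (H j)"
    "\<And>j A. A \<in> sets M \<Longrightarrow> \<Lambda> (single_seq j (indicator A)) = (\<integral>x. indicator A x * H j x \<partial>M)"
    using bounded_functional_density[OF L] by metis
  \<comment> \<open>\<open>H j\<close> is the density of the functional on multiples of
    \<open>v\<close>; dividing by \<open>v\<close> gives the density against \<open>f\<close>
    itself.\<close>
  define g where "g j x = H j x / of_real (v x)" for j x
  have v0: "v x \<noteq> 0" for x using v_pos[of x] by simp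
  have [measurable]: "H j \<in> borel_measurable M" for j using H(1) by (rule borel_measurable_integrable)
  have g_meas[measurable]: "g j \<in> borel_measurable M" for j unfolding g_def by measurable
  have gv: "g j x * of_real (v x) = H j x" for j x using v0[of x] by (simp add: g_def)
  have int: "integrable M (\<lambda>x. g j x * of_real (v x))" for j unfolding gv by (rule H(1))
  have test: "\<Lambda> f = seq_pairing g f" if f: "test_seq m B f" for m B f
  proof -
    have f': "f j \<in> borel_measurable M" "\<And>j x. j \<ge> m \<Longrightarrow> f j x = 0" "cmod (f j x) \<le> B * v x" for j x
      using f by (auto simp: test_seq_def)
    note [measurable] = f'(1)
    define \<psi> where "\<psi> j x = f j x / of_real (v x)" for j x
    have [measurable]: "\<psi> j \<in> borel_measurable M" for j unfolding \<psi>_def by measurable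
    have \<psi>B: "cmod (\<psi> j x) \<le> B" for j x
      using f'(3)[of j x] v_pos[of x] by (simp add: \<psi>_def norm_divide field_simps)
    have \<psi>v: "\<psi> j x * of_real (v x) = f j x" for j x using v0[of x] by (simp add: \<psi>_def)
    have single: "\<Lambda> (single_seq j (\<psi> j)) = (\<integral>x. g j x * f j x \<partial>M)" for j
    proof -
      have "\<psi> j x * H j x = g j x * f j x" for x using v0[of x] by (simp add: \<psi>_def g_def)
      then show ?thesis
        using bounded_functional_eq_integral[OF L H(1)[of j] H(2), where \<psi> = "\<psi> j" and B = B] \<psi>B
        by simp
    qed
    \<comment> \<open>Components are peeled off one at a time, since additivity is available for two
      summands.\<close>
    define F where "F k = (\<lambda>j x. if j < k then f j x else 0)" for k
    have F: "\<Lambda> (F k) = (\<Sum>j<k. \<integral>x. g j x * f j x \<partial>M)" for k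
    proof (induction k)
      case 0
      have "F 0 = (\<lambda>j x. 0 * 0)" by (simp add: F_def)
      then show ?case using LD(2)[OF block_seq_zero(1), of 0] by simp
    next
      case (Suc k)
      have "test_seq k B (F k)"
        using f' v_pos \<psi>B order_trans[OF norm_ge_zero f'(3)] by (auto simp: test_seq_def F_def)
      then have b: "block_seq (F k)" by (rule test_seq_block_seq)
      have "F (Suc k) = (\<lambda>j x. F k j x + single_seq k (\<psi> k) j x)"
        by (auto simp: F_def single_seq_def \<psi>v fun_eq_iff less_Suc_eq)
      then have "\<Lambda> (F (Suc k)) = \<Lambda> (F k) + \<Lambda> (single_seq k (\<psi> k))"
        using LD(1)[OF b block_seq_single_seq(1)[of "\<psi> k" B k]] \<psi>B by simp
      then show ?case using Suc single by simp
    qed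
    have "F m = f" using f'(2) by (auto simp: F_def fun_eq_iff not_less)
    then show ?thesis using F[of m] seq_pairing_test_seq(2)[OF f g_meas int] by simp
  qed
  have g: "morrey_seq_bound g C"
    by (rule morrey_seq_boundI[OF g_meas int C]) (metis test LD(3) test_seq_block_seq)
  then show ?thesis
    using bounded_functional_eqI[OF L bounded_functional_seq_pairing[OF g]] test by blast
qed

text \<open>Testing with \<open>indicator A * v\<close> in the component \<open>j\<close> alone
  shows that \<open>g j * v\<close> and \<open>h j * v\<close> have the same integral over every
  measurable \<open>A\<close>.\<close>

lemma morrey_seq_bound_unique:
  assumes g: "morrey_seq_bound g S" and h: "morrey_seq_bound h S'"
    and eq: "\<And>m B f. test_seq m B f \<Longrightarrow> seq_pairing g f = seq_pairing h f"
  shows "AE x in M. g j x = h j x"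
proof -
  have meas: "g j \<in> borel_measurable M" "h j \<in> borel_measurable M" for j
    using g h by (auto simp: morrey_seq_bound_def)
  note ig = morrey_seq_bound_integrable[OF g] and ih = morrey_seq_bound_integrable[OF h]
  have "AE x in M. g j x * of_real (v x) = h j x * of_real (v x)"
  proof (rule density_unique_banach[OF ig ih])
    fix A assume A[measurable]: "A \<in> sets M"
    define f where "f = single_seq j (indicator A)"
    have "f k \<in> borel_measurable M" for k
      unfolding f_def single_seq_def[abs_def] by measurable
    then have f: "test_seq (Suc j) 1 f"
      using v_pos by (auto simp: test_seq_def f_def single_seq_def indicator_def less_imp_le)
    have *: "seq_pairing k f = set_lebesgue_integral M A (\<lambda>x. k j x * of_real (v x))"
      if "\<And>j. k j \<in> borel_measurable M" "\<And>j. integrable M (\<lambda>x. k j x * of_real (v x))" for k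
    proof -
      have "seq_pairing k f = (\<Sum>i<Suc j. \<integral>x. k i x * f i x \<partial>M)"
        by (rule seq_pairing_test_seq(2)[OF f that])
      also have "\<dots> = (\<integral>x. k j x * f j x \<partial>M)" by (simp add: f_def single_seq_def)
      also have "\<dots> = set_lebesgue_integral M A (\<lambda>x. k j x * of_real (v x))"
        unfolding set_lebesgue_integral_def
        by (rule Bochner_Integration.integral_cong) (auto simp: f_def single_seq_def indicator_def)
      finally show ?thesis .
    qed
    show "set_lebesgue_integral M A (\<lambda>x. g j x * of_real (v x)) = set_lebesgue_integral M A (\<lambda>x. h j x * of_real (v x))"
      using eq[OF f] *[OF meas(1) ig] *[OF meas(2) ih] by simp
  qed
  then show ?thesis
  proof eventually_elim
    case (elim x)
    then show ?case using v_pos[of x] by simp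
  qed
qed

end

section \<open>Test functions\<close>

lemma power_mult_exp_bounded:
  fixes c t :: real
  assumes "0 < c" "0 \<le> t"
  shows "t ^ m * exp (- c * t) \<le> fact m / c ^ m"
proof -
  have "(c * t) ^ m / fact m \<le> exp (c * t)"
    using sum_le_suminf[OF summable_exp, of "{m}" "c * t"] assms
    by (simp add: exp_def divide_inverse scaleR_conv_of_real mult_ac)
  then have "(c * t) ^ m / fact m * exp (- (c * t)) \<le> exp (c * t) * exp (- (c * t))"
    by (intro mult_right_mono) auto
  then have "(c * t) ^ m / fact m * exp (- (c * t)) \<le> 1" by (simp add: exp_minus)
  then show ?thesis using assms by (simp add: field_simps power_mult_distrib)
qed

text \<open>The bumps and all their derivatives satisfy such a bound at the ends of the interval and
  outside, which settles differentiability there.\<close>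

lemma has_real_derivative_zero_quadratic:
  fixes f :: "real \<Rightarrow> real"
  assumes "\<And>x. \<bar>f x\<bar> \<le> K * (x - x0)\<^sup>2"
  shows "(f has_real_derivative 0) (at x0)"
proof -
  have f0: "f x0 = 0" using assms[of x0] by simp
  have lim: "((\<lambda>x. K * \<bar>x - x0\<bar>) \<longlongrightarrow> 0) (at x0)"
    by (auto intro!: tendsto_eq_intros)
  have "((\<lambda>x. (f x - f x0) / (x - x0)) \<longlongrightarrow> 0) (at x0)"
  proof (rule Lim_null_comparison[OF _ lim])
    show "\<forall>\<^sub>F x in at x0. norm ((f x - f x0) / (x - x0)) \<le> K * \<bar>x - x0\<bar>"
    proof (rule eventually_at_topological[THEN iffD2], intro exI[of _ UNIV] conjI ballI impI)
      fix x assume x: "x \<noteq> x0"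
      have "\<bar>f x\<bar> \<le> K * \<bar>x - x0\<bar> * \<bar>x - x0\<bar>" using assms[of x] by (simp add: power2_eq_square)
      then show "norm ((f x - f x0) / (x - x0)) \<le> K * \<bar>x - x0\<bar>"
        using x f0 by (simp add: divide_le_eq)
    qed auto
  qed
  then show ?thesis by (simp add: has_field_derivative_iff)
qed

text \<open>Tends to infinity at both ends of the interval from inside, so
  \<open>exp (- c * bump_exponent a b x)\<close> is flat there; as \<open>c\<close> tends to 0 this
  exponential tends to 1 at every interior point.\<close>

definition bump_exponent :: "real \<Rightarrow> real \<Rightarrow> real \<Rightarrow> real" where
  "bump_exponent a b x = 1 / ((x - a) * (b - x))"

text \<open>The bump is the case \<open>i = j = 0\<close>. The monomial factors are there because
  derivatives produce them: the linear span of these functions is closed under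
  differentiation.\<close>

definition bump_term :: "real \<Rightarrow> real \<Rightarrow> real \<Rightarrow> nat \<Rightarrow> nat \<Rightarrow> real \<Rightarrow> real" where
  "bump_term a b c i j x =
     (if a < x \<and> x < b
      then x ^ i * bump_exponent a b x ^ j * exp (- c * bump_exponent a b x) else 0)"

text \<open>The linear span as an inductive predicate, so that bounds and derivatives are obtained
  by induction over its formation.\<close>

inductive bump_span :: "real \<Rightarrow> real \<Rightarrow> real \<Rightarrow> (real \<Rightarrow> real) \<Rightarrow> bool" for a b c where
  base: "bump_span a b c (bump_term a b c i j)"
| add: "bump_span a b c f \<Longrightarrow> bump_span a b c g \<Longrightarrow> bump_span a b c (\<lambda>x. f x + g x)"
| cmult: "bump_span a b c f \<Longrightarrow> bump_span a b c (\<lambda>x. k * f x)"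

lemma bump_span_outside:
  assumes "bump_span a b c f" "x \<le> a \<or> b \<le> x"
  shows "f x = 0"
  using assms by induction (auto simp: bump_term_def)

text \<open>With \<open>W = 1 / D\<close> one has \<open>W ^ j * exp (- c * W) = W ^ (j + 2) * exp
  (- c * W) * D\<^sup>2\<close>. The exponential bounds the factor in front of
  \<open>D\<^sup>2\<close>, and \<open>D \<le> (b - a) * \<bar>x - x0\<bar>\<close> because
  \<open>x0\<close> is outside the open interval.\<close>

lemma bump_term_quadratic:
  assumes "a < b" "0 < c" and x0: "x0 \<le> a \<or> b \<le> x0"
  shows "\<exists>K. \<forall>x. \<bar>bump_term a b c i j x\<bar> \<le> K * (x - x0)\<^sup>2"
proof (intro exI allI)
  define L where "L = \<bar>a\<bar> + \<bar>b\<bar>"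
  define C where "C = fact (j + 2) / c ^ (j + 2)"
  have C: "0 \<le> C" using assms by (simp add: C_def)
  fix x
  show "\<bar>bump_term a b c i j x\<bar> \<le> (L ^ i * C * (b - a)\<^sup>2) * (x - x0)\<^sup>2"
  proof (cases "a < x \<and> x < b")
    case True
    define W where "W = bump_exponent a b x"
    define D where "D = (x - a) * (b - x)"
    have D: "0 < D" using True by (simp add: D_def)
    have W: "W = 1 / D" by (simp add: W_def D_def bump_exponent_def)
    have "D\<^sup>2 \<le> ((b - a) * \<bar>x - x0\<bar>)\<^sup>2"
    proof (rule power_mono)
      show "D \<le> (b - a) * \<bar>x - x0\<bar>"
        using x0
      proof
        assume "x0 \<le> a"
        then show ?thesis
          unfolding D_def mult.commute[of "x - a"] using True by (intro mult_mono) auto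
      next
        assume "b \<le> x0"
        then show ?thesis unfolding D_def using True by (intro mult_mono) auto
      qed
    qed (use D in simp)
    then have D2: "D\<^sup>2 \<le> (b - a)\<^sup>2 * (x - x0)\<^sup>2" by (simp add: power_mult_distrib)
    have "W ^ j * exp (- c * W) = (W ^ (j + 2) * exp (- c * W)) * D\<^sup>2"
      using D by (simp add: W power_add field_simps power2_eq_square)
    also have "\<dots> \<le> C * D\<^sup>2"
      unfolding C_def using assms D W by (intro mult_right_mono power_mult_exp_bounded) auto
    also have "\<dots> \<le> C * ((b - a)\<^sup>2 * (x - x0)\<^sup>2)" using D2 C by (rule mult_left_mono)
    finally have 1: "W ^ j * exp (- c * W) \<le> C * ((b - a)\<^sup>2 * (x - x0)\<^sup>2)" .
    have 2: "\<bar>x\<bar> ^ i \<le> L ^ i" using True by (intro power_mono) (auto simp: L_def)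
    have "\<bar>bump_term a b c i j x\<bar> = \<bar>x\<bar> ^ i * (W ^ j * exp (- c * W))"
      using True D W by (simp add: bump_term_def W_def[symmetric] abs_mult power_abs)
    also have "\<dots> \<le> L ^ i * (C * ((b - a)\<^sup>2 * (x - x0)\<^sup>2))"
      by (rule mult_mono) (use 1 2 D W in \<open>auto simp: L_def\<close>)
    finally show ?thesis by (simp add: mult.assoc)
  next
    case False
    then show ?thesis using C by (auto simp: bump_term_def L_def)
  qed
qed

lemma bump_span_quadratic:
  assumes "bump_span a b c f" "a < b" "0 < c" "x0 \<le> a \<or> b \<le> x0"
  shows "\<exists>K. \<forall>x. \<bar>f x\<bar> \<le> K * (x - x0)\<^sup>2"
  using assms(1)
proof induction
  case (base i j)
  show ?case by (rule bump_term_quadratic[OF assms(2-4)])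
next
  case (add f g)
  then obtain K1 K2 where "\<And>x. \<bar>f x\<bar> \<le> K1 * (x - x0)\<^sup>2" "\<And>x. \<bar>g x\<bar> \<le> K2 * (x - x0)\<^sup>2" by blast
  then have "\<bar>f x + g x\<bar> \<le> (K1 + K2) * (x - x0)\<^sup>2" for x
    using abs_triangle_ineq[of "f x" "g x"] by (smt (verit) distrib_right)
  then show ?case by blast
next
  case (cmult f k)
  then obtain K where "\<And>x. \<bar>f x\<bar> \<le> K * (x - x0)\<^sup>2" by blast
  then have "\<bar>k * f x\<bar> \<le> (\<bar>k\<bar> * K) * (x - x0)\<^sup>2" for x
    by (simp add: abs_mult mult.assoc mult_left_mono)
  then show ?case by blast
qed

text \<open>The exponent satisfies \<open>W' = - W\<^sup>2 * (a + b - 2 * x)\<close>. Splitting this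
  linear factor into a constant and a multiple of \<open>x\<close> keeps all five terms in the
  family. At \<open>i = 0\<close> the truncated \<open>i - 1\<close> is harmless, as its coefficient
  vanishes.\<close>

lemma bump_term_deriv_inside:
  assumes x: "a < x" "x < b"
  shows "(bump_term a b c i j has_real_derivative
      (of_nat i * bump_term a b c (i - 1) j x + (- of_nat j * (a + b)) * bump_term a b c i (j + 1) x
       + (2 * of_nat j) * bump_term a b c (i + 1) (j + 1) x + (c * (a + b)) * bump_term a b c i (j + 2) x
       + (- 2 * c) * bump_term a b c (i + 1) (j + 2) x)) (at x)"
proof -
  define W where "W = bump_exponent a b"
  have W: "(W has_real_derivative (- (W x)\<^sup>2 * (a + b - 2 * x))) (at x)"
  proof -
    have D: "((\<lambda>y. (y - a) * (b - y)) has_real_derivative (a + b - 2 * x)) (at x)"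
      by (auto intro!: derivative_eq_intros)
    have "(x - a) * (b - x) \<noteq> 0" using x by simp
    from DERIV_inverse_fun[OF D this]
    have "((\<lambda>y. inverse ((y - a) * (b - y))) has_real_derivative
        - ((a + b - 2 * x) * (inverse ((x - a) * (b - x)))\<^sup>2)) (at x)"
      by (simp add: power2_eq_square)
    moreover have "W = (\<lambda>y. inverse ((y - a) * (b - y)))"
      by (simp add: W_def bump_exponent_def fun_eq_iff inverse_eq_divide)
    ultimately show ?thesis by (simp add: mult.commute)
  qed
  have D: "((\<lambda>y. y ^ i * W y ^ j * exp (- c * W y)) has_real_derivative
     (of_nat i * x ^ (i - 1) * W x ^ j * exp (- c * W x)
      + x ^ i * (of_nat j * W x ^ (j - 1) * (- (W x)\<^sup>2 * (a + b - 2 * x))) * exp (- c * W x)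
      + x ^ i * W x ^ j * (exp (- c * W x) * (- c * (- (W x)\<^sup>2 * (a + b - 2 * x)))))) (at x)"
    by (rule derivative_eq_intros W refl)+ (simp add: algebra_simps)
  \<comment> \<open>For \<open>j = 0\<close> both sides are 0, which absorbs the truncated
    subtraction.\<close>
  have "of_nat j * W x ^ (j - 1) * (W x)\<^sup>2 = of_nat j * W x ^ (j + 1)"
    by (cases j) (auto simp: power2_eq_square)
  then have e: "x ^ i * (of_nat j * W x ^ (j - 1) * (- (W x)\<^sup>2 * (a + b - 2 * x))) * exp (- c * W x)
      = x ^ i * (- (of_nat j * W x ^ (j + 1)) * (a + b - 2 * x)) * exp (- c * W x)"
    by (simp add: mult.assoc[symmetric])
  note D[unfolded e]
  moreover have "(of_nat i * x ^ (i - 1) * W x ^ j * exp (- c * W x)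
      + x ^ i * (- (of_nat j * W x ^ (j + 1)) * (a + b - 2 * x)) * exp (- c * W x)
      + x ^ i * W x ^ j * (exp (- c * W x) * (- c * (- (W x)\<^sup>2 * (a + b - 2 * x)))))
    = of_nat i * bump_term a b c (i - 1) j x + (- of_nat j * (a + b)) * bump_term a b c i (j + 1) x
       + (2 * of_nat j) * bump_term a b c (i + 1) (j + 1) x + (c * (a + b)) * bump_term a b c i (j + 2) x
       + (- 2 * c) * bump_term a b c (i + 1) (j + 2) x"
  proof -
    have pw: "W x ^ (j + 1) = W x ^ j * W x" "W x ^ (j + 2) = W x ^ j * (W x)\<^sup>2" "x ^ (i + 1) = x ^ i * x"
      by (simp_all add: power2_eq_square)
    have "n * z * wj * e + X * (- (m * (wj * w)) * (a + b - 2 * x)) * e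
        + X * wj * (e * (- c * (- w\<^sup>2 * (a + b - 2 * x)))) =
      n * (z * wj * e) + (- m * (a + b)) * (X * (wj * w) * e) + (2 * m) * ((X * x) * (wj * w) * e)
        + (c * (a + b)) * (X * (wj * w\<^sup>2) * e) + (- 2 * c) * ((X * x) * (wj * w\<^sup>2) * e)"
      for n m z wj w e X :: real
      by (simp add: algebra_simps)
    from this[of "of_nat i" "x ^ (i - 1)" "W x ^ j" "exp (- c * W x)" "x ^ i" "of_nat j" "W x"]
    show ?thesis
      using x unfolding bump_term_def W_def[symmetric] pw by simp
  qed
  ultimately have "((\<lambda>y. y ^ i * W y ^ j * exp (- c * W y)) has_real_derivative
     (of_nat i * bump_term a b c (i - 1) j x + (- of_nat j * (a + b)) * bump_term a b c i (j + 1) x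
       + (2 * of_nat j) * bump_term a b c (i + 1) (j + 1) x + (c * (a + b)) * bump_term a b c i (j + 2) x
       + (- 2 * c) * bump_term a b c (i + 1) (j + 2) x)) (at x)" by simp
  then show ?thesis
    by (rule DERIV_cong_ev[THEN iffD1, rotated 3])
      (use x in \<open>auto simp: bump_term_def W_def eventually_nhds intro!: exI[of _ "{a<..<b}"]\<close>)
qed

text \<open>Inside the interval by induction over the span; elsewhere the quadratic bound makes the
  derivative 0, which is also the value of \<open>f'\<close> there. Keeping \<open>f'\<close> in the
  span permits iteration.\<close>

lemma bump_span_deriv:
  assumes "bump_span a b c f" and ab: "a < b" "0 < c"
  shows "\<exists>f'. bump_span a b c f' \<and> (\<forall>x. (f has_real_derivative f' x) (at x))"
proof -
  have inside: "\<exists>f'. bump_span a b c f' \<and> (\<forall>x. a < x \<and> x < b \<longrightarrow> (f has_real_derivative f' x) (at x))"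
    using assms(1)
  proof induction
    case (base i j)
    show ?case
      by (intro exI conjI allI impI,
          rule bump_span.add[OF bump_span.add[OF bump_span.add[OF bump_span.add[OF
            bump_span.cmult bump_span.cmult] bump_span.cmult] bump_span.cmult] bump_span.cmult])
        (rule bump_span.base | rule bump_term_deriv_inside, blast, blast)+
  next
    case (add f g)
    then obtain f' g' where "bump_span a b c f'" "bump_span a b c g'"
      "\<And>x. a < x \<and> x < b \<Longrightarrow> (f has_real_derivative f' x) (at x)"
      "\<And>x. a < x \<and> x < b \<Longrightarrow> (g has_real_derivative g' x) (at x)" by blast
    then show ?case
      by (intro exI[of _ "\<lambda>x. f' x + g' x"]) (auto intro: bump_span.intros DERIV_add)
  next
    case (cmult f k)
    then obtain f' where "bump_span a b c f'"
      "\<And>x. a < x \<and> x < b \<Longrightarrow> (f has_real_derivative f' x) (at x)" by blast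
    then show ?case
      by (intro exI[of _ "\<lambda>x. k * f' x"]) (auto intro: bump_span.intros DERIV_cmult)
  qed
  then obtain f' where f': "bump_span a b c f'"
    "\<And>x. a < x \<and> x < b \<Longrightarrow> (f has_real_derivative f' x) (at x)" by blast
  have "(f has_real_derivative f' x) (at x)" for x
  proof (cases "a < x \<and> x < b")
    case False
    then have x: "x \<le> a \<or> b \<le> x" by auto
    obtain K where "\<And>y. \<bar>f y\<bar> \<le> K * (y - x)\<^sup>2" using bump_span_quadratic[OF assms x] by blast
    then have "(f has_real_derivative 0) (at x)" by (rule has_real_derivative_zero_quadratic)
    then show ?thesis using bump_span_outside[OF f'(1) x] by simp
  qed (use f'(2) in auto)
  then show ?thesis using f'(1) by blast
qed

lemma bump_derivative_sequence:
  assumes "a < b" "0 < c"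
  shows "\<exists>H :: nat \<Rightarrow> real \<Rightarrow> real. H 0 = bump_term a b c 0 0 \<and>
    (\<forall>k x. (H k has_real_derivative H (Suc k) x) (at x)) \<and> (\<forall>k x. x \<le> a \<or> b \<le> x \<longrightarrow> H k x = 0)"
proof -
  have "\<exists>H. \<forall>k. (bump_span a b c (H k) \<and> (k = 0 \<longrightarrow> H k = bump_term a b c 0 0)) \<and>
      (\<forall>x. (H k has_real_derivative H (Suc k) x) (at x))"
    by (rule dependent_nat_choice[where Q = "\<lambda>_ f f'. \<forall>x. (f has_real_derivative f' x) (at x)"])
      (use bump_span_deriv[OF _ assms] bump_span.base[of a b c 0 0] in auto)
  then show ?thesis using bump_span_outside by metis
qed

text \<open>A partial derivative in direction \<open>l\<close> raises the order of the factor at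
  \<open>l\<close> by one and leaves the others alone, so iterated partial derivatives stay in the
  family \<open>\<Phi>\<close> and one proof of boundedness serves all of them.\<close>

lemma iter_partial_prod:
  fixes H :: "'n::finite \<Rightarrow> nat \<Rightarrow> real \<Rightarrow> real"
  assumes H: "\<And>i k x. (H i k has_real_derivative H i (Suc k) x) (at x)"
  defines "\<Phi> \<equiv> \<lambda>k (x :: real ^ 'n). complex_of_real (\<Prod>i\<in>UNIV. H i (k i) (x $ i))"
  shows "(\<Phi> k has_derivative
      (\<lambda>y. of_real (\<Sum>i\<in>UNIV. (H i (Suc (k i)) (x $ i) * y $ i) * (\<Prod>j\<in>UNIV - {i}. H j (k j) (x $ j))))) (at x)"
    and "partial_deriv l (\<Phi> k) = \<Phi> (k(l := Suc (k l)))"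
    and "\<exists>k'. iter_partial ls (\<Phi> k) = \<Phi> k'"
proof -
  have nth: "((\<lambda>x :: real ^ 'n. x $ i) has_derivative (\<lambda>y. y $ i)) (at x)" for i and x :: "real ^ 'n"
    by (rule bounded_linear_imp_has_derivative) (rule bounded_linear_vec_nth)
  show der: "(\<Phi> k has_derivative
      (\<lambda>y. of_real (\<Sum>i\<in>UNIV. (H i (Suc (k i)) (x $ i) * y $ i) * (\<Prod>j\<in>UNIV - {i}. H j (k j) (x $ j))))) (at x)" for k x
    unfolding \<Phi>_def
  proof (rule has_derivative_of_real, rule has_derivative_prod)
    fix i
    have "(H i (k i) has_derivative (\<lambda>h. H i (Suc (k i)) (x $ i) * h)) (at (x $ i))"
      using H by (simp add: has_field_derivative_def)
    from has_derivative_compose[OF nth this]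
    show "((\<lambda>x. H i (k i) (x $ i)) has_derivative (\<lambda>y. H i (Suc (k i)) (x $ i) * y $ i)) (at x)" .
  qed
  show part: "partial_deriv l (\<Phi> k) = \<Phi> (k(l := Suc (k l)))" for l k
  proof
    fix x
    have "partial_deriv l (\<Phi> k) x
      = of_real (\<Sum>i\<in>UNIV. (H i (Suc (k i)) (x $ i) * axis l 1 $ i) * (\<Prod>j\<in>UNIV - {i}. H j (k j) (x $ j)))"
      unfolding partial_deriv_def frechet_derivative_at[OF der, symmetric] ..
    also have "(\<Sum>i\<in>UNIV. (H i (Suc (k i)) (x $ i) * axis l 1 $ i) * (\<Prod>j\<in>UNIV - {i}. H j (k j) (x $ j)))
      = (\<Sum>i\<in>UNIV. if i = l then H l (Suc (k l)) (x $ l) * (\<Prod>j\<in>UNIV - {l}. H j (k j) (x $ j)) else 0)"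
      by (rule sum.cong) (auto simp: axis_def)
    also have "\<dots> = H l (Suc (k l)) (x $ l) * (\<Prod>j\<in>UNIV - {l}. H j (k j) (x $ j))" by simp
    also have "\<dots> = (\<Prod>i\<in>UNIV. H i ((k(l := Suc (k l))) i) (x $ i))"
      by (subst prod.remove[of UNIV l]) (auto intro!: prod.cong)
    finally show "partial_deriv l (\<Phi> k) x = \<Phi> (k(l := Suc (k l))) x" by (simp only: \<Phi>_def)
  qed
  show "\<exists>k'. iter_partial ls (\<Phi> k) = \<Phi> k'"
  proof (induction ls)
    case (Cons l ls)
    then obtain k' where "iter_partial ls (\<Phi> k) = \<Phi> k'" by blast
    then show ?case using part by auto
  qed auto
qed

section \<open>Smooth bumps on boxes\<close>

definition box_bump :: "real ^ 'n \<Rightarrow> real ^ 'n \<Rightarrow> real \<Rightarrow> real ^ 'n \<Rightarrow> complex" where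
  "box_bump a b c x = of_real (\<Prod>i\<in>UNIV. bump_term (a $ i) (b $ i) c 0 0 (x $ i))"

text \<open>Every iterated derivative is continuous and vanishes outside the closed box, hence stays
  bounded after multiplication by any power of \<open>1 + norm x\<close>.\<close>

lemma box_bump_schwartz:
  fixes a b :: "real ^ 'n::finite"
  assumes ab: "\<And>i. a $ i < b $ i" and c: "0 < c"
  shows "box_bump a b c \<in> schwartz"
proof -
  obtain H :: "'n \<Rightarrow> nat \<Rightarrow> real \<Rightarrow> real" where H: "\<And>i. H i 0 = bump_term (a $ i) (b $ i) c 0 0"
    "\<And>i k x. (H i k has_real_derivative H i (Suc k) x) (at x)"
    "\<And>i k x. x \<le> a $ i \<or> b $ i \<le> x \<Longrightarrow> H i k x = 0"
    using bump_derivative_sequence[OF ab c] by metis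
  define \<Phi> where "\<Phi> k x = complex_of_real (\<Prod>i\<in>UNIV. H i (k i) (x $ i))" for k and x :: "real ^ 'n"
  note it = iter_partial_prod[of H, OF H(2), folded \<Phi>_def]
  have bump: "box_bump a b c = \<Phi> (\<lambda>_. 0)" by (auto simp: box_bump_def \<Phi>_def H(1))
  have diff: "\<Phi> k differentiable_on UNIV" for k
    using it(1)[of k] by (auto simp: differentiable_on_def differentiable_def)
  have bdd: "bounded (range (\<lambda>x. (1 + norm x) ^ N *\<^sub>R \<Phi> k x))" for N :: nat and k
  proof -
    have cont: "continuous_on UNIV (\<Phi> k)"
      using differentiable_imp_continuous_on[OF diff] .
    have "compact ((\<lambda>x. (1 + norm x) ^ N *\<^sub>R \<Phi> k x) ` cbox a b)"
      by (intro compact_continuous_image continuous_intros continuous_on_subset[OF cont]) auto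
    then have "bounded (insert 0 ((\<lambda>x. (1 + norm x) ^ N *\<^sub>R \<Phi> k x) ` cbox a b))"
      by (simp add: compact_imp_bounded)
    moreover have "range (\<lambda>x. (1 + norm x) ^ N *\<^sub>R \<Phi> k x) \<subseteq> insert 0 ((\<lambda>x. (1 + norm x) ^ N *\<^sub>R \<Phi> k x) ` cbox a b)"
    proof (intro image_subsetI)
      fix x
      show "(1 + norm x) ^ N *\<^sub>R \<Phi> k x \<in> insert 0 ((\<lambda>x. (1 + norm x) ^ N *\<^sub>R \<Phi> k x) ` cbox a b)"
      proof (cases "x \<in> cbox a b")
        case False
        then obtain i where "x $ i \<le> a $ i \<or> b $ i \<le> x $ i" by (auto simp: mem_box_cart not_le intro: less_imp_le)
        then have "\<Phi> k x = 0" using H(3) by (auto simp: \<Phi>_def)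
        then show ?thesis by simp
      qed auto
    qed
    ultimately show ?thesis by (rule bounded_subset)
  qed
  show ?thesis
    unfolding schwartz_def bump
  proof (intro CollectI allI conjI)
    fix ls and N :: nat
    obtain k' where "iter_partial ls (\<Phi> (\<lambda>_. 0)) = \<Phi> k'" using it(3) by blast
    then show "iter_partial ls (\<Phi> (\<lambda>_. 0)) differentiable_on UNIV"
      "bounded (range (\<lambda>x. (1 + norm x) ^ N *\<^sub>R iter_partial ls (\<Phi> (\<lambda>_. 0)) x))"
      using diff bdd by auto
  qed
qed

lemma bump_term_bounds: "0 < c \<Longrightarrow> 0 \<le> bump_term a b c 0 0 x" "0 < c \<Longrightarrow> bump_term a b c 0 0 x \<le> 1"
  by (auto simp: bump_term_def bump_exponent_def)

lemma box_bump_norm_le: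
  assumes "0 < c"
  shows "cmod (box_bump a b c x) \<le> indicator (box a b) x"
proof (cases "x \<in> box a b")
  case True
  have "\<bar>\<Prod>i\<in>UNIV. bump_term (a $ i) (b $ i) c 0 0 (x $ i)\<bar> \<le> 1"
    unfolding abs_prod by (rule prod_le_1) (use bump_term_bounds[OF assms] in auto)
  then show ?thesis using True by (simp add: box_bump_def del: of_real_prod)
next
  case False
  then obtain i where "\<not> (a $ i < x $ i \<and> x $ i < b $ i)" by (auto simp: mem_box_cart)
  then have "bump_term (a $ i) (b $ i) c 0 0 (x $ i) = 0" by (auto simp: bump_term_def)
  then show ?thesis using False by (auto simp: box_bump_def)
qed

lemma box_bump_tendsto_indicator:
  "(\<lambda>m. box_bump a b (1 / real (Suc m)) x) \<longlonglongrightarrow> indicator (box a b) x"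
proof (cases "x \<in> box a b")
  case True
  have "(\<lambda>m. bump_term (a $ i) (b $ i) (1 / real (Suc m)) 0 0 (x $ i)) \<longlonglongrightarrow> 1" for i
  proof -
    have "(\<lambda>m. exp (- (1 / real (Suc m)) * bump_exponent (a $ i) (b $ i) (x $ i))) \<longlonglongrightarrow> exp (- 0 * bump_exponent (a $ i) (b $ i) (x $ i))"
      by (intro tendsto_intros LIMSEQ_Suc[OF lim_1_over_n])
    then show ?thesis using True by (simp add: bump_term_def mem_box_cart)
  qed
  then have "(\<lambda>m. \<Prod>i\<in>UNIV. bump_term (a $ i) (b $ i) (1 / real (Suc m)) 0 0 (x $ i)) \<longlonglongrightarrow> (\<Prod>i\<in>(UNIV :: 'a set). 1)"
    by (intro tendsto_prod)
  then have "(\<lambda>m. box_bump a b (1 / real (Suc m)) x) \<longlonglongrightarrow> of_real (\<Prod>i\<in>(UNIV :: 'a set). 1)"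
    unfolding box_bump_def by (rule tendsto_of_real)
  then show ?thesis using True by simp
next
  case False
  have "box_bump a b (1 / real (Suc m)) x = 0" for m
    using box_bump_norm_le[of "1 / real (Suc m)" a b x] False by simp
  then show ?thesis using False by simp
qed

text \<open>Enlarging the box by 1 in every direction keeps the bump exponents at most 1 on the
  original box. The bound makes integrability against Schwartz functions imply integrability over
  boxes.\<close>

lemma box_bump_lower_bound:
  fixes a b x :: "real ^ 'n::finite"
  assumes "x \<in> box a b"
  shows "exp (- 1) ^ CARD('n) \<le> cmod (box_bump (a - 1) (b + 1) 1 x)"
proof -
  have "exp (- 1) \<le> bump_term ((a - 1) $ i) ((b + 1) $ i) 1 0 0 (x $ i)" for i
  proof -
    have x: "a $ i < x $ i" "x $ i < b $ i" using assms by (auto simp: mem_box_cart)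
    have "1 * 1 \<le> (x $ i - (a $ i - 1)) * (b $ i + 1 - x $ i)"
      using x by (intro mult_mono) auto
    then have "bump_exponent ((a - 1) $ i) ((b + 1) $ i) (x $ i) \<le> 1"
      using x by (simp add: bump_exponent_def divide_le_eq)
    then show ?thesis using x by (simp add: bump_term_def)
  qed
  then have "(\<Prod>i\<in>(UNIV :: 'n set). exp (- 1)) \<le> (\<Prod>i\<in>UNIV. bump_term ((a - 1) $ i) ((b + 1) $ i) 1 0 0 (x $ i))"
    by (intro prod_mono) auto
  also have "\<dots> \<le> cmod (box_bump (a - 1) (b + 1) 1 x)"
    by (simp add: box_bump_def del: of_real_prod)
  finally show ?thesis by simp
qed

text \<open>The measures whose densities are the positive and the negative part of \<open>f\<close>
  agree on boxes, a generator stable under intersection, so the two parts coincide almost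
  everywhere.\<close>

lemma AE_eq_0_of_box_integrals:
  fixes f :: "'a::euclidean_space \<Rightarrow> real"
  assumes f: "f \<in> borel_measurable lebesgue"
    and int: "\<And>a b. integrable lebesgue (\<lambda>x. indicator (box a b) x * f x)"
    and zero: "\<And>a b. (\<integral>x. indicator (box a b) x * f x \<partial>lebesgue) = 0"
  shows "AE x in lebesgue. f x = 0"
proof -
  \<comment> \<open>Boxes generate the Borel sets, so \<open>f\<close> is first replaced by a Borel
    function equal to it almost everywhere.\<close>
  obtain g where g[measurable]: "g \<in> borel_measurable lborel" and fg: "AE x in lborel. f x = g x"
    using completion_ex_borel_measurable_real[OF f] by blast
  have fg': "AE x in lebesgue. f x = g x" using fg by (rule AE_completion)
  have g': "g \<in> borel_measurable lebesgue" using g by (rule measurable_completion)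
  have m: "(\<lambda>x. indicator (box a b) x * u x :: real) \<in> borel_measurable lebesgue"
    if "u \<in> borel_measurable lebesgue" for a b u
    using that by (intro borel_measurable_times borel_measurable_indicator) auto
  have intg: "integrable lborel (\<lambda>x. indicator (box a b) x * g x)" for a b
  proof -
    have "integrable lebesgue (\<lambda>x. indicator (box a b) x * g x)"
    proof (rule integrable_cong_AE_imp[OF int])
      show "AE x in lebesgue. indicator (box a b) x * f x = indicator (box a b) x * g x"
        using fg' by eventually_elim simp
    qed (intro m f g')+
    then show ?thesis by (subst (asm) integrable_completion) auto
  qed
  have zg: "(\<integral>x. indicator (box a b) x * g x \<partial>lborel) = 0" for a b
  proof -
    have "(\<integral>x. indicator (box a b) x * g x \<partial>lborel) = (\<integral>x. indicator (box a b) x * g x \<partial>lebesgue)"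
      by (rule integral_completion[symmetric]) measurable
    also have "\<dots> = (\<integral>x. indicator (box a b) x * f x \<partial>lebesgue)"
    proof (rule integral_cong_AE)
      show "AE x in lebesgue. indicator (box a b) x * g x = indicator (box a b) x * f x"
        using fg' by eventually_elim simp
    qed (intro m f g')+
    finally show ?thesis using zero by simp
  qed
  \<comment> \<open>\<open>ennreal\<close> sends negative numbers to 0, so these densities are the
    positive and the negative part of \<open>g\<close>.\<close>
  have eq: "density lborel (\<lambda>x. ennreal (g x)) = density lborel (\<lambda>x. ennreal (- g x))"
  proof (rule measure_eqI_generator_eq)
    let ?E = "range (\<lambda>(a, b). box a b :: 'a set)"
    show "Int_stable ?E" by (auto simp: Int_stable_def box_Int_box)
    show "?E \<subseteq> Pow UNIV" by simp
    show "sets (density lborel (\<lambda>x. ennreal (g x))) = sigma_sets UNIV ?E"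
      "sets (density lborel (\<lambda>x. ennreal (- g x))) = sigma_sets UNIV ?E"
      by (simp_all add: borel_eq_box)
    let ?A = "\<lambda>n::nat. box (- (real n *\<^sub>R One)) (real n *\<^sub>R One) :: 'a set"
    show "range ?A \<subseteq> ?E" "(\<Union>i. ?A i) = UNIV" unfolding UN_box_eq_UNIV by auto
    have em: "emeasure (density lborel (\<lambda>x. ennreal (g x))) (box a b) = (\<integral>\<^sup>+x. ennreal (indicator (box a b) x * g x) \<partial>lborel)"
      "emeasure (density lborel (\<lambda>x. ennreal (- g x))) (box a b) = (\<integral>\<^sup>+x. ennreal (- (indicator (box a b) x * g x)) \<partial>lborel)" for a b
      by (auto simp: emeasure_density indicator_def intro!: nn_integral_cong)
    have fin: "(\<integral>\<^sup>+x. ennreal (indicator (box a b) x * g x) \<partial>lborel) \<noteq> \<infinity>"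
      "(\<integral>\<^sup>+x. ennreal (- (indicator (box a b) x * g x)) \<partial>lborel) \<noteq> \<infinity>" for a b
      using intg[of a b] by (simp_all add: real_integrable_def)
    show "emeasure (density lborel (\<lambda>x. ennreal (g x))) (?A n) \<noteq> \<infinity>" for n
      unfolding em by (rule fin)
    fix X assume "X \<in> ?E"
    then obtain a b where X: "X = box a b" by auto
    have "enn2real (\<integral>\<^sup>+x. ennreal (indicator (box a b) x * g x) \<partial>lborel) =
        enn2real (\<integral>\<^sup>+x. ennreal (- (indicator (box a b) x * g x)) \<partial>lborel)"
      using real_lebesgue_integral_def[OF intg, of a b] zg[of a b] by simp
    moreover have "A = B" if "enn2real A = enn2real B" "A \<noteq> \<infinity>" "B \<noteq> \<infinity>" for A B
      using that by (cases A; cases B) auto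
    ultimately show "emeasure (density lborel (\<lambda>x. ennreal (g x))) X = emeasure (density lborel (\<lambda>x. ennreal (- g x))) X"
      unfolding X em using fin[of a b] by blast
  qed
  have "AE x in lborel. ennreal (g x) = ennreal (- g x)"
    by (rule sigma_finite_measure.density_unique[OF lborel.sigma_finite_measure_axioms _ _ eq]) measurable
  then have "AE x in lborel. g x = 0"
  proof eventually_elim
    case (elim x)
    then show ?case by (cases "0 \<le> g x") (auto simp: ennreal_neg ennreal_eq_0_iff dest: sym)
  qed
  then have "AE x in lborel. f x = 0" using fg by eventually_elim simp
  then show ?thesis by (rule AE_completion)
qed

text \<open>The fundamental lemma of the calculus of variations. Integrability over a box comes from
  one bump that is bounded below on it, and the integral over a box is the limit of integrals
  against bumps with \<open>c = 1 / Suc m\<close>.\<close>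

lemma AE_eq_0_of_schwartz:
  fixes h :: "real ^ 'n::finite \<Rightarrow> complex"
  assumes h: "h \<in> borel_measurable lebesgue"
    and int: "\<And>\<phi>. \<phi> \<in> schwartz \<Longrightarrow> integrable lebesgue (\<lambda>x. h x * \<phi> x)"
    and zero: "\<And>\<phi>. \<phi> \<in> schwartz \<Longrightarrow> (\<integral>x. h x * \<phi> x \<partial>lebesgue) = 0"
  shows "AE x in lebesgue. h x = 0"
proof -
  have empty: "box a b = {}" if ab: "\<not> (\<forall>i. a $ i < b $ i)" for a b :: "real ^ 'n"
  proof -
    obtain i where "b $ i \<le> a $ i" using ab by (auto simp: not_less)
    then have "x \<notin> box a b" for x by (auto simp: mem_box_cart intro!: exI[of _ i])
    then show ?thesis by auto
  qed
  have hi: "integrable lebesgue (\<lambda>x. indicator (box a b) x * h x)" for a b :: "real ^ 'n"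
  proof (cases "\<forall>i. a $ i < b $ i")
    case True
    then have "box_bump (a - 1) (b + 1) 1 \<in> schwartz"
      by (intro box_bump_schwartz) (auto intro: order.strict_trans2 less_imp_le simp: less_diff_eq add_strict_mono add.commute)
    \<comment> \<open>\<open>exp 1 ^ CARD('n)\<close> is the reciprocal of the lower bound of the
      bump on the box.\<close>
    from int[OF this] have i: "integrable lebesgue (\<lambda>x. of_real (exp 1 ^ CARD('n)) * (h x * box_bump (a - 1) (b + 1) 1 x))"
      by (rule integrable_mult_right)
    show ?thesis
    proof (rule Bochner_Integration.integrable_bound[OF i])
      show "AE x in lebesgue. norm (indicator (box a b) x * h x) \<le> norm (of_real (exp 1 ^ CARD('n)) * (h x * box_bump (a - 1) (b + 1) 1 x))"
      proof (rule AE_I2)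
        fix x
        show "norm (indicator (box a b) x * h x) \<le> norm (of_real (exp 1 ^ CARD('n)) * (h x * box_bump (a - 1) (b + 1) 1 x))"
        proof (cases "x \<in> box a b")
          case True
          have "1 = exp 1 ^ CARD('n) * exp (- 1 :: real) ^ CARD('n)"
            by (simp flip: power_mult_distrib exp_add)
          also have "\<dots> \<le> exp 1 ^ CARD('n) * cmod (box_bump (a - 1) (b + 1) 1 x)"
            by (intro mult_left_mono box_bump_lower_bound[OF True]) auto
          finally have "cmod (h x) * 1 \<le> cmod (h x) * (exp 1 ^ CARD('n) * cmod (box_bump (a - 1) (b + 1) 1 x))"
            by (rule mult_left_mono) simp
          then show ?thesis using True by (simp add: norm_mult norm_power mult_ac)
        qed simp
      qed
    qed (intro borel_measurable_times borel_measurable_indicator h, simp)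
  qed (simp add: empty)
  have hz: "(\<integral>x. indicator (box a b) x * h x \<partial>lebesgue) = 0" for a b :: "real ^ 'n"
  proof (cases "\<forall>i. a $ i < b $ i")
    case True
    have s: "box_bump a b (1 / real (Suc m)) \<in> schwartz" for m
      by (rule box_bump_schwartz) (use True in auto)
    have "(\<lambda>m. \<integral>x. h x * box_bump a b (1 / real (Suc m)) x \<partial>lebesgue) \<longlonglongrightarrow> (\<integral>x. h x * indicator (box a b) x \<partial>lebesgue)"
    proof (rule integral_dominated_convergence)
      show "integrable lebesgue (\<lambda>x. norm (indicator (box a b) x * h x))" using hi by (rule integrable_norm)
      show "AE x in lebesgue. (\<lambda>m. h x * box_bump a b (1 / real (Suc m)) x) \<longlonglongrightarrow> h x * indicator (box a b) x"
        by (intro AE_I2 tendsto_mult tendsto_const box_bump_tendsto_indicator)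
      show "AE x in lebesgue. norm (h x * box_bump a b (1 / real (Suc m)) x) \<le> norm (indicator (box a b) x * h x)" for m
      proof (rule AE_I2)
        fix x
        have "cmod (h x) * cmod (box_bump a b (1 / real (Suc m)) x) \<le> cmod (h x) * indicator (box a b) x"
          by (intro mult_left_mono box_bump_norm_le) auto
        then show "norm (h x * box_bump a b (1 / real (Suc m)) x) \<le> norm (indicator (box a b) x * h x)"
          by (auto simp: norm_mult indicator_def)
      qed
      show "(\<lambda>x. h x * box_bump a b (1 / real (Suc m)) x) \<in> borel_measurable lebesgue" for m
        using int[OF s] by (rule borel_measurable_integrable)
      show "(\<lambda>x. h x * indicator (box a b) x) \<in> borel_measurable lebesgue"
        by (intro borel_measurable_times borel_measurable_indicator h) simp
    qed
    then have "(\<integral>x. h x * indicator (box a b) x \<partial>lebesgue) = 0"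
      using zero[OF s] LIMSEQ_unique[OF tendsto_const] by fastforce
    then show ?thesis by (simp add: mult.commute)
  qed (simp add: empty)
  have iRe: "(\<lambda>x. indicator A x * Re (h x)) = (\<lambda>x. Re (indicator A x * h x))"
    and iIm: "(\<lambda>x. indicator A x * Im (h x)) = (\<lambda>x. Im (indicator A x * h x))" for A
    by (auto simp: indicator_def)
  have Re_meas: "(\<lambda>x. Re (h x)) \<in> borel_measurable lebesgue" and Im_meas: "(\<lambda>x. Im (h x)) \<in> borel_measurable lebesgue"
    by (intro borel_measurable_continuous_on[OF _ h] continuous_intros)+
  have "AE x in lebesgue. Re (h x) = 0"
  proof (rule AE_eq_0_of_box_integrals[OF Re_meas])
    fix a b :: "real ^ 'n"
    show "integrable lebesgue (\<lambda>x. indicator (box a b) x * Re (h x))"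
      unfolding iRe by (rule integrable_Re[OF hi])
    show "(\<integral>x. indicator (box a b) x * Re (h x) \<partial>lebesgue) = 0"
      unfolding iRe integral_Re[OF hi] hz by simp
  qed
  moreover have "AE x in lebesgue. Im (h x) = 0"
  proof (rule AE_eq_0_of_box_integrals[OF Im_meas])
    fix a b :: "real ^ 'n"
    show "integrable lebesgue (\<lambda>x. indicator (box a b) x * Im (h x))"
      unfolding iIm by (rule integrable_Im[OF hi])
    show "(\<integral>x. indicator (box a b) x * Im (h x) \<partial>lebesgue) = 0"
      unfolding iIm integral_Im[OF hi] hz by simp
  qed
  ultimately show ?thesis by eventually_elim (simp add: complex_eq_iff)
qed

section \<open>Dyadic cubes and weights\<close>

lemma sigma_finite_lebesgue: "sigma_finite_measure (lebesgue :: 'a::euclidean_space measure)"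
proof
  show "\<exists>A. countable A \<and> A \<subseteq> sets (lebesgue :: 'a measure) \<and> \<Union>A = space lebesgue \<and> (\<forall>a\<in>A. emeasure lebesgue a \<noteq> \<infinity>)"
  proof (intro exI[of _ "range (\<lambda>n::nat. box (- (real n *\<^sub>R One)) (real n *\<^sub>R One))"] conjI)
    show "\<Union>(range (\<lambda>n::nat. box (- (real n *\<^sub>R One)) (real n *\<^sub>R One))) = space (lebesgue :: 'a measure)"
      unfolding UN_box_eq_UNIV by simp
    show "\<forall>a\<in>range (\<lambda>n::nat. box (- (real n *\<^sub>R One)) (real n *\<^sub>R One)). emeasure (lebesgue :: 'a measure) a \<noteq> \<infinity>"
      using emeasure_lborel_box_finite by (auto simp: less_top)
  qed auto
qed

lemma dyadic_cube_eq_cbox: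
  "dyadic_cube J M = cbox (\<chi> i. 2 powr (- of_int J) * (of_int (M $ i) - 1)) (\<chi> i. 2 powr (- of_int J) * (of_int (M $ i) + 1))"
proof (intro set_eqI iffI)
  define s :: real where "s = 2 powr (- of_int J)"
  have s: "0 < s" "2 powi (- J) = s"
    using powr_real_of_int'[of 2 "- J"] by (simp_all add: s_def)
  fix x :: "real ^ 'a"
  show "x \<in> cbox (\<chi> i. 2 powr (- of_int J) * (of_int (M $ i) - 1)) (\<chi> i. 2 powr (- of_int J) * (of_int (M $ i) + 1))"
    if "x \<in> dyadic_cube J M"
  proof -
    obtain y where y: "x = s *\<^sub>R ((\<chi> i. of_int (M $ i)) + y)" "\<And>i. - 1 \<le> y $ i \<and> y $ i \<le> 1"
      using \<open>x \<in> dyadic_cube J M\<close> s by (auto simp: dyadic_cube_def)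
    have "s * (of_int (M $ i) - 1) \<le> x $ i \<and> x $ i \<le> s * (of_int (M $ i) + 1)" for i
      using y(2)[of i] s by (simp add: y(1))
    then show ?thesis by (simp add: mem_box_cart s_def)
  qed
  show "x \<in> dyadic_cube J M"
    if "x \<in> cbox (\<chi> i. 2 powr (- of_int J) * (of_int (M $ i) - 1)) (\<chi> i. 2 powr (- of_int J) * (of_int (M $ i) + 1))"
  proof -
    have x: "s * (of_int (M $ i) - 1) \<le> x $ i \<and> x $ i \<le> s * (of_int (M $ i) + 1)" for i
      using that by (auto simp: mem_box_cart s_def)
    define y where "y = (\<chi> i. x $ i / s - of_int (M $ i))"
    have "- 1 \<le> y $ i \<and> y $ i \<le> 1" for i
      using x[of i] s(1) by (simp add: y_def field_simps)
    moreover have "x = s *\<^sub>R ((\<chi> i. of_int (M $ i)) + y)"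
      using s(1) by (simp add: vec_eq_iff y_def)
    ultimately show ?thesis unfolding dyadic_cube_def s(2) by blast
  qed
qed

lemma dyadic_cube_sets [measurable]: "dyadic_cube J M \<in> sets lebesgue"
  unfolding dyadic_cube_eq_cbox by simp

lemma closed_dyadic_cube: "closed (dyadic_cube J M)"
  unfolding dyadic_cube_eq_cbox by (rule closed_cbox)

lemma emeasure_dyadic_cube:
  fixes M :: "int ^ 'n::finite"
  shows "emeasure lebesgue (dyadic_cube J M) = ennreal (2 powr ((1 - of_int J) * real CARD('n)))"
proof -
  define a b :: "real ^ 'n" where "a = (\<chi> i. 2 powr (- of_int J) * (of_int (M $ i) - 1))"
    and "b = (\<chi> i. 2 powr (- of_int J) * (of_int (M $ i) + 1))"
  have "a $ i \<le> b $ i" for i by (simp add: a_def b_def)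
  then have ne: "cbox a b \<noteq> {}" by (auto simp: mem_box_cart ex_in_conv[symmetric] intro!: exI[of _ a])
  have "measure lborel (cbox a b) = (\<Prod>i\<in>UNIV. b $ i - a $ i)" by (rule content_cbox_cart[OF ne])
  also have "\<dots> = (\<Prod>i\<in>(UNIV :: 'n set). 2 powr (1 - of_int J))"
  proof (rule prod.cong)
    fix i
    have "2 powr (1 - of_int J :: real) = 2 * 2 powr (- of_int J)"
      by (simp add: powr_diff powr_minus divide_inverse)
    then show "b $ i - a $ i = 2 powr (1 - of_int J)" by (simp add: a_def b_def algebra_simps)
  qed simp
  also have "\<dots> = 2 powr ((1 - of_int J) * real CARD('n))"
    by (simp add: powr_realpow[symmetric] powr_powr)
  finally have "emeasure lborel (cbox a b) = ennreal (2 powr ((1 - of_int J) * real CARD('n)))"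
    using emeasure_lborel_cbox_finite[of a b] by (simp add: emeasure_eq_ennreal_measure less_top)
  then show ?thesis unfolding dyadic_cube_eq_cbox a_def[symmetric] b_def[symmetric] by simp
qed

section \<open>Central cubes, shells and weights\<close>

lemma mem_central_cube:
  fixes x :: "real ^ 'n::finite"
  shows "x \<in> dyadic_cube (- int k) 0 \<longleftrightarrow> (\<forall>i. \<bar>x $ i\<bar> \<le> 2 ^ k)"
  by (auto simp: dyadic_cube_eq_cbox mem_box_cart powr_realpow abs_le_iff) (metis minus_le_iff)+

lemma norm_ge_outside_central_cube:
  fixes x :: "real ^ 'n::finite"
  assumes "x \<notin> dyadic_cube (- int k) 0"
  shows "2 ^ k \<le> norm x"
proof -
  obtain i where "2 ^ k < \<bar>x $ i\<bar>" using assms by (auto simp: mem_central_cube not_le)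
  then show ?thesis using component_le_norm_cart[of x i] by linarith
qed

lemma bounded_subset_central_cube:
  fixes S :: "(real ^ 'n::finite) set"
  assumes "bounded S"
  shows "\<exists>k. S \<subseteq> dyadic_cube (- int k) 0"
proof -
  obtain B where B: "\<And>x. x \<in> S \<Longrightarrow> norm x \<le> B" using assms by (auto simp: bounded_iff)
  obtain k where k: "B < 2 ^ k" using real_arch_pow[of 2 B] by auto
  have "x \<in> dyadic_cube (- int k) 0" if "x \<in> S" for x
  proof -
    have "\<bar>x $ i\<bar> \<le> 2 ^ k" for i
      using component_le_norm_cart[of x i] B[OF that] k by linarith
    then show ?thesis by (simp add: mem_central_cube)
  qed
  then show ?thesis by blast
qed

text \<open>Difference of consecutive central cubes; \<open>k = 0\<close> is exempted because the
  truncated \<open>k - 1\<close> would remove the whole cube.\<close>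

definition central_shell :: "nat \<Rightarrow> (real ^ 'n::finite) set" where
  "central_shell k = {x \<in> dyadic_cube (- int k) 0. k = 0 \<or> x \<notin> dyadic_cube (- int (k - 1)) 0}"

lemma central_shell_sets [measurable]: "central_shell k \<in> sets lebesgue"
proof -
  have eq: "central_shell k = (if k = 0 then dyadic_cube (- int k) 0 else dyadic_cube (- int k) 0 - dyadic_cube (- int (k - 1)) 0)"
    by (auto simp: central_shell_def)
  show ?thesis unfolding eq using dyadic_cube_sets sets.Diff by auto
qed

lemma central_shell_cover: "\<exists>k. x \<in> central_shell k"
proof -
  obtain k0 where "x \<in> dyadic_cube (- int k0) 0" using bounded_subset_central_cube[of "{x}"] by auto
  define k where "k = (LEAST k. x \<in> dyadic_cube (- int k) 0)"
  have "x \<in> dyadic_cube (- int k) 0" unfolding k_def by (rule LeastI) fact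
  moreover have "x \<notin> dyadic_cube (- int (k - 1)) 0" if "k \<noteq> 0"
  proof -
    have "k - 1 < k" using that by simp
    then show ?thesis using not_less_Least[of "k - 1" "\<lambda>k. x \<in> dyadic_cube (- int k) 0"]
      unfolding k_def[symmetric] by blast
  qed
  ultimately have "x \<in> central_shell k" unfolding central_shell_def by blast
  then show ?thesis ..
qed

lemma weight_pos: "0 < weight \<alpha> x"
proof -
  have "0 < 1 + (norm x)\<^sup>2" by (rule add_pos_nonneg) auto
  then show ?thesis by (simp add: weight_def)
qed

lemma borel_measurable_weight [measurable]: "weight \<alpha> \<in> borel_measurable borel"
  unfolding weight_def[abs_def] by measurable

lemma weight_lebesgue_measurable: "weight \<alpha> \<in> borel_measurable lebesgue"
  using borel_measurable_weight by (intro measurable_completion) simp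

lemma weight_powr: "weight \<alpha> x powr p = weight (\<alpha> * p) x"
  by (simp add: weight_def powr_powr)

lemma weight_mult: "weight \<alpha> x * weight \<beta> x = weight (\<alpha> + \<beta>) x"
  by (simp add: weight_def powr_add[symmetric] add_divide_distrib)

lemma weight_minus: "weight (- \<alpha>) x = inverse (weight \<alpha> x)"
  by (simp add: weight_def powr_minus)

text \<open>Shell \<open>k\<close> lies outside the cube of half-width \<open>2 ^ (k - 1)\<close>,
  whence the exponent \<open>k - 1\<close>. For \<open>k = 0\<close> the bound is weaker than the
  obvious 1, which keeps the formula uniform.\<close>

lemma weight_ge_shell:
  assumes \<alpha>: "0 < \<alpha>" and x: "x \<in> central_shell k"
  shows "2 powr ((real k - 1) * \<alpha>) \<le> weight \<alpha> x"
proof (cases "k = 0")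
  case True
  have "2 powr ((real k - 1) * \<alpha>) \<le> 2 powr 0" using True \<alpha> by (intro powr_mono) auto
  also have "\<dots> = 1 powr (\<alpha> / 2)" by simp
  also have "\<dots> \<le> weight \<alpha> x" unfolding weight_def using \<alpha> by (intro powr_mono2) auto
  finally show ?thesis .
next
  case False
  then have "x \<notin> dyadic_cube (- int (k - 1)) 0"
    using x unfolding central_shell_def by blast
  then have "2 ^ (k - 1) \<le> norm x" by (rule norm_ge_outside_central_cube)
  then have "2 powr (real k - 1) \<le> norm x"
    using False by (simp add: powr_realpow[symmetric] of_nat_diff)
  then have "(2 powr (real k - 1))\<^sup>2 \<le> 1 + (norm x)\<^sup>2"
    by (smt (verit) power_mono powr_ge_zero)
  then have "((2 powr (real k - 1))\<^sup>2) powr (\<alpha> / 2) \<le> weight \<alpha> x"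
    unfolding weight_def using \<alpha> by (intro powr_mono2) auto
  moreover have "((2 powr (real k - 1))\<^sup>2) powr (\<alpha> / 2) = 2 powr ((real k - 1) * \<alpha>)"
    by (simp add: power2_eq_square powr_add[symmetric] powr_powr algebra_simps add_divide_distrib diff_divide_distrib)
  ultimately show ?thesis by simp
qed

lemma weight_minus_le_shell:
  assumes "0 < \<alpha>" "x \<in> central_shell k"
  shows "weight (- \<alpha>) x \<le> 2 powr (- (real k - 1) * \<alpha>)"
proof -
  have "inverse (weight \<alpha> x) \<le> inverse (2 powr ((real k - 1) * \<alpha>))"
    using weight_ge_shell[OF assms] by (intro le_imp_inverse_le) auto
  then show ?thesis by (simp add: weight_minus powr_minus[symmetric] algebra_simps)
qed

lemma ennreal_le_suminf: "f k \<le> (\<Sum>k. f k)" for f :: "nat \<Rightarrow> ennreal"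
  using sum_le_suminf[of f "{k}"] by simp

text \<open>On the shell of index \<open>k\<close> the weight is at most
  \<open>2 powr (- (k - 1) * s)\<close>, and the cube around it has volume
  \<open>2 powr ((1 + k) * n)\<close>: a geometric series with ratio
  \<open>2 powr (n - s)\<close>.\<close>

lemma nn_integral_weight_finite:
  assumes s: "real CARD('n::finite) < s"
  shows "(\<integral>\<^sup>+x. ennreal (weight (- s) (x :: real ^ 'n)) \<partial>lebesgue) < \<infinity>"
proof -
  define n where "n = real CARD('n)"
  have s0: "0 < s" using s by (rule le_less_trans[rotated]) simp
  define D where "D k = dyadic_cube (- int k) (0 :: int ^ 'n)" for k
  have [measurable]: "D k \<in> sets lebesgue" for k by (simp add: D_def dyadic_cube_sets)
  have le: "ennreal (weight (- s) x) \<le> (\<Sum>k. ennreal (2 powr (- (real k - 1) * s)) * indicator (D k) x)" for x :: "real ^ 'n"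
  proof -
    obtain k where k: "x \<in> central_shell k" using central_shell_cover by blast
    have "ennreal (weight (- s) x) \<le> ennreal (2 powr (- (real k - 1) * s)) * indicator (D k) x"
      using weight_minus_le_shell[OF s0 k] k by (auto simp: D_def central_shell_def intro: ennreal_leI)
    also have "\<dots> \<le> (\<Sum>k. ennreal (2 powr (- (real k - 1) * s)) * indicator (D k) x)"
      by (rule ennreal_le_suminf)
    finally show ?thesis .
  qed
  have "(\<integral>\<^sup>+x. ennreal (weight (- s) (x :: real ^ 'n)) \<partial>lebesgue)
      \<le> (\<integral>\<^sup>+x. (\<Sum>k. ennreal (2 powr (- (real k - 1) * s)) * indicator (D k) x) \<partial>lebesgue)"
    by (intro nn_integral_mono le)
  also have "\<dots> = (\<Sum>k. \<integral>\<^sup>+x. ennreal (2 powr (- (real k - 1) * s)) * indicator (D k) x \<partial>lebesgue)"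
    by (rule nn_integral_suminf) simp
  also have "\<dots> = (\<Sum>k. ennreal (2 powr (s + n) * (2 powr (n - s)) ^ k))"
  proof (rule arg_cong[where f = suminf], rule ext)
    fix k
    have "(\<integral>\<^sup>+x. ennreal (2 powr (- (real k - 1) * s)) * indicator (D k) x \<partial>lebesgue)
      = ennreal (2 powr (- (real k - 1) * s)) * ennreal (2 powr ((1 + real k) * n))"
      using emeasure_dyadic_cube[of "- int k" "0 :: int ^ 'n"]
      by (simp add: nn_integral_cmult_indicator D_def n_def)
    also have "\<dots> = ennreal (2 powr (- (real k - 1) * s + (1 + real k) * n))"
      by (simp add: powr_add flip: ennreal_mult)
    also have "- (real k - 1) * s + (1 + real k) * n = (s + n) + (n - s) * real k"
      by (simp add: algebra_simps)
    also have "2 powr ((s + n) + (n - s) * real k) = 2 powr (s + n) * (2 powr (n - s)) ^ k"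
      by (simp add: powr_add powr_powr[symmetric] powr_realpow)
    finally show "(\<integral>\<^sup>+x. ennreal (2 powr (- (real k - 1) * s)) * indicator (D k) x \<partial>lebesgue)
      = ennreal (2 powr (s + n) * (2 powr (n - s)) ^ k)" .
  qed
  also have "\<dots> < \<infinity>"
  proof -
    have "2 powr (n - s) < 2 powr (0::real)" using s by (intro powr_less_mono) (auto simp: n_def)
    then have "summable (\<lambda>k. 2 powr (s + n) * (2 powr (n - s)) ^ k)"
      by (intro summable_mult summable_geometric) simp
    then show ?thesis by (simp add: suminf_ennreal2)
  qed
  finally show ?thesis .
qed

section \<open>Lebesgue spaces and distributions\<close>

lemma lq_fun_eq: "lq_fun s f x = of_real (lq_norm s (\<lambda>j. f j x))"
  by (simp add: lq_fun_def lq_norm_def)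

lemma cmod_lq_fun: "cmod (lq_fun s f x) = lq_norm s (\<lambda>j. f j x)"
  by (simp add: lq_fun_eq)

lemma lq_fun_measurable:
  assumes "\<And>j. f j \<in> borel_measurable lebesgue"
  shows "lq_fun s f \<in> borel_measurable lebesgue"
proof -
  note [measurable] = assms
  have "lq_fun s f = (\<lambda>x. of_real (lq_norm s (\<lambda>j. f j x)))" by (simp add: fun_eq_iff lq_fun_eq)
  then show ?thesis by simp
qed

text \<open>Converts norms over restricted measures into nonnegative integrals with an indicator,
  the form in which the duality is stated.\<close>

lemma Lp_on_iff:
  fixes f :: "real ^ 'n::finite \<Rightarrow> complex"
  assumes S: "S \<in> sets lebesgue" and f: "f \<in> borel_measurable lebesgue" and s: "0 < s"
  shows "f \<in> Lp_on S s \<longleftrightarrow> (\<integral>\<^sup>+x. ennreal (cmod (f x) powr s * indicator S x) \<partial>lebesgue) < \<infinity>"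
    and "f \<in> Lp_on S s \<Longrightarrow> (\<integral>\<^sup>+x. ennreal (cmod (f x) powr s * indicator S x) \<partial>lebesgue) = ennreal (Lp_norm_on S s f powr s)"
    and "0 \<le> Lp_norm_on S s f"
proof -
  note [measurable] = f
  have meas: "(\<lambda>x. cmod (f x) powr s * indicator S x) \<in> borel_measurable lebesgue"
    using S by measurable
  have eq: "integrable (lebesgue_on S) (\<lambda>x. cmod (f x) powr s) \<longleftrightarrow> integrable lebesgue (\<lambda>x. cmod (f x) powr s * indicator S x)"
    using S by (subst integrable_restrict_space) (auto simp: mult.commute)
  have eqi: "(\<integral>x. cmod (f x) powr s \<partial>lebesgue_on S) = (\<integral>x. cmod (f x) powr s * indicator S x \<partial>lebesgue)"
    using S by (subst integral_restrict_space) (auto simp: mult.commute)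
  have fS: "f \<in> borel_measurable (lebesgue_on S)" using f by (rule measurable_restrict_space1)
  have "f \<in> Lp_on S s \<longleftrightarrow> integrable lebesgue (\<lambda>x. cmod (f x) powr s * indicator S x)"
    using fS eq by (simp add: Lp_on_def)
  then show "f \<in> Lp_on S s \<longleftrightarrow> (\<integral>\<^sup>+x. ennreal (cmod (f x) powr s * indicator S x) \<partial>lebesgue) < \<infinity>"
    using meas by (simp add: integrable_iff_bounded)
  show "0 \<le> Lp_norm_on S s f" by (simp add: Lp_norm_on_def)
  assume "f \<in> Lp_on S s"
  then have int: "integrable lebesgue (\<lambda>x. cmod (f x) powr s * indicator S x)"
    using eq by (simp add: Lp_on_def)
  have "Lp_norm_on S s f powr s = (\<integral>x. cmod (f x) powr s * indicator S x \<partial>lebesgue)"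
    unfolding Lp_norm_on_def eqi using s by (intro powr_powr_cancel(1) integral_nonneg_AE) auto
  then show "(\<integral>\<^sup>+x. ennreal (cmod (f x) powr s * indicator S x) \<partial>lebesgue) = ennreal (Lp_norm_on S s f powr s)"
    using int by (simp add: nn_integral_eq_integral)
qed

lemma Lp_norm_on_le:
  fixes f :: "real ^ 'n::finite \<Rightarrow> complex"
  assumes S: "S \<in> sets lebesgue" and f: "f \<in> borel_measurable lebesgue" and s: "0 < s" and B: "0 \<le> B"
    and le: "(\<integral>\<^sup>+x. ennreal (cmod (f x) powr s * indicator S x) \<partial>lebesgue) \<le> ennreal (B powr s)"
  shows "f \<in> Lp_on S s" "Lp_norm_on S s f \<le> B"
proof -
  show L: "f \<in> Lp_on S s"
    using le by (subst Lp_on_iff(1)[OF S f s]) (auto intro: le_less_trans)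
  have "ennreal (Lp_norm_on S s f powr s) \<le> ennreal (B powr s)"
    using le Lp_on_iff(2)[OF S f s L] by simp
  then have le': "Lp_norm_on S s f powr s \<le> B powr s" by simp
  show "Lp_norm_on S s f \<le> B"
  proof (rule ccontr)
    assume "\<not> Lp_norm_on S s f \<le> B"
    then have "B powr s < Lp_norm_on S s f powr s" using B s by (intro powr_less_mono2) auto
    then show False using le' by simp
  qed
qed

text \<open>The complement of the essential support is a union of possibly uncountably many open
  sets; Lindelof leaves a countable subfamily, whose exceptional null sets can be united.\<close>

lemma AE_outside_ess_supp:
  fixes a :: "real ^ 'n::finite \<Rightarrow> complex"
  shows "AE x in lebesgue. x \<notin> ess_supp a \<longrightarrow> a x = 0"
proof -
  obtain \<U> where \<U>: "\<U> \<subseteq> {U. open U \<and> (AE x in lebesgue. x \<in> U \<longrightarrow> a x = 0)}" "countable \<U>"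
    "\<Union>\<U> = \<Union>{U. open U \<and> (AE x in lebesgue. x \<in> U \<longrightarrow> a x = 0)}"
    using Lindelof[of "{U. open U \<and> (AE x in lebesgue. x \<in> U \<longrightarrow> a x = 0)}"] by blast
  have "AE x in lebesgue. \<forall>U\<in>\<U>. x \<in> U \<longrightarrow> a x = 0"
    by (rule AE_ball_countable[THEN iffD2, OF \<U>(2)]) (use \<U>(1) in auto)
  then show ?thesis by eventually_elim (use \<U>(3) in \<open>auto simp: ess_supp_def\<close>)
qed

lemma schwartz_measurable:
  fixes \<phi> :: "real ^ 'n::finite \<Rightarrow> complex"
  assumes "\<phi> \<in> schwartz"
  shows "\<phi> \<in> borel_measurable lebesgue"
proof -
  have "iter_partial [] \<phi> differentiable_on UNIV" using assms unfolding schwartz_def by blast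
  then have "continuous_on UNIV \<phi>" by (simp add: differentiable_imp_continuous_on)
  then have "\<phi> \<in> borel_measurable lborel" using borel_measurable_continuous_onI by simp
  then show ?thesis by (rule measurable_completion)
qed

lemma schwartz_le_norm:
  \<comment> \<open>The derivatives of order up to \<open>N\<close> are finitely many and each has a
    finite bound, so the supremum is a genuine upper bound; the empty list gives
    \<open>\<phi>\<close> itself.\<close>
  fixes \<phi> :: "real ^ 'n::finite \<Rightarrow> complex"
  assumes \<phi>: "\<phi> \<in> schwartz"
  shows "(1 + norm x) ^ N * cmod (\<phi> x) \<le> schwartz_norm N \<phi>"
proof -
  define A where "A = (\<lambda>(ls, x). (1 + norm x) ^ N * cmod (iter_partial ls \<phi> x)) ` ({ls :: 'n list. length ls \<le> N} \<times> UNIV)"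
  have fin: "finite {ls :: 'n list. length ls \<le> N}"
    using finite_lists_length_le[of "UNIV :: 'n set" N] by simp
  have "A = (\<Union>ls\<in>{ls :: 'n list. length ls \<le> N}. range (\<lambda>x. (1 + norm x) ^ N * cmod (iter_partial ls \<phi> x)))"
    by (auto simp: A_def)
  moreover have "bdd_above (range (\<lambda>x. (1 + norm x) ^ N * cmod (iter_partial ls \<phi> x)))" for ls
  proof -
    have "bounded (range (\<lambda>x. (1 + norm x) ^ N *\<^sub>R iter_partial ls \<phi> x))"
      using \<phi> unfolding schwartz_def by blast
    then obtain B where "\<And>x. norm ((1 + norm x) ^ N *\<^sub>R iter_partial ls \<phi> x) \<le> B"
      by (auto simp: bounded_iff)
    then show ?thesis by (intro bdd_aboveI[of _ B]) auto
  qed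
  ultimately have "bdd_above A" using fin by simp
  then have "(1 + norm x) ^ N * cmod (iter_partial [] \<phi> x) \<le> Sup A"
    by (intro cSup_upper) (auto simp: A_def intro!: image_eqI[of _ _ "([], x)"])
  then show ?thesis by (simp add: A_def schwartz_norm_def)
qed

section \<open>The Morrey and predual Morrey setting\<close>

definition cube_index :: "nat \<Rightarrow> int \<times> (int ^ 'n::finite)" where
  "cube_index = from_nat_into UNIV"

lemma bij_cube_index: "bij (cube_index :: nat \<Rightarrow> int \<times> (int ^ 'n::finite))"
  unfolding cube_index_def
  by (rule bij_betw_from_nat_into) (auto simp: finite_prod infinite_UNIV_int)

text \<open>The parameter \<open>dim\<close> fixes the dimension type \<open>'n\<close>, which the
  numerical parameters do not determine.\<close>

locale morrey_setting =
  fixes p p' q q' r \<rho> \<alpha> :: real and dim :: "'n::finite itself"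
  assumes p: "1 < p" "1 / p + 1 / p' = 1" and q: "1 < q" "1 / q + 1 / q' = 1"
    and r: "- real CARD('n) / p < r" "r < 0" and \<rho>: "r + \<rho> = - real CARD('n)"
    and \<alpha>: "real CARD('n) / p < \<alpha>"
begin

definition cube :: "nat \<Rightarrow> (real ^ 'n) set" where
  "cube i = (case cube_index i of (J, M) \<Rightarrow> dyadic_cube J M)"

definition scale :: "nat \<Rightarrow> real" where
  "scale i = 2 powr (of_int (fst (cube_index i :: int \<times> (int ^ 'n))) * (real CARD('n) / p + r))"

definition decay :: "real ^ 'n \<Rightarrow> real" where
  "decay = weight (- (\<alpha> + real CARD('n) + 1))"

sublocale block_system lebesgue cube scale p p'
proof -
  interpret sigma_finite_measure "lebesgue :: (real ^ 'n) measure" by (rule sigma_finite_lebesgue)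
  show "block_system (lebesgue :: (real ^ 'n) measure) cube scale p p'"
    by unfold_locales (use p in \<open>auto simp: cube_def scale_def dyadic_cube_sets split: prod.split\<close>)
qed

lemma cube_index_surj: "\<exists>i. cube_index i = (J, M :: int ^ 'n)"
  using bij_is_surj[OF bij_cube_index] by (metis surjD)

lemma cube_UN: "(\<Union>i. cube i) = UNIV"
proof -
  have "x \<in> (\<Union>i. cube i)" for x :: "real ^ 'n"
  proof -
    obtain k where "x \<in> dyadic_cube (- int k) 0" using bounded_subset_central_cube[of "{x}"] by auto
    moreover obtain i where "cube_index i = (- int k, 0 :: int ^ 'n)" using cube_index_surj by blast
    ultimately show ?thesis by (auto simp: cube_def intro!: exI[of _ i])
  qed
  then show ?thesis by auto
qed

lemma emeasure_cube_finite: "emeasure lebesgue (cube i) < \<infinity>"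
  by (cases "cube_index i :: int \<times> (int ^ 'n)")
    (simp add: cube_def emeasure_dyadic_cube del: emeasure_completion)

section \<open>The weighted space and the decay weight\<close>

lemma \<alpha>_pos: "0 < \<alpha>"
  using \<alpha> p(1) by (smt (verit) divide_nonneg_nonneg of_nat_0_le_iff)

text \<open>\<open>F\<close> is cut along the shells, and shell \<open>k\<close> is placed in the
  central cube with \<open>J = - k\<close>. The weight gains
  \<open>2 powr (- (k - 1) * \<alpha>)\<close> there, the atom bound is
  \<open>2 powr (- k * \<theta>)\<close>, and the quotients are summable because
  \<open>\<theta> < n / p < \<alpha>\<close>. One constant serves all \<open>F\<close>, as an
  embedding requires.\<close>

lemma weighted_block:
  "\<exists>C. 0 \<le> C \<and> (\<forall>F A. F \<in> borel_measurable lebesgue \<longrightarrow> (\<forall>x. 0 \<le> F x) \<longrightarrow> 0 \<le> A \<longrightarrow>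
     (\<integral>\<^sup>+x. ennreal ((weight \<alpha> x * F x) powr p') \<partial>lebesgue) \<le> ennreal (A powr p') \<longrightarrow>
     block_fun F \<and> block_norm F \<le> C * A)"
proof -
  define \<theta> where "\<theta> = real CARD('n) / p + r"
  have \<theta>: "\<theta> < \<alpha>" using r \<alpha> by (simp add: \<theta>_def)
  \<comment> \<open>The coefficient of shell \<open>k = - J\<close> per unit of \<open>A\<close>;
    the factor \<open>2 powr \<alpha>\<close> stems from the exponent \<open>k - 1\<close> in the
    weight bound on shells.\<close>
  define U where "U = (\<lambda>(J :: int, M :: int ^ 'n). if J \<le> 0 \<and> M = 0 then 2 powr \<alpha> * 2 powr (of_int J * (\<alpha> - \<theta>)) else 0 :: real)"
  define T where "T i = U (cube_index i)" for i
  have T_nn: "0 \<le> T i" for i by (auto simp: T_def U_def split: prod.split)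
  have T_sum: "summable T"
  proof -
    define e where "e k = (- int k, 0 :: int ^ 'n)" for k
    have inj: "inj_on e UNIV" by (auto simp: inj_on_def e_def)
    have "2 powr (- (\<alpha> - \<theta>)) < 2 powr (0::real)" using \<theta> by (intro powr_less_mono) auto
    then have "summable (\<lambda>k. 2 powr \<alpha> * (2 powr (- (\<alpha> - \<theta>))) ^ k)"
      by (intro summable_mult summable_geometric) simp
    also have "(\<lambda>k. 2 powr \<alpha> * (2 powr (- (\<alpha> - \<theta>))) ^ k) = U \<circ> e"
    proof
      fix k
      have "(2 powr (- (\<alpha> - \<theta>))) ^ k = 2 powr (- (\<alpha> - \<theta>) * real k)"
        by (simp add: powr_powr[symmetric] powr_realpow)
      then show "2 powr \<alpha> * (2 powr (- (\<alpha> - \<theta>))) ^ k = (U \<circ> e) k"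
        by (simp add: U_def e_def algebra_simps)
    qed
    finally have "summable (U \<circ> e)" .
    moreover have "0 \<le> (U \<circ> e) k" for k by (auto simp: U_def e_def)
    ultimately have "(U \<circ> e) summable_on UNIV"
      by (simp only: summable_on_UNIV_nonneg_real_iff)
    then have "U summable_on (range e)" by (simp add: summable_on_reindex[OF inj])
    also have "U summable_on (range e) \<longleftrightarrow> U summable_on UNIV"
    proof (rule summable_on_cong_neutral)
      fix x assume "x \<in> UNIV - range e"
      moreover obtain J M where x: "x = (J, M)" by fastforce
      moreover have "x = e (nat (- J))" if "J \<le> 0" "M = 0" using that x by (simp add: e_def)
      ultimately show "U x = 0" by (auto simp: U_def)
    qed auto
    finally have "(\<lambda>i. U (cube_index i)) summable_on UNIV"
      by (subst summable_on_reindex_bij_betw[OF bij_cube_index]) simp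
    then show ?thesis unfolding T_def[abs_def]
      by (rule summable_on_imp_summable)
  qed
  define C where "C = suminf T"
  show ?thesis
  proof (intro exI[of _ C] conjI allI impI)
    show "0 \<le> C" unfolding C_def by (rule suminf_nonneg[OF T_sum T_nn])
    fix F :: "real ^ 'n \<Rightarrow> real" and A :: real
    assume F[measurable]: "F \<in> borel_measurable lebesgue" and nn: "\<forall>x. 0 \<le> F x" and A: "0 \<le> A"
      and le: "(\<integral>\<^sup>+x. ennreal ((weight \<alpha> x * F x) powr p') \<partial>lebesgue) \<le> ennreal (A powr p')"
    define t where "t i = A * T i" for i
    define b where "b i x = (case cube_index i of (J, M :: int ^ 'n) \<Rightarrow>
        if J \<le> 0 \<and> M = 0 then F x * indicator (central_shell (nat (- J))) x else 0)" for i x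
    have bm: "block_majorant F t b"
      unfolding block_majorant_def
    proof (intro conjI allI)
      show "summable t" unfolding t_def by (rule summable_mult[OF T_sum])
      fix i
      obtain J M where JM: "cube_index i = (J, M :: int ^ 'n)" by fastforce
      show "0 \<le> t i" using A T_nn by (simp add: t_def)
      have "(\<lambda>x. F x * indicator (central_shell (nat (- J))) x) \<in> borel_measurable lebesgue"
        by (intro borel_measurable_times borel_measurable_indicator F central_shell_sets)
      then show "b i \<in> borel_measurable lebesgue" unfolding b_def JM by simp
      show "0 \<le> b i x" for x using nn by (simp add: b_def JM)
      show "x \<notin> cube i \<longrightarrow> b i x = 0" for x
        by (auto simp: b_def JM cube_def central_shell_def)
      show "(\<integral>\<^sup>+x. ennreal (b i x powr p') \<partial>lebesgue) \<le> ennreal ((scale i * t i) powr p')"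
      proof (cases "J \<le> 0 \<and> M = 0")
        case True
        define k where "k = nat (- J)"
        have Jk: "of_int J = - real k" using True by (simp add: k_def)
        define D where "D = 2 powr (- (real k - 1) * \<alpha>)"
        have D: "0 < D" by (simp add: D_def)
        have bw: "b i x \<le> D * (weight \<alpha> x * F x)" for x
        proof (cases "x \<in> central_shell k")
          case x: True
          have "1 = D * 2 powr ((real k - 1) * \<alpha>)" by (simp add: D_def algebra_simps flip: powr_add)
          also have "\<dots> \<le> D * weight \<alpha> x"
            using D by (intro mult_left_mono weight_ge_shell[OF \<alpha>_pos x]) simp
          finally have "1 * F x \<le> (D * weight \<alpha> x) * F x" using nn by (intro mult_right_mono) auto
          then show ?thesis using True x by (simp add: b_def JM k_def mult.assoc)
        next
          case False
          then show ?thesis using True D nn weight_pos[of \<alpha> x] by (simp add: b_def JM k_def)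
        qed
        have st: "scale i * t i = D * A"
        proof -
          have "scale i * T i = 2 powr (- real k * \<theta>) * (2 powr \<alpha> * 2 powr (- real k * (\<alpha> - \<theta>)))"
            using True by (simp add: scale_def T_def JM U_def Jk \<theta>_def)
          also have "\<dots> = D" by (simp add: D_def algebra_simps flip: powr_add)
          finally show ?thesis by (simp add: t_def algebra_simps)
        qed
        have "(\<integral>\<^sup>+x. ennreal (b i x powr p') \<partial>lebesgue)
          \<le> (\<integral>\<^sup>+x. ennreal (D powr p') * ennreal ((weight \<alpha> x * F x) powr p') \<partial>lebesgue)"
        proof (rule nn_integral_mono)
          fix x
          have "b i x powr p' \<le> (D * (weight \<alpha> x * F x)) powr p'"
            using bw[of x] p' nn by (intro powr_mono2) (auto simp: b_def JM)
          also have "\<dots> = D powr p' * (weight \<alpha> x * F x) powr p'"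
            using D nn weight_pos[of \<alpha> x] by (simp add: powr_mult)
          finally show "ennreal (b i x powr p') \<le> ennreal (D powr p') * ennreal ((weight \<alpha> x * F x) powr p')"
            by (simp add: ennreal_leI flip: ennreal_mult)
        qed
        also have "\<dots> = ennreal (D powr p') * (\<integral>\<^sup>+x. ennreal ((weight \<alpha> x * F x) powr p') \<partial>lebesgue)"
        proof (rule nn_integral_cmult)
          show "(\<lambda>x. ennreal ((weight \<alpha> x * F x) powr p')) \<in> borel_measurable lebesgue"
            using weight_lebesgue_measurable F by measurable
        qed
        also have "\<dots> \<le> ennreal (D powr p') * ennreal (A powr p')" by (intro mult_left_mono le) simp
        also have "\<dots> = ennreal ((scale i * t i) powr p')"
          using D A by (simp add: st powr_mult flip: ennreal_mult)
        finally show ?thesis .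
      qed (auto simp: b_def JM)
    next
      have "ennreal (F x) \<le> (\<Sum>i. ennreal (b i x))" for x
      proof -
        obtain k where k: "x \<in> central_shell k" using central_shell_cover by blast
        obtain i where i: "cube_index i = (- int k, 0 :: int ^ 'n)" using cube_index_surj by blast
        have "b i x = F x" using k by (simp add: b_def i)
        then show ?thesis using ennreal_le_suminf[of "\<lambda>i. ennreal (b i x)" i] by simp
      qed
      then show "AE x in lebesgue. ennreal (F x) \<le> (\<Sum>i. ennreal (b i x))" by simp
    qed
    show "block_fun F" using bm by (auto simp: block_fun_def)
    show "block_norm F \<le> C * A"
      using block_norm_le[OF bm] suminf_mult[OF T_sum, of A] by (simp add: t_def[abs_def] C_def mult.commute)
  qed
qed


lemma decay_measurable [measurable]: "decay \<in> borel_measurable lebesgue"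
  unfolding decay_def by (rule weight_lebesgue_measurable)

lemma decay_pos: "0 < decay x"
  by (simp add: decay_def weight_pos)

lemma decay_le_1: "decay x \<le> 1"
proof -
  have "0 \<le> \<alpha> + real CARD('n) + 1" using \<alpha>_pos by simp
  then have "1 powr ((\<alpha> + real CARD('n) + 1) / 2) \<le> weight (\<alpha> + real CARD('n) + 1) x"
    unfolding weight_def by (intro powr_mono2) auto
  then show ?thesis
    unfolding decay_def weight_minus using weight_pos by (simp add: inverse_le_1_iff)
qed

text \<open>After cancelling \<open>\<alpha>\<close> the exponent is \<open>(n + 1) * p'\<close>,
  which exceeds \<open>n\<close>.\<close>

lemma weight_decay_finite: "(\<integral>\<^sup>+x. ennreal ((weight \<alpha> x * decay x) powr p') \<partial>lebesgue) < \<infinity>"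
proof -
  have "(weight \<alpha> x * decay x) powr p' = weight (- ((real CARD('n) + 1) * p')) x" for x :: "real ^ 'n"
    by (simp add: decay_def weight_mult weight_powr algebra_simps)
  moreover have "real CARD('n) < (real CARD('n) + 1) * p'"
  proof -
    have "real CARD('n) < (real CARD('n) + 1) * 1" by simp
    also have "\<dots> \<le> (real CARD('n) + 1) * p'"
      using p' by (intro mult_left_mono) auto
    finally show ?thesis .
  qed
  ultimately show ?thesis using nn_integral_weight_finite by simp
qed

lemma decay_block: "block_fun decay"
proof -
  obtain C where C: "\<And>F A. F \<in> borel_measurable lebesgue \<Longrightarrow> (\<And>x. 0 \<le> F x) \<Longrightarrow> 0 \<le> A \<Longrightarrow>
     (\<integral>\<^sup>+x. ennreal ((weight \<alpha> x * F x) powr p') \<partial>lebesgue) \<le> ennreal (A powr p') \<Longrightarrow> block_fun F"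
    using weighted_block by meson
  define I where "I = (\<integral>\<^sup>+x. ennreal ((weight \<alpha> x * decay x) powr p') \<partial>lebesgue)"
  have "I < \<infinity>" unfolding I_def by (rule weight_decay_finite)
  then have "I \<le> ennreal ((enn2real I powr (1 / p')) powr p')"
    using p' by (simp add: powr_powr less_top)
  then show ?thesis
    unfolding I_def by (intro C[of decay "enn2real I powr (1 / p')"]) (auto simp: decay_pos less_imp_le I_def)
qed

text \<open>Small cubes, \<open>J \<ge> 0\<close>, use \<open>decay \<le> 1\<close> and the volume,
  and \<open>r < 0\<close> keeps \<open>2 powr (n + J * r * p)\<close> below
  \<open>2 powr n\<close>. Large cubes use the global \<open>L_p\<close>-norm, where
  \<open>n + r * p > 0\<close> makes the factor at most 1. \<open>R\<close> is the sum of the two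
  constants.\<close>

lemma decay_morrey: "\<exists>S. morrey_bound decay S"
proof -
  define n where "n = real CARD('n)"
  define I where "I = (\<integral>\<^sup>+x. ennreal (decay x powr p) \<partial>lebesgue)"
  have "decay x powr p = weight (- ((\<alpha> + n + 1) * p)) x" for x :: "real ^ 'n"
    by (simp add: decay_def weight_powr n_def algebra_simps)
  moreover have "n < (\<alpha> + n + 1) * p"
  proof -
    have "n < (\<alpha> + n + 1) * 1" using \<alpha>_pos by simp
    also have "\<dots> \<le> (\<alpha> + n + 1) * p"
      using p \<alpha>_pos by (intro mult_left_mono) (auto simp: n_def)
    finally show ?thesis .
  qed
  ultimately have I: "I < \<infinity>" unfolding I_def n_def using nn_integral_weight_finite by simp
  define R where "R = 2 powr n + enn2real I"
  have R: "0 \<le> R" by (simp add: R_def)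
  have "morrey_bound decay (R powr (1 / p))"
    unfolding morrey_bound_def
  proof (intro conjI allI)
    fix i
    obtain J M where JM: "cube_index i = (J, M :: int ^ 'n)" by fastforce
    have "(n / p + r) * p = n + r * p" using p(1) by (simp add: distrib_right)
    then have sc: "scale i powr p = 2 powr (of_int J * (n + r * p))"
      by (simp add: scale_def JM powr_powr n_def mult.assoc)
    have "(R powr (1 / p) / scale i) powr p = R / 2 powr (of_int J * (n + r * p))"
      using p R \<kappa>_pos[of i] sc by (simp add: powr_divide powr_powr)
    moreover have "(\<integral>\<^sup>+x. ennreal (decay x powr p * indicator (cube i) x) \<partial>lebesgue) \<le> ennreal (R / 2 powr (of_int J * (n + r * p)))"
    proof (cases "0 \<le> J")
      case True
      have "(\<integral>\<^sup>+x. ennreal (decay x powr p * indicator (cube i) x) \<partial>lebesgue) \<le> (\<integral>\<^sup>+x. indicator (cube i) x \<partial>lebesgue)"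
      proof (rule nn_integral_mono)
        fix x :: "real ^ 'n"
        have "decay x powr p \<le> 1 powr p"
          using p decay_le_1 decay_pos[of x] by (intro powr_mono2) auto
        then show "ennreal (decay x powr p * indicator (cube i) x) \<le> indicator (cube i) x"
          by (auto simp: indicator_def)
      qed
      also have "\<dots> = emeasure lebesgue (cube i)" by (rule nn_integral_indicator) simp
      also have "\<dots> = ennreal (2 powr ((1 - of_int J) * n))"
        by (simp add: cube_def JM emeasure_dyadic_cube n_def del: emeasure_completion)
      also have "\<dots> \<le> ennreal (R / 2 powr (of_int J * (n + r * p)))"
      proof (rule ennreal_leI)
        have "2 powr ((1 - of_int J) * n) * 2 powr (of_int J * (n + r * p)) = 2 powr (n + of_int J * r * p)"
          by (simp add: algebra_simps flip: powr_add)
        also have "\<dots> \<le> 2 powr n"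
          using True r p by (intro powr_mono) (auto simp: mult_nonneg_nonpos mult_nonpos_nonneg)
        also have "\<dots> \<le> R" by (simp add: R_def)
        finally show "2 powr ((1 - of_int J) * n) \<le> R / 2 powr (of_int J * (n + r * p))"
          by (simp add: le_divide_eq)
      qed
      finally show ?thesis .
    next
      case False
      have "(\<integral>\<^sup>+x. ennreal (decay x powr p * indicator (cube i) x) \<partial>lebesgue) \<le> I"
        unfolding I_def by (intro nn_integral_mono ennreal_leI) (auto simp: indicator_def)
      also have "I = ennreal (enn2real I)" using I by (simp add: less_top)
      also have "\<dots> \<le> ennreal (R / 2 powr (of_int J * (n + r * p)))"
      proof (rule ennreal_leI)
        have "- n < r * p" using r(1) p by (simp add: n_def field_simps)
        then have "of_int J * (n + r * p) \<le> 0" using False by (intro mult_nonpos_nonneg) auto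
        then have "2 powr (of_int J * (n + r * p)) \<le> 2 powr 0" by (intro powr_mono) auto
        then have "enn2real I * 2 powr (of_int J * (n + r * p)) \<le> enn2real I"
          using mult_left_mono[of _ 1 "enn2real I"] by fastforce
        then show "enn2real I \<le> R / 2 powr (of_int J * (n + r * p))"
          by (simp add: le_divide_eq R_def) (smt (verit) powr_ge_zero)
      qed
      finally show ?thesis .
    qed
    ultimately show "(\<integral>\<^sup>+x. ennreal (decay x powr p * indicator (cube i) x) \<partial>lebesgue)
        \<le> ennreal ((R powr (1 / p) / scale i) powr p)" by simp
  qed simp
  then show ?thesis ..
qed

sublocale block_seq_system lebesgue cube scale p p' q q' decay
  by unfold_locales
    (use q cube_UN emeasure_cube_finite decay_pos decay_block decay_morrey in auto)

section \<open>Morrey and weighted spaces as integral bounds\<close>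

lemma morrey_terms_eq: "morrey_terms p r f = range (\<lambda>i. scale i * Lp_norm_on (cube i) p f)"
proof -
  have sur: "range (cube_index :: nat \<Rightarrow> int \<times> (int ^ 'n)) = UNIV"
    by (rule bij_is_surj[OF bij_cube_index])
  have "range (\<lambda>(J, M). 2 powr (of_int J * (real CARD('n) / p + r)) * Lp_norm_on (dyadic_cube J M) p f)
      = (\<lambda>(J, M). 2 powr (of_int J * (real CARD('n) / p + r)) * Lp_norm_on (dyadic_cube J M) p f) ` range cube_index"
    by (simp only: sur)
  also have "\<dots> = range (\<lambda>i. scale i * Lp_norm_on (cube i) p f)"
    by (auto simp: image_image scale_def cube_def split: prod.split intro!: image_cong)
  finally show ?thesis by (simp add: morrey_terms_def)
qed

lemma morrey_imp_bound:
  fixes f :: "real ^ 'n \<Rightarrow> complex"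
  assumes "f \<in> morrey p r"
  shows "f \<in> borel_measurable lebesgue" "morrey_bound (\<lambda>x. cmod (f x)) (morrey_norm p r f)"
proof -
  show f: "f \<in> borel_measurable lebesgue" using assms by (simp add: morrey_def Lp_loc_def)
  have p0: "0 < p" using p by simp
  have bdd: "bdd_above (range (\<lambda>i. scale i * Lp_norm_on (cube i) p f))"
    using assms by (simp add: morrey_def morrey_terms_eq)
  have le: "scale i * Lp_norm_on (cube i) p f \<le> morrey_norm p r f" for i
    unfolding morrey_norm_def morrey_terms_eq by (rule cSUP_upper[OF _ bdd]) simp
  show "morrey_bound (\<lambda>x. cmod (f x)) (morrey_norm p r f)"
    unfolding morrey_bound_def
  proof (intro conjI allI)
    have "0 \<le> scale 0 * Lp_norm_on (cube 0) p f"
      using \<kappa>_pos[of 0] Lp_on_iff(3)[OF Q_sets f p0] by (simp add: less_imp_le)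
    then show S: "0 \<le> morrey_norm p r f" using le[of 0] by linarith
    fix i
    have "compact (cube i)" by (auto simp: cube_def dyadic_cube_eq_cbox split: prod.split)
    then have L: "f \<in> Lp_on (cube i) p" using assms by (simp add: morrey_def Lp_loc_def)
    have "Lp_norm_on (cube i) p f \<le> morrey_norm p r f / scale i"
      using le[of i] \<kappa>_pos[of i] by (simp add: le_divide_eq mult.commute)
    then have "Lp_norm_on (cube i) p f powr p \<le> (morrey_norm p r f / scale i) powr p"
      using p Lp_on_iff(3)[OF Q_sets f p0] by (intro powr_mono2) auto
    then show "(\<integral>\<^sup>+x. ennreal (cmod (f x) powr p * indicator (cube i) x) \<partial>lebesgue)
        \<le> ennreal ((morrey_norm p r f / scale i) powr p)"
      unfolding Lp_on_iff(2)[OF Q_sets f p0 L] by (rule ennreal_leI)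
  qed
qed

lemma bound_imp_morrey:
  fixes f :: "real ^ 'n \<Rightarrow> complex"
  assumes f: "f \<in> borel_measurable lebesgue" and S: "morrey_bound (\<lambda>x. cmod (f x)) S"
  shows "f \<in> morrey p r" "morrey_norm p r f \<le> S"
proof -
  have p0: "0 < p" using p by simp
  have S0: "0 \<le> S" using S by (simp add: morrey_bound_def)
  have L: "f \<in> Lp_on (cube i) p" "Lp_norm_on (cube i) p f \<le> S / scale i" for i
    by (rule Lp_norm_on_le[OF Q_sets f p0, of "S / scale i" i];
        use S S0 \<kappa>_pos[of i] in \<open>simp add: morrey_bound_def\<close>)+
  have le: "scale i * Lp_norm_on (cube i) p f \<le> S" for i
    using L(2)[of i] \<kappa>_pos[of i] by (simp add: le_divide_eq mult.commute)
  have "f \<in> Lp_on K p" if K: "compact K" for K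
  proof -
    have Ks: "K \<in> sets lebesgue" using K by (simp add: compact_imp_closed)
    \<comment> \<open>A compact set lies in some central cube, on which the bound gives
      integrability of the \<open>p\<close>-th power.\<close>
    obtain k where k: "K \<subseteq> dyadic_cube (- int k) 0"
      using bounded_subset_central_cube[OF compact_imp_bounded[OF K]] by blast
    obtain i where i: "cube_index i = (- int k, 0 :: int ^ 'n)" using cube_index_surj by blast
    have "K \<subseteq> cube i" using k by (simp add: cube_def i)
    then have "(\<integral>\<^sup>+x. ennreal (cmod (f x) powr p * indicator K x) \<partial>lebesgue)
        \<le> (\<integral>\<^sup>+x. ennreal (cmod (f x) powr p * indicator (cube i) x) \<partial>lebesgue)"
      by (intro nn_integral_mono ennreal_leI mult_left_mono) (auto simp: indicator_def)
    also have "\<dots> < \<infinity>" using L(1)[of i] Lp_on_iff(1)[OF Q_sets f p0] by blast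
    finally show ?thesis by (subst Lp_on_iff(1)[OF Ks f p0])
  qed
  then show "f \<in> morrey p r"
    using f le by (auto simp: morrey_def Lp_loc_def morrey_terms_eq intro!: bdd_aboveI)
  show "morrey_norm p r f \<le> S"
    unfolding morrey_norm_def morrey_terms_eq by (rule cSUP_least) (use le in auto)
qed

lemma weighted_imp_bound:
  fixes f :: "real ^ 'n \<Rightarrow> complex"
  assumes "f \<in> weighted_Lp p' \<alpha>"
  shows "f \<in> borel_measurable lebesgue" "0 \<le> weighted_Lp_norm p' \<alpha> f"
    "(\<integral>\<^sup>+x. ennreal ((weight \<alpha> x * cmod (f x)) powr p') \<partial>lebesgue) \<le> ennreal (weighted_Lp_norm p' \<alpha> f powr p')"
proof -
  have p'0: "0 < p'" using p' by simp
  define g where "g x = of_real (weight \<alpha> x) * f x" for x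
  have g: "g \<in> Lp_on UNIV p'" using assms by (simp add: weighted_Lp_def g_def[abs_def])
  then have gm: "g \<in> borel_measurable lebesgue" by (simp add: Lp_on_def lebesgue_on_UNIV_eq)
  have "f = (\<lambda>x. g x / of_real (weight \<alpha> x))"
  proof
    show "f x = g x / of_real (weight \<alpha> x)" for x
      using weight_pos[of \<alpha> x] by (simp add: g_def)
  qed
  moreover have "(\<lambda>x. g x / of_real (weight \<alpha> x)) \<in> borel_measurable lebesgue"
    using weight_lebesgue_measurable[of \<alpha>] gm by measurable
  ultimately show "f \<in> borel_measurable lebesgue" by simp
  have norm: "cmod (g x) = weight \<alpha> x * cmod (f x)" for x
    using weight_pos[of \<alpha> x] by (simp add: g_def norm_mult)
  show "0 \<le> weighted_Lp_norm p' \<alpha> f" by (simp add: weighted_Lp_norm_def Lp_norm_on_def)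
  show "(\<integral>\<^sup>+x. ennreal ((weight \<alpha> x * cmod (f x)) powr p') \<partial>lebesgue) \<le> ennreal (weighted_Lp_norm p' \<alpha> f powr p')"
  proof -
    have "weighted_Lp_norm p' \<alpha> f = Lp_norm_on UNIV p' g"
      by (simp add: weighted_Lp_norm_def g_def[abs_def])
    then show ?thesis using Lp_on_iff(2)[OF _ gm p'0 g] unfolding norm by simp
  qed
qed

lemma bound_imp_weighted:
  fixes f :: "real ^ 'n \<Rightarrow> complex"
  assumes f: "f \<in> borel_measurable lebesgue"
    and le: "(\<integral>\<^sup>+x. ennreal ((weight \<alpha> x * cmod (f x)) powr p') \<partial>lebesgue) < \<infinity>"
  shows "f \<in> weighted_Lp p' \<alpha>"
proof -
  have p'0: "0 < p'" using p' by simp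
  define g where "g x = of_real (weight \<alpha> x) * f x" for x
  have gm: "g \<in> borel_measurable lebesgue"
    unfolding g_def using weight_lebesgue_measurable[of \<alpha>] f by measurable
  have norm: "cmod (g x) = weight \<alpha> x * cmod (f x)" for x
    using weight_pos[of \<alpha> x] by (simp add: g_def norm_mult)
  have "g \<in> Lp_on UNIV p'" by (subst Lp_on_iff(1)[OF _ gm p'0]) (use le in \<open>auto simp: norm\<close>)
  then show ?thesis by (simp add: weighted_Lp_def g_def[abs_def])
qed


section \<open>Distributions, atomic series and majorants\<close>

definition schwartz_order :: nat where
  "schwartz_order = nat \<lceil>\<alpha> + real CARD('n) + 1\<rceil>"

text \<open>\<open>schwartz_order\<close> is at least the decay exponent \<open>\<beta>\<close>, and
  \<open>weight \<beta> x \<le> (1 + norm x) powr \<beta>\<close>. Hence \<open>decay\<close> stands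
  in for Schwartz functions in the estimates.\<close>

lemma schwartz_le_decay:
  fixes \<phi> :: "real ^ 'n \<Rightarrow> complex"
  assumes \<phi>: "\<phi> \<in> schwartz"
  shows "cmod (\<phi> x) \<le> schwartz_norm schwartz_order \<phi> * decay x"
proof -
  define N \<beta> where "N = schwartz_order" and "\<beta> = \<alpha> + real CARD('n) + 1"
  have \<beta>: "0 < \<beta>" "\<beta> \<le> real N"
    using \<alpha>_pos by (auto simp: \<beta>_def N_def schwartz_order_def)
  have "weight \<beta> x \<le> ((1 + norm x)\<^sup>2) powr (\<beta> / 2)"
    unfolding weight_def using \<beta> by (intro powr_mono2) (auto simp: power2_eq_square algebra_simps)
  also have "\<dots> = (1 + norm x) powr \<beta>"
    by (simp add: powr_powr flip: powr_numeral)
  also have "\<dots> \<le> (1 + norm x) powr real N" using \<beta> by (intro powr_mono) auto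
  also have "\<dots> = (1 + norm x) ^ N" by (intro powr_realpow) (auto intro: add_pos_nonneg)
  finally have le: "weight \<beta> x * cmod (\<phi> x) \<le> schwartz_norm N \<phi>"
    using schwartz_le_norm[OF \<phi>, of x N] mult_right_mono[of "weight \<beta> x" "(1 + norm x) ^ N" "cmod (\<phi> x)"]
    by simp
  have decay: "decay x = inverse (weight \<beta> x)" by (simp add: decay_def \<beta>_def weight_minus[symmetric])
  have "cmod (\<phi> x) = inverse (weight \<beta> x) * (weight \<beta> x * cmod (\<phi> x))"
    using weight_pos[of \<beta> x] by simp
  also have "\<dots> \<le> inverse (weight \<beta> x) * schwartz_norm N \<phi>"
    using le weight_pos[of \<beta> x] by (intro mult_left_mono) auto
  finally show ?thesis by (simp add: decay N_def mult.commute)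
qed

text \<open>Used in both directions between atomic series and majorants: when the terms
  \<open>c i\<close> are dominated by blocks, pairing the blocks with \<open>decay\<close> gives a
  convergent majorant series, hence termwise integration. Absolute convergence provides the
  unordered sum that \<open>atomic_rep\<close> demands.\<close>

lemma block_majorant_sums_integral:
  fixes c :: "nat \<Rightarrow> real ^ 'n \<Rightarrow> complex"
  assumes b: "block_majorant F t b" and \<phi>[measurable]: "\<phi> \<in> borel_measurable lebesgue"
    and K: "\<And>x. cmod (\<phi> x) \<le> K * decay x"
    and c[measurable]: "\<And>i. c i \<in> borel_measurable lebesgue"
    and cb: "\<And>i. AE x in lebesgue. cmod (c i x) \<le> b i x"
  shows "AE x in lebesgue. summable (\<lambda>i. cmod (c i x)) \<and> (\<forall>i. cmod (c i x) \<le> b i x)"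
    and "integrable lebesgue (\<lambda>x. (\<Sum>i. c i x) * \<phi> x)"
    and "((\<lambda>i. \<integral>x. c i x * \<phi> x \<partial>lebesgue) has_sum (\<integral>x. (\<Sum>i. c i x) * \<phi> x \<partial>lebesgue)) UNIV"
proof -
  note D = block_majorantD[OF b]
  note [measurable] = D(3)
  obtain S where S: "morrey_bound decay S" using decay_morrey by blast
  have cb': "AE x in lebesgue. \<forall>i. cmod (c i x) \<le> b i x" unfolding AE_all_countable by (intro allI cb)
  show AE: "AE x in lebesgue. summable (\<lambda>i. cmod (c i x)) \<and> (\<forall>i. cmod (c i x) \<le> b i x)"
    using cb' block_majorant_AE_summable[OF b S decay_measurable decay_pos]
  proof eventually_elim
    case (elim x)
    then show ?case by (auto intro: summable_comparison_test'[of "\<lambda>i. b i x" 0])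
  qed
  have nnd: "0 \<le> decay x" for x :: "real ^ 'n" using decay_pos[of x] by simp
  have K0: "0 \<le> K"
  proof -
    have "0 \<le> K * decay 0" using K[of 0] norm_ge_zero order_trans by blast
    then show ?thesis using decay_pos[of 0] by (simp add: zero_le_mult_iff)
  qed
  define J where "J i = (\<integral>\<^sup>+x. ennreal (b i x * decay x) \<partial>lebesgue)" for i
  have "(\<Sum>i. J i) = (\<integral>\<^sup>+x. (\<Sum>i. ennreal (b i x * decay x)) \<partial>lebesgue)"
    unfolding J_def by (rule nn_integral_suminf[symmetric]) measurable
  also have "\<dots> = (\<integral>\<^sup>+x. (\<Sum>i. ennreal (b i x)) * ennreal (decay x) \<partial>lebesgue)"
    using D(4) nnd by (simp add: ennreal_mult)
  also have "\<dots> \<le> ennreal (S * suminf t)"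
    by (rule block_majorant_pairing_sum[OF b S decay_measurable nnd])
  finally have Jsum: "(\<Sum>i. J i) \<le> ennreal (S * suminf t)" .
  have Jfin: "J i < \<infinity>" for i
    using le_less_trans[OF order_trans[OF ennreal_le_suminf[of J i] Jsum] ennreal_less_top] by simp
  have Jint: "integrable lebesgue (\<lambda>x. b i x * decay x)" for i
    using Jfin[of i] D(4) nnd unfolding J_def by (intro integrableI_nonneg) auto
  define j where "j i = (\<integral>x. b i x * decay x \<partial>lebesgue)" for i
  have Jj: "J i = ennreal (j i)" for i
    unfolding J_def j_def by (rule nn_integral_eq_integral[OF Jint]) (use D(4) nnd in auto)
  have jnn: "0 \<le> j i" for i
    unfolding j_def by (rule integral_nonneg_AE) (use D(4) nnd in auto)
  have jsum: "summable j"
    by (rule summable_suminf_not_top[OF jnn]) (use Jsum in \<open>auto simp: Jj[symmetric] top_unique\<close>)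
  have le: "AE x in lebesgue. norm (c i x * \<phi> x) \<le> K * (b i x * decay x)" for i
    using cb[of i]
  proof eventually_elim
    case (elim x)
    have "cmod (c i x) * cmod (\<phi> x) \<le> b i x * (K * decay x)"
      by (rule mult_mono) (use elim K D(4) in auto)
    then show ?case by (simp add: norm_mult mult_ac)
  qed
  have int: "integrable lebesgue (\<lambda>x. c i x * \<phi> x)" for i
  proof (rule Bochner_Integration.integrable_bound)
    show "integrable lebesgue (\<lambda>x. K * (b i x * decay x))" using Jint by (rule integrable_mult_right)
    show "AE x in lebesgue. norm (c i x * \<phi> x) \<le> norm (K * (b i x * decay x))"
      using le[of i] by eventually_elim simp
  qed measurable
  have intle: "(\<integral>x. norm (c i x * \<phi> x) \<partial>lebesgue) \<le> K * j i" for i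
  proof -
    have "(\<integral>x. norm (c i x * \<phi> x) \<partial>lebesgue) \<le> (\<integral>x. K * (b i x * decay x) \<partial>lebesgue)"
      by (rule integral_mono_AE) (use int Jint le in auto)
    then show ?thesis by (simp add: j_def)
  qed
  have s1: "AE x in lebesgue. summable (\<lambda>i. norm (c i x * \<phi> x))"
    using AE by eventually_elim (auto simp: norm_mult intro: summable_mult2)
  have s2: "summable (\<lambda>i. \<integral>x. norm (c i x * \<phi> x) \<partial>lebesgue)"
    by (rule summable_comparison_test'[OF summable_mult[OF jsum, of K], of 0])
      (use intle in \<open>auto simp: abs_of_nonneg integral_nonneg_AE\<close>)
  have eq: "AE x in lebesgue. (\<Sum>i. c i x * \<phi> x) = (\<Sum>i. c i x) * \<phi> x"
    using AE by eventually_elim (auto intro: suminf_mult2[symmetric] summable_norm_cancel)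
  have m: "(\<lambda>x. (\<Sum>i. c i x) * \<phi> x) \<in> borel_measurable lebesgue" by measurable
  show "integrable lebesgue (\<lambda>x. (\<Sum>i. c i x) * \<phi> x)"
    by (rule integrable_cong_AE_imp[OF integrable_suminf[OF int s1 s2] m eq])
  have "(\<lambda>i. \<integral>x. c i x * \<phi> x \<partial>lebesgue) sums (\<integral>x. (\<Sum>i. c i x * \<phi> x) \<partial>lebesgue)"
    by (rule sums_integral[OF int s1 s2])
  also have "(\<integral>x. (\<Sum>i. c i x * \<phi> x) \<partial>lebesgue) = (\<integral>x. (\<Sum>i. c i x) * \<phi> x \<partial>lebesgue)"
    by (rule integral_cong_AE) (use m eq in auto)
  finally have sums: "(\<lambda>i. \<integral>x. c i x * \<phi> x \<partial>lebesgue) sums (\<integral>x. (\<Sum>i. c i x) * \<phi> x \<partial>lebesgue)" .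
  have "summable (\<lambda>i. norm (\<integral>x. c i x * \<phi> x \<partial>lebesgue))"
    by (rule summable_comparison_test'[OF s2, of 0]) (simp add: integral_norm_bound)
  then show "((\<lambda>i. \<integral>x. c i x * \<phi> x \<partial>lebesgue) has_sum (\<integral>x. (\<Sum>i. c i x) * \<phi> x \<partial>lebesgue)) UNIV"
    using sums by (rule norm_summable_imp_has_sum)
qed

lemma atom_exponent: "2 powr (- of_int J * (real CARD('n) / p' + \<rho>)) = 2 powr (of_int J * (real CARD('n) / p + r))"
proof -
  have "real CARD('n) / p + real CARD('n) / p' = real CARD('n) * (1 / p + 1 / p')"
    by (simp add: distrib_left)
  then have eq: "real CARD('n) / p' + \<rho> = - (real CARD('n) / p + r)"
    using p(2) \<rho> by simp
  show ?thesis unfolding eq by (simp only: minus_mult_minus)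
qed

lemma atomic_rep_iff:
  "atomic_rep p' \<rho> T lam a \<longleftrightarrow>
     (\<forall>i. a (cube_index i) \<in> Lp_on UNIV p' \<and> ess_supp (a (cube_index i)) \<subseteq> cube i \<and>
          Lp_norm_on UNIV p' (a (cube_index i)) \<le> scale i) \<and>
     (\<lambda>k. cmod (lam k)) summable_on UNIV \<and>
     (\<forall>\<phi>\<in>schwartz. ((\<lambda>k. lam k * regular_dist (a k) \<phi>) has_sum T \<phi>) UNIV)"
proof -
  have all: "(\<forall>J M. P (J, M)) \<longleftrightarrow> (\<forall>i. P (cube_index i))" for P :: "int \<times> (int ^ 'n) \<Rightarrow> bool"
    using cube_index_surj by (metis surj_pair)
  have "(\<forall>J M. a (J, M) \<in> Lp_on UNIV p' \<and> ess_supp (a (J, M)) \<subseteq> dyadic_cube J M \<and>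
            Lp_norm_on UNIV p' (a (J, M)) \<le> 2 powr (- of_int J * (real CARD('n) / p' + \<rho>)))
    \<longleftrightarrow> (\<forall>i. a (cube_index i) \<in> Lp_on UNIV p' \<and> ess_supp (a (cube_index i)) \<subseteq> cube i \<and>
          Lp_norm_on UNIV p' (a (cube_index i)) \<le> scale i)"
    using all[of "\<lambda>(J, M). a (J, M) \<in> Lp_on UNIV p' \<and> ess_supp (a (J, M)) \<subseteq> dyadic_cube J M \<and>
            Lp_norm_on UNIV p' (a (J, M)) \<le> 2 powr (- of_int J * (real CARD('n) / p' + \<rho>))"]
    unfolding atom_exponent by (simp add: cube_def scale_def split_beta)
  then show ?thesis unfolding atomic_rep_def by simp
qed

text \<open>The atomic series converges absolutely almost everywhere to some \<open>F\<close>;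
  \<open>F\<close> and \<open>f\<close> have the same integrals against Schwartz functions and
  therefore coincide. Then \<open>cmod (f x)\<close> is dominated by the sum of the moduli of the
  terms.\<close>

lemma atomic_rep_imp_majorant:
  fixes f :: "real ^ 'n \<Rightarrow> complex"
  assumes f: "f \<in> borel_measurable lebesgue"
    and int: "\<And>\<phi>. \<phi> \<in> schwartz \<Longrightarrow> integrable lebesgue (\<lambda>x. f x * \<phi> x)"
    and rep: "atomic_rep p' \<rho> (regular_dist f) lam a"
  shows "\<exists>b. block_majorant (\<lambda>x. cmod (f x)) (\<lambda>i. cmod (lam (cube_index i))) b"
proof -
  have p'0: "0 < p'" using p' by simp
  define c where "c i x = lam (cube_index i) * a (cube_index i) x" for i x
  define t where "t i = cmod (lam (cube_index i))" for i
  \<comment> \<open>The indicator is inserted because an atom vanishes outside its cube only almost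
    everywhere, while a block has to vanish there at every point.\<close>
  define b where "b i x = cmod (c i x) * indicator (cube i) x" for i x
  note R = rep[unfolded atomic_rep_iff]
  have a_meas: "a (cube_index i) \<in> borel_measurable lebesgue" for i
    using R by (auto simp: Lp_on_def lebesgue_on_UNIV_eq)
  note [measurable] = a_meas f
  have c_meas[measurable]: "c i \<in> borel_measurable lebesgue" for i unfolding c_def by measurable
  have b_meas: "b i \<in> borel_measurable lebesgue" for i unfolding b_def by measurable
  have t_sum: "summable t"
    unfolding t_def using R summable_on_reindex_bij_betw[OF bij_cube_index, of "\<lambda>k. cmod (lam k)"]
    by (intro summable_on_imp_summable) simp
  have norm: "(\<integral>\<^sup>+x. ennreal (b i x powr p') \<partial>lebesgue) \<le> ennreal ((scale i * t i) powr p')" for i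
  proof -
    have L: "a (cube_index i) \<in> Lp_on UNIV p'" "Lp_norm_on UNIV p' (a (cube_index i)) \<le> scale i" using R by auto
    have "(\<integral>\<^sup>+x. ennreal (b i x powr p') \<partial>lebesgue)
        \<le> (\<integral>\<^sup>+x. ennreal (t i powr p') * ennreal (cmod (a (cube_index i) x) powr p') \<partial>lebesgue)"
      by (intro nn_integral_mono)
        (auto simp: b_def c_def t_def indicator_def norm_mult powr_mult simp flip: ennreal_mult)
    also have "\<dots> = ennreal (t i powr p') * (\<integral>\<^sup>+x. ennreal (cmod (a (cube_index i) x) powr p') \<partial>lebesgue)"
      by (rule nn_integral_cmult) measurable
    also have "(\<integral>\<^sup>+x. ennreal (cmod (a (cube_index i) x) powr p') \<partial>lebesgue) = ennreal (Lp_norm_on UNIV p' (a (cube_index i)) powr p')"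
      using Lp_on_iff(2)[OF _ a_meas p'0 L(1)] by simp
    also have "ennreal (t i powr p') * \<dots> \<le> ennreal (t i powr p') * ennreal (scale i powr p')"
      using L(2) p' Lp_on_iff(3)[OF _ a_meas p'0, of UNIV i]
      by (intro mult_left_mono ennreal_leI powr_mono2) auto
    also have "\<dots> = ennreal ((scale i * t i) powr p')"
      using \<kappa>_pos[of i] by (simp add: t_def powr_mult mult.commute flip: ennreal_mult)
    finally show ?thesis .
  qed
  \<comment> \<open>That the blocks majorise \<open>f\<close> is the goal; as a majorant of 0 they
    can already be used for convergence.\<close>
  have b0: "block_majorant (\<lambda>x. 0) t b"
    unfolding block_majorant_def using t_sum b_meas norm
    by (auto simp: t_def b_def)
  have cb: "AE x in lebesgue. cmod (c i x) \<le> b i x" for i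
    using AE_outside_ess_supp[of "a (cube_index i)"]
  proof eventually_elim
    case (elim x)
    have "ess_supp (a (cube_index i)) \<subseteq> cube i" using R by blast
    then show ?case using elim by (auto simp: b_def c_def indicator_def)
  qed
  define F where "F x = (\<Sum>i. c i x)" for x
  have F_meas[measurable]: "F \<in> borel_measurable lebesgue" unfolding F_def by measurable
  \<comment> \<open>Here the statement about almost every point is wanted, so the test function is
    simply 0.\<close>
  have AE: "AE x in lebesgue. summable (\<lambda>i. cmod (c i x)) \<and> (\<forall>i. cmod (c i x) \<le> b i x)"
    using block_majorant_sums_integral(1)[OF b0 _ _ c_meas cb, of "\<lambda>x. 0" 0] by simp
  have intF: "integrable lebesgue (\<lambda>x. F x * \<phi> x)" and eqF: "(\<integral>x. F x * \<phi> x \<partial>lebesgue) = (\<integral>x. f x * \<phi> x \<partial>lebesgue)"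
    if \<phi>: "\<phi> \<in> schwartz" for \<phi>
  proof -
    note B = block_majorant_sums_integral(2,3)[OF b0 schwartz_measurable[OF \<phi>] schwartz_le_decay[OF \<phi>] c_meas cb]
    show "integrable lebesgue (\<lambda>x. F x * \<phi> x)" unfolding F_def by (rule B(1))
    have "((\<lambda>k. lam k * regular_dist (a k) \<phi>) has_sum regular_dist f \<phi>) UNIV" using R \<phi> by blast
    then have "((\<lambda>i. lam (cube_index i) * regular_dist (a (cube_index i)) \<phi>) has_sum regular_dist f \<phi>) UNIV"
      by (subst has_sum_reindex_bij_betw[OF bij_cube_index])
    moreover have "lam (cube_index i) * regular_dist (a (cube_index i)) \<phi> = (\<integral>x. c i x * \<phi> x \<partial>lebesgue)" for i
      by (simp add: regular_dist_def c_def mult.assoc)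
    ultimately have "((\<lambda>i. \<integral>x. c i x * \<phi> x \<partial>lebesgue) has_sum regular_dist f \<phi>) UNIV" by simp
    then show "(\<integral>x. F x * \<phi> x \<partial>lebesgue) = (\<integral>x. f x * \<phi> x \<partial>lebesgue)"
      using B(2) has_sum_unique unfolding F_def regular_dist_def by blast
  qed
  have "AE x in lebesgue. f x - F x = 0"
  proof (rule AE_eq_0_of_schwartz)
    show "(\<lambda>x. f x - F x) \<in> borel_measurable lebesgue" by measurable
    fix \<phi> :: "real ^ 'n \<Rightarrow> complex" assume \<phi>: "\<phi> \<in> schwartz"
    show "integrable lebesgue (\<lambda>x. (f x - F x) * \<phi> x)"
      unfolding left_diff_distrib using int[OF \<phi>] intF[OF \<phi>] by (rule Bochner_Integration.integrable_diff)
    show "(\<integral>x. (f x - F x) * \<phi> x \<partial>lebesgue) = 0"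
      unfolding left_diff_distrib using int[OF \<phi>] intF[OF \<phi>] eqF[OF \<phi>] by simp
  qed
  then have "AE x in lebesgue. ennreal (cmod (f x)) \<le> (\<Sum>i. ennreal (b i x))"
    using AE
  proof eventually_elim
    case (elim x)
    have "cmod (f x) \<le> (\<Sum>i. cmod (c i x))" using elim summable_norm[of "\<lambda>i. c i x"] by (simp add: F_def)
    then have "ennreal (cmod (f x)) \<le> ennreal (\<Sum>i. cmod (c i x))" by (rule ennreal_leI)
    also have "\<dots> = (\<Sum>i. ennreal (cmod (c i x)))" using elim by (intro suminf_ennreal2[symmetric]) auto
    also have "\<dots> \<le> (\<Sum>i. ennreal (b i x))" using elim by (intro suminf_le ennreal_leI) auto
    finally show ?case .
  qed
  then have "block_majorant (\<lambda>x. cmod (f x)) t b" using b0 by (simp add: block_majorant_def)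
  then show ?thesis unfolding t_def by blast
qed

text \<open>Distributing \<open>f\<close> over the blocks in the proportion \<open>b i / B\<close>
  gives pieces below the blocks that sum to \<open>f\<close>. The coefficients come out as exactly
  \<open>t\<close>, so passing to an atomic series costs nothing in the norm.\<close>

lemma majorant_imp_atomic_rep:
  fixes f :: "real ^ 'n \<Rightarrow> complex"
  assumes f: "f \<in> borel_measurable lebesgue" and b: "block_majorant (\<lambda>x. cmod (f x)) t b"
  shows "\<And>\<phi>. \<phi> \<in> schwartz \<Longrightarrow> integrable lebesgue (\<lambda>x. f x * \<phi> x)"
    and "\<exists>a lam. atomic_rep p' \<rho> (regular_dist f) lam a \<and> (\<forall>i. cmod (lam (cube_index i)) = t i)"
proof -
  have p'0: "0 < p'" using p' by simp
  note D = block_majorantD[OF b]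
  note [measurable] = D(3) f
  obtain S where S: "morrey_bound decay S" using decay_morrey by blast
  define B where "B x = (\<Sum>i. b i x)" for x
  \<comment> \<open>Where \<open>B x = 0\<close> the quotient is 0 by convention, and almost
    everywhere there \<open>f x = 0\<close> as well.\<close>
  define c where "c i x = f x * of_real (b i x / B x)" for i x
  have c_meas: "c i \<in> borel_measurable lebesgue" for i unfolding c_def B_def by measurable
  have AE: "AE x in lebesgue. (\<forall>i. cmod (c i x) \<le> b i x) \<and> (\<lambda>i. c i x) sums f x"
    using block_majorant_AE_summable[OF b S decay_measurable decay_pos] D(7)
  proof eventually_elim
    case (elim x)
    have nn: "0 \<le> b i x" for i by (rule D(4))
    have B: "(\<lambda>i. b i x) sums B x" unfolding B_def using elim by auto
    have B0: "0 \<le> B x" using nn elim unfolding B_def by (intro suminf_nonneg) auto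
    have "ennreal (cmod (f x)) \<le> ennreal (B x)"
      using elim nn unfolding B_def by (simp add: suminf_ennreal2)
    then have fB: "cmod (f x) \<le> B x" using B0 by simp
    have "cmod (c i x) \<le> b i x" for i
    proof -
      have "cmod (c i x) = cmod (f x) * b i x / B x"
        using nn B0 by (simp add: c_def norm_mult norm_divide)
      also have "\<dots> \<le> b i x"
      proof (cases "B x = 0")
        case False
        then show ?thesis using fB B0 nn[of i] mult_right_mono[OF fB nn[of i]]
          by (simp add: divide_le_eq mult.commute)
      qed (use nn in simp)
      finally show ?thesis .
    qed
    moreover have "(\<lambda>i. c i x) sums f x"
    proof (cases "B x = 0")
      case True
      then show ?thesis using fB by (simp add: c_def)
    next
      case False
      have "(\<lambda>i. f x * of_real (b i x / B x)) sums (f x * of_real (B x / B x))"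
        by (intro sums_mult sums_of_real sums_divide B)
      then show ?thesis using False by (simp add: c_def)
    qed
    ultimately show ?case by blast
  qed
  have cb: "AE x in lebesgue. cmod (c i x) \<le> b i x" for i using AE by eventually_elim blast
  have eq: "AE x in lebesgue. (\<Sum>i. c i x) = f x" using AE by eventually_elim (auto simp: sums_iff)
  have sum: "integrable lebesgue (\<lambda>x. f x * \<phi> x)"
    "((\<lambda>i. \<integral>x. c i x * \<phi> x \<partial>lebesgue) has_sum regular_dist f \<phi>) UNIV" if \<phi>: "\<phi> \<in> schwartz" for \<phi>
  proof -
    have [measurable]: "\<phi> \<in> borel_measurable lebesgue" by (rule schwartz_measurable[OF \<phi>])
    note Bl = block_majorant_sums_integral(2,3)[OF b schwartz_measurable[OF \<phi>] schwartz_le_decay[OF \<phi>] c_meas cb]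
    have eq': "AE x in lebesgue. (\<Sum>i. c i x) * \<phi> x = f x * \<phi> x" using eq by eventually_elim simp
    have m: "(\<lambda>x. f x * \<phi> x) \<in> borel_measurable lebesgue" by measurable
    show "integrable lebesgue (\<lambda>x. f x * \<phi> x)" by (rule integrable_cong_AE_imp[OF Bl(1) m eq'])
    have "(\<integral>x. (\<Sum>i. c i x) * \<phi> x \<partial>lebesgue) = (\<integral>x. f x * \<phi> x \<partial>lebesgue)"
      by (rule integral_cong_AE) (use m eq' borel_measurable_integrable[OF Bl(1)] in auto)
    then show "((\<lambda>i. \<integral>x. c i x * \<phi> x \<partial>lebesgue) has_sum regular_dist f \<phi>) UNIV"
      using Bl(2) unfolding regular_dist_def by simp
  qed
  show "\<And>\<phi>. \<phi> \<in> schwartz \<Longrightarrow> integrable lebesgue (\<lambda>x. f x * \<phi> x)" by (rule sum(1))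
  define e where "e = inv (cube_index :: nat \<Rightarrow> int \<times> (int ^ 'n))"
  have e: "e (cube_index i) = i" for i
    unfolding e_def by (rule inv_f_f[OF bij_is_inj[OF bij_cube_index]])
  define lam where "lam k = complex_of_real (t (e k))" for k
  \<comment> \<open>For \<open>t (e k) = 0\<close> the atom is 0 by the convention for division;
    nothing is lost, as the corresponding block then vanishes almost everywhere.\<close>
  define a where "a k x = c (e k) x / of_real (t (e k))" for k x
  have a_meas: "a k \<in> borel_measurable lebesgue" for k unfolding a_def using c_meas by measurable
  have atom: "a (cube_index i) \<in> Lp_on UNIV p' \<and> Lp_norm_on UNIV p' (a (cube_index i)) \<le> scale i" for i
  proof -
    have "(\<integral>\<^sup>+x. ennreal (cmod (a (cube_index i) x) powr p' * indicator UNIV x) \<partial>lebesgue) \<le> ennreal (scale i powr p')"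
    proof (cases "t i = 0")
      case False
      then have t: "0 < t i" using D(1)[of i] by simp
      have "(\<integral>\<^sup>+x. ennreal (cmod (a (cube_index i) x) powr p' * indicator UNIV x) \<partial>lebesgue)
          \<le> (\<integral>\<^sup>+x. ennreal (1 / t i powr p') * ennreal (b i x powr p') \<partial>lebesgue)"
      proof (rule nn_integral_mono_AE, use cb[of i] in eventually_elim)
        fix x assume x: "cmod (c i x) \<le> b i x"
        have "cmod (a (cube_index i) x) powr p' = cmod (c i x) powr p' / t i powr p'"
          using t by (simp add: a_def e norm_divide powr_divide)
        also have "\<dots> \<le> b i x powr p' / t i powr p'"
          using x p' by (intro divide_right_mono powr_mono2) auto
        finally show "ennreal (cmod (a (cube_index i) x) powr p' * indicator UNIV x)
            \<le> ennreal (1 / t i powr p') * ennreal (b i x powr p')"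
          by (simp add: ennreal_leI flip: ennreal_mult)
      qed
      also have "\<dots> = ennreal (1 / t i powr p') * (\<integral>\<^sup>+x. ennreal (b i x powr p') \<partial>lebesgue)"
        by (rule nn_integral_cmult) measurable
      also have "\<dots> \<le> ennreal (1 / t i powr p') * ennreal ((scale i * t i) powr p')"
        by (intro mult_left_mono D(6)) simp
      also have "\<dots> = ennreal (scale i powr p')"
        using t \<kappa>_pos[of i] by (simp add: powr_mult flip: ennreal_mult)
      finally show ?thesis .
    qed (simp add: a_def e)
    then show ?thesis
      using Lp_norm_on_le[OF _ a_meas p'0 less_imp_le[OF \<kappa>_pos[of i]], of UNIV "cube_index i"] by auto
  qed
  have supp: "ess_supp (a (cube_index i)) \<subseteq> cube i" for i
  proof -
    have "closed (cube i)" by (auto simp: cube_def closed_dyadic_cube split: prod.split)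
    then have "- cube i \<in> {U. open U \<and> (AE x in lebesgue. x \<in> U \<longrightarrow> a (cube_index i) x = 0)}"
      using D(5) by (auto simp: a_def c_def e)
    then show ?thesis unfolding ess_supp_def by blast
  qed
  have lam_sum: "(\<lambda>k. cmod (lam k)) summable_on UNIV"
  proof -
    have "(\<lambda>i. cmod (lam (cube_index i))) = t" using D(1) by (auto simp: lam_def e)
    moreover have "t summable_on UNIV" using D(1,2) by (subst summable_on_UNIV_nonneg_real_iff) auto
    ultimately have "(\<lambda>i. cmod (lam (cube_index i))) summable_on UNIV" by simp
    then show ?thesis by (subst (asm) summable_on_reindex_bij_betw[OF bij_cube_index])
  qed
  have conv: "((\<lambda>k. lam k * regular_dist (a k) \<phi>) has_sum regular_dist f \<phi>) UNIV" if \<phi>: "\<phi> \<in> schwartz" for \<phi>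
  proof -
    have [measurable]: "\<phi> \<in> borel_measurable lebesgue" by (rule schwartz_measurable[OF \<phi>])
    have "lam (cube_index i) * regular_dist (a (cube_index i)) \<phi> = (\<integral>x. c i x * \<phi> x \<partial>lebesgue)" for i
    proof (cases "t i = 0")
      case True
      have "AE x in lebesgue. b i x = 0"
        by (rule nn_integral_powr_eq_0[of _ _ p']) (use D(6)[of i] True in auto)
      then have "AE x in lebesgue. c i x * \<phi> x = 0" by eventually_elim (simp add: c_def)
      then have "(\<integral>x. c i x * \<phi> x \<partial>lebesgue) = 0" by (rule integral_eq_zero_AE)
      then show ?thesis using True by (simp add: lam_def e)
    next
      case False
      then have eqc: "c i x * \<phi> x = of_real (t i) * (a (cube_index i) x * \<phi> x)" for x by (simp add: a_def e)
      show ?thesis by (simp only: eqc integral_mult_right_zero lam_def e regular_dist_def)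
    qed
    then have "((\<lambda>i. lam (cube_index i) * regular_dist (a (cube_index i)) \<phi>) has_sum regular_dist f \<phi>) UNIV"
      using sum(2)[OF \<phi>] by simp
    then show ?thesis by (subst (asm) has_sum_reindex_bij_betw[OF bij_cube_index])
  qed
  have "atomic_rep p' \<rho> (regular_dist f) lam a"
    unfolding atomic_rep_iff using atom supp lam_sum conv by blast
  moreover have "cmod (lam (cube_index i)) = t i" for i using D(1)[of i] by (simp add: lam_def e)
  ultimately show "\<exists>a lam. atomic_rep p' \<rho> (regular_dist f) lam a \<and> (\<forall>i. cmod (lam (cube_index i)) = t i)"
    by blast
qed

text \<open>A Schwartz function is below a seminorm times \<open>decay\<close>, and
  \<open>cmod (f x)\<close> pairs with \<open>decay\<close>.\<close>

lemma tempered_regular_dist: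
  fixes f :: "real ^ 'n \<Rightarrow> complex"
  assumes f: "f \<in> borel_measurable lebesgue" and bf: "block_fun (\<lambda>x. cmod (f x))"
  shows "regular_dist f \<in> tempered"
proof -
  note [measurable] = f
  obtain S where S: "morrey_bound decay S" using decay_morrey by blast
  obtain t b where b: "block_majorant (\<lambda>x. cmod (f x)) t b" using bf by (auto simp: block_fun_def)
  note int = majorant_imp_atomic_rep(1)[OF f b]
  have nnd: "0 \<le> decay x" for x :: "real ^ 'n" using decay_pos[of x] by simp
  note pair = block_fun_pairing_integrable[OF bf _ norm_ge_zero S decay_measurable nnd]
  have "cmod (regular_dist f \<phi>) \<le> (S * block_norm (\<lambda>x. cmod (f x))) * schwartz_norm schwartz_order \<phi>"
    if \<phi>: "\<phi> \<in> schwartz" for \<phi>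
  proof -
    have K: "0 \<le> schwartz_norm schwartz_order \<phi>"
    proof -
      have "0 \<le> (1 + norm (0 :: real ^ 'n)) ^ schwartz_order * cmod (\<phi> 0)" by simp
      then show ?thesis using schwartz_le_norm[OF \<phi>, of 0 schwartz_order] by linarith
    qed
    have "cmod (regular_dist f \<phi>) \<le> (\<integral>x. norm (f x * \<phi> x) \<partial>lebesgue)"
      unfolding regular_dist_def by (rule integral_norm_bound)
    also have "\<dots> \<le> (\<integral>x. schwartz_norm schwartz_order \<phi> * (cmod (f x) * decay x) \<partial>lebesgue)"
    proof (rule integral_mono)
      show "integrable lebesgue (\<lambda>x. norm (f x * \<phi> x))" using int[OF \<phi>] by (rule integrable_norm)
      show "integrable lebesgue (\<lambda>x. schwartz_norm schwartz_order \<phi> * (cmod (f x) * decay x))"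
        by (intro integrable_mult_right pair(1)) measurable
      show "norm (f x * \<phi> x) \<le> schwartz_norm schwartz_order \<phi> * (cmod (f x) * decay x)" for x
        using mult_left_mono[OF schwartz_le_decay[OF \<phi>, of x], of "cmod (f x)"]
        by (simp add: norm_mult mult_ac)
    qed
    also have "\<dots> = schwartz_norm schwartz_order \<phi> * (\<integral>x. cmod (f x) * decay x \<partial>lebesgue)" by simp
    also have "\<dots> \<le> schwartz_norm schwartz_order \<phi> * (S * block_norm (\<lambda>x. cmod (f x)))"
      by (intro mult_left_mono K pair(2)) measurable
    finally show ?thesis by (simp add: mult.commute)
  qed
  moreover have "regular_dist f (\<lambda>x. \<phi> x + \<psi> x) = regular_dist f \<phi> + regular_dist f \<psi>"
    if "\<phi> \<in> schwartz" "\<psi> \<in> schwartz" for \<phi> \<psi>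
    unfolding regular_dist_def distrib_left using int that by (intro Bochner_Integration.integral_add)
  moreover have "regular_dist f (\<lambda>x. k * \<phi> x) = k * regular_dist f \<phi>" for k \<phi>
    unfolding regular_dist_def by (simp add: mult.left_commute)
  ultimately show ?thesis unfolding tempered_def by blast
qed

lemma predual_morrey_iff:
  fixes f :: "real ^ 'n \<Rightarrow> complex"
  shows "f \<in> predual_morrey p' \<rho> \<longleftrightarrow> f \<in> borel_measurable lebesgue \<and> block_fun (\<lambda>x. cmod (f x))"
proof
  assume "f \<in> predual_morrey p' \<rho>"
  then obtain lam a where "f \<in> borel_measurable lebesgue" "\<And>\<phi>. \<phi> \<in> schwartz \<Longrightarrow> integrable lebesgue (\<lambda>x. f x * \<phi> x)"
    "atomic_rep p' \<rho> (regular_dist f) lam a"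
    by (auto simp: predual_morrey_def predual_dist_def)
  then show "f \<in> borel_measurable lebesgue \<and> block_fun (\<lambda>x. cmod (f x))"
    using atomic_rep_imp_majorant unfolding block_fun_def by blast
next
  assume f: "f \<in> borel_measurable lebesgue \<and> block_fun (\<lambda>x. cmod (f x))"
  then obtain t b where b: "block_majorant (\<lambda>x. cmod (f x)) t b" by (auto simp: block_fun_def)
  have f1: "f \<in> borel_measurable lebesgue" "block_fun (\<lambda>x. cmod (f x))" using f by auto
  show "f \<in> predual_morrey p' \<rho>"
    using majorant_imp_atomic_rep[OF f1(1) b] tempered_regular_dist[OF f1] f1(1)
    unfolding predual_morrey_def predual_dist_def by blast
qed

text \<open>Both conversions preserve the moduli of the coefficients, so the two infima range over
  the same set of sums.\<close>

lemma predual_morrey_norm_eq: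
  fixes f :: "real ^ 'n \<Rightarrow> complex"
  assumes f: "f \<in> predual_morrey p' \<rho>"
  shows "predual_morrey_norm p' \<rho> f = block_norm (\<lambda>x. cmod (f x))"
proof -
  have fm: "f \<in> borel_measurable lebesgue" and int: "\<And>\<phi>. \<phi> \<in> schwartz \<Longrightarrow> integrable lebesgue (\<lambda>x. f x * \<phi> x)"
    using f by (auto simp: predual_morrey_def)
  have lam: "(\<Sum>\<^sub>\<infinity>k. cmod (lam k)) = (\<Sum>i. cmod (lam (cube_index i)))"
    if "(\<lambda>k. cmod (lam k)) summable_on UNIV" for lam :: "int \<times> (int ^ 'n) \<Rightarrow> complex"
  proof -
    have "((\<lambda>i. cmod (lam (cube_index i))) has_sum (\<Sum>\<^sub>\<infinity>k. cmod (lam k))) UNIV"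
      using that by (subst has_sum_reindex_bij_betw[OF bij_cube_index]) simp
    then show ?thesis by (intro sums_unique has_sum_imp_sums)
  qed
  have "{\<Sum>\<^sub>\<infinity>k. cmod (lam k) | lam. \<exists>a. atomic_rep p' \<rho> (regular_dist f) lam a}
      = {suminf t |t. \<exists>b. block_majorant (\<lambda>x. cmod (f x)) t b}"
  proof (intro set_eqI iffI)
    fix s assume "s \<in> {\<Sum>\<^sub>\<infinity>k. cmod (lam k) | lam. \<exists>a. atomic_rep p' \<rho> (regular_dist f) lam a}"
    then obtain lam a where s: "s = (\<Sum>\<^sub>\<infinity>k. cmod (lam k))" and rep: "atomic_rep p' \<rho> (regular_dist f) lam a"
      by blast
    have "s = (\<Sum>i. cmod (lam (cube_index i)))"
      unfolding s by (rule lam) (use rep in \<open>simp add: atomic_rep_def\<close>)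
    then show "s \<in> {suminf t |t. \<exists>b. block_majorant (\<lambda>x. cmod (f x)) t b}"
      using atomic_rep_imp_majorant[OF fm int rep] by blast
  next
    fix s assume "s \<in> {suminf t |t. \<exists>b. block_majorant (\<lambda>x. cmod (f x)) t b}"
    then obtain t b where s: "s = suminf t" and b: "block_majorant (\<lambda>x. cmod (f x)) t b" by blast
    obtain a lam' where rep: "atomic_rep p' \<rho> (regular_dist f) lam' a" and t: "\<And>i. cmod (lam' (cube_index i)) = t i"
      using majorant_imp_atomic_rep(2)[OF fm b] by blast
    have "s = (\<Sum>\<^sub>\<infinity>k. cmod (lam' k))"
      using lam[of lam'] rep by (simp add: s t atomic_rep_def)
    then show "s \<in> {\<Sum>\<^sub>\<infinity>k. cmod (lam k) | lam. \<exists>a. atomic_rep p' \<rho> (regular_dist f) lam a}"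
      using rep by blast
  qed
  then show ?thesis by (simp add: predual_morrey_norm_def predual_dist_norm_def block_norm_def)
qed

end

section \<open>The duality\<close>

context morrey_setting
begin

text \<open>Membership of the single components is the lattice property: each modulus is below the
  \<open>q'\<close>-norm almost everywhere.\<close>

lemma predual_seq_iff:
  fixes f :: "'n fun_seq"
  shows "f \<in> predual_seq p' \<rho> q' \<longleftrightarrow> block_seq f"
proof
  assume "f \<in> predual_seq p' \<rho> q'"
  then show "block_seq f"
    by (auto simp: seq_space_def block_seq_def predual_morrey_iff cmod_lq_fun)
next
  assume f: "block_seq f"
  have m: "f j \<in> borel_measurable lebesgue" for j using f by (rule block_seq_measurable)
  have s: "AE x in lebesgue. summable (\<lambda>j. cmod (f j x) powr q')"
    and bf: "block_fun (\<lambda>x. lq_norm q' (\<lambda>j. f j x))"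
    using f by (auto simp: block_seq_def)
  have "block_fun (\<lambda>x. cmod (f j x))" for j
  proof (rule block_fun_mono[OF bf])
    show "AE x in lebesgue. cmod (f j x) \<le> lq_norm q' (\<lambda>j. f j x)"
      using s by eventually_elim (rule lq_norm_ge, use q' in auto)
  qed
  then show "f \<in> predual_seq p' \<rho> q'"
    using m s bf lq_fun_measurable[OF m, of q']
    by (simp add: seq_space_def predual_morrey_iff cmod_lq_fun)
qed

lemma predual_seq_norm_eq:
  fixes f :: "'n fun_seq"
  assumes "block_seq f"
  shows "predual_seq_norm p' \<rho> q' f = block_seq_norm f"
proof -
  have "lq_fun q' f \<in> predual_morrey p' \<rho>"
    using assms unfolding predual_seq_iff[symmetric] by (simp add: seq_space_def)
  then show ?thesis
    by (simp add: seq_norm_def predual_morrey_norm_eq cmod_lq_fun block_seq_norm_def)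
qed

lemma morrey_seq_imp_bound:
  fixes g :: "'n fun_seq"
  assumes "g \<in> morrey_seq p r q"
  shows "morrey_seq_bound g (morrey_seq_norm p r q g)"
  using assms morrey_imp_bound[of "lq_fun q g"] morrey_imp_bound(1)
  by (auto simp: seq_space_def morrey_seq_bound_def seq_norm_def cmod_lq_fun)

lemma bound_imp_morrey_seq:
  fixes g :: "'n fun_seq"
  assumes g: "morrey_seq_bound g S"
  shows "g \<in> morrey_seq p r q" "morrey_seq_norm p r q g \<le> S"
proof -
  have m: "g j \<in> borel_measurable lebesgue" for j using g by (simp add: morrey_seq_bound_def)
  have s: "AE x in lebesgue. summable (\<lambda>j. cmod (g j x) powr q)"
    and mb: "morrey_bound (\<lambda>x. lq_norm q (\<lambda>j. g j x)) S"
    using g by (auto simp: morrey_seq_bound_def)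
  have "morrey_bound (\<lambda>x. cmod (g j x)) S" for j
    unfolding morrey_bound_def
  proof (intro conjI allI)
    show "0 \<le> S" using mb by (simp add: morrey_bound_def)
    fix i
    have "AE x in lebesgue. cmod (g j x) powr p * indicator (cube i) x \<le> lq_norm q (\<lambda>j. g j x) powr p * indicator (cube i) x"
      using s
    proof eventually_elim
      case (elim x)
      have "cmod (g j x) \<le> lq_norm q (\<lambda>j. g j x)" using lq_norm_ge[OF _ elim] q by simp
      then show ?case using p by (intro mult_right_mono powr_mono2) auto
    qed
    then have "(\<integral>\<^sup>+x. ennreal (cmod (g j x) powr p * indicator (cube i) x) \<partial>lebesgue)
        \<le> (\<integral>\<^sup>+x. ennreal (lq_norm q (\<lambda>j. g j x) powr p * indicator (cube i) x) \<partial>lebesgue)"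
      by (intro nn_integral_mono_AE) (auto elim!: eventually_mono intro: ennreal_leI)
    also have "\<dots> \<le> ennreal ((S / scale i) powr p)" using mb by (simp add: morrey_bound_def)
    finally show "(\<integral>\<^sup>+x. ennreal (cmod (g j x) powr p * indicator (cube i) x) \<partial>lebesgue) \<le> ennreal ((S / scale i) powr p)" .
  qed
  then have gj: "g j \<in> morrey p r" for j using bound_imp_morrey(1)[OF m] by blast
  note L = bound_imp_morrey[OF lq_fun_measurable[OF m], unfolded cmod_lq_fun, OF mb]
  show "g \<in> morrey_seq p r q" using gj s L(1) by (simp add: seq_space_def)
  show "morrey_seq_norm p r q g \<le> S" using L(2) by (simp add: seq_norm_def)
qed

lemma morrey_seq_norm_nonneg:
  fixes g :: "'n fun_seq"
  assumes "g \<in> morrey_seq p r q"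
  shows "0 \<le> morrey_seq_norm p r q g"
  using morrey_seq_imp_bound[OF assms] by (simp add: morrey_seq_bound_def morrey_bound_def)

lemma weighted_seq_embedding:
  "\<exists>C. \<forall>f\<in>weighted_seq p' \<alpha> q'. block_seq (f :: 'n fun_seq) \<and> block_seq_norm f \<le> C * weighted_seq_norm p' \<alpha> q' f"
proof -
  obtain C where C: "\<And>F A. F \<in> borel_measurable lebesgue \<Longrightarrow> (\<And>x. 0 \<le> F x) \<Longrightarrow> 0 \<le> A \<Longrightarrow>
     (\<integral>\<^sup>+x. ennreal ((weight \<alpha> x * F x) powr p') \<partial>lebesgue) \<le> ennreal (A powr p') \<Longrightarrow>
     block_fun F \<and> block_norm F \<le> C * A"
    using weighted_block by meson
  show ?thesis
  proof (intro exI[of _ C] ballI)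
    fix f :: "'n fun_seq" assume f: "f \<in> weighted_seq p' \<alpha> q'"
    have m[measurable]: "f j \<in> borel_measurable lebesgue" for j
      using f weighted_imp_bound(1) by (auto simp: seq_space_def)
    have "lq_fun q' f \<in> weighted_Lp p' \<alpha>" using f by (simp add: seq_space_def)
    note W = weighted_imp_bound[OF this, unfolded cmod_lq_fun]
    have "block_fun (\<lambda>x. lq_norm q' (\<lambda>j. f j x)) \<and>
        block_norm (\<lambda>x. lq_norm q' (\<lambda>j. f j x)) \<le> C * weighted_Lp_norm p' \<alpha> (lq_fun q' f)"
      by (rule C[OF _ lq_norm_nonneg W(2,3)]) measurable
    then show "block_seq f \<and> block_seq_norm f \<le> C * weighted_seq_norm p' \<alpha> q' f"
      using f m by (auto simp: block_seq_def block_seq_norm_def seq_norm_def seq_space_def)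
  qed
qed

text \<open>Puts the test sequences into the weighted space, so that agreement there is enough to
  compare functionals.\<close>

lemma test_seq_weighted:
  fixes f :: "'n fun_seq"
  assumes f: "test_seq m B f"
  shows "f \<in> weighted_seq p' \<alpha> q'"
proof -
  have fm: "f j \<in> borel_measurable lebesgue" for j using f by (simp add: test_seq_def)
  have le: "h \<in> weighted_Lp p' \<alpha>"
    if h: "h \<in> borel_measurable lebesgue" and hK: "\<And>x. cmod (h x) \<le> K * decay x" for h and K :: real
  proof (rule bound_imp_weighted[OF h])
    have "(\<integral>\<^sup>+x. ennreal ((weight \<alpha> x * cmod (h x)) powr p') \<partial>lebesgue)
        \<le> (\<integral>\<^sup>+x. ennreal (\<bar>K\<bar> powr p') * ennreal ((weight \<alpha> x * decay x) powr p') \<partial>lebesgue)"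
    proof (rule nn_integral_mono)
      fix x :: "real ^ 'n"
      have "K * decay x \<le> \<bar>K\<bar> * decay x" using decay_pos[of x] by (intro mult_right_mono) auto
      then have "cmod (h x) \<le> \<bar>K\<bar> * decay x" using hK[of x] by linarith
      then have "weight \<alpha> x * cmod (h x) \<le> weight \<alpha> x * (\<bar>K\<bar> * decay x)"
        using weight_pos[of \<alpha> x] by (intro mult_left_mono) auto
      then have "(weight \<alpha> x * cmod (h x)) powr p' \<le> (\<bar>K\<bar> * (weight \<alpha> x * decay x)) powr p'"
        using p' weight_pos[of \<alpha> x] by (intro powr_mono2) (auto simp: mult_ac)
      also have "\<dots> = \<bar>K\<bar> powr p' * (weight \<alpha> x * decay x) powr p'"
        using weight_pos[of \<alpha> x] decay_pos[of x] by (simp add: powr_mult)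
      finally show "ennreal ((weight \<alpha> x * cmod (h x)) powr p') \<le> ennreal (\<bar>K\<bar> powr p') * ennreal ((weight \<alpha> x * decay x) powr p')"
        by (simp add: ennreal_leI flip: ennreal_mult)
    qed
    also have "\<dots> = ennreal (\<bar>K\<bar> powr p') * (\<integral>\<^sup>+x. ennreal ((weight \<alpha> x * decay x) powr p') \<partial>lebesgue)"
      by (rule nn_integral_cmult) (use weight_lebesgue_measurable decay_measurable in measurable)
    also have "\<dots> < \<infinity>" using weight_decay_finite by (simp add: ennreal_mult_less_top)
    finally show "(\<integral>\<^sup>+x. ennreal ((weight \<alpha> x * cmod (h x)) powr p') \<partial>lebesgue) < \<infinity>" .
  qed
  have "f j \<in> weighted_Lp p' \<alpha>" for j
    by (rule le[OF fm, where K = B]) (use f in \<open>auto simp: test_seq_def\<close>)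
  moreover have "lq_fun q' f \<in> weighted_Lp p' \<alpha>"
    by (rule le[OF lq_fun_measurable[OF fm], where K = "real m powr (1 / q') * \<bar>B\<bar>"])
      (use test_seq_lq_norm(2)[OF f] in \<open>simp add: cmod_lq_fun\<close>)
  ultimately show ?thesis using test_seq_lq_norm(1)[OF f] by (simp add: seq_space_def)
qed

section \<open>Dual space and dual norm\<close>

lemma seq_dual_imp_bounded_functional:
  fixes G :: "'n fun_seq \<Rightarrow> complex"
  assumes "G \<in> seq_dual (predual_seq p' \<rho> q') (predual_seq_norm p' \<rho> q')"
  shows "\<exists>C\<ge>0. bounded_functional G C"
proof -
  obtain C where C: "\<And>f. block_seq f \<Longrightarrow> cmod (G f) \<le> C * block_seq_norm f"
    using assms by (auto simp: seq_dual_def Ball_def predual_seq_iff predual_seq_norm_eq)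
  \<comment> \<open>The definition of the dual admits a negative constant, the representation
    theorem asks for a nonnegative one.\<close>
  have "cmod (G f) \<le> max C 0 * block_seq_norm f" if "block_seq f" for f
  proof -
    have "C * block_seq_norm f \<le> max C 0 * block_seq_norm f"
      using block_seq_norm_nonneg[OF that] by (intro mult_right_mono) auto
    then show ?thesis using C[OF that] by linarith
  qed
  then have "bounded_functional G (max C 0)"
    using assms by (auto simp: seq_dual_def Ball_def predual_seq_iff bounded_functional_def)
  then show ?thesis by (intro exI[of _ "max C 0"]) auto
qed

lemma bounded_functional_imp_seq_dual:
  fixes G :: "'n fun_seq \<Rightarrow> complex"
  assumes "bounded_functional G C"
  shows "G \<in> seq_dual (predual_seq p' \<rho> q') (predual_seq_norm p' \<rho> q')"
  using assms by (auto simp: seq_dual_def Ball_def predual_seq_iff predual_seq_norm_eq bounded_functional_def)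

lemma pairing_eq: "pairing g f = seq_pairing g f"
  by (simp add: pairing_def seq_pairing_def)

lemma pairing_exists_block_seq:
  assumes "morrey_seq_bound g S" "block_seq f"
  shows "pairing_exists g f"
  using morrey_seq_bound_AE_pairing[OF assms(2,1)] seq_pairing_bound(1)[OF assms(2,1)]
  by (auto simp: pairing_exists_def elim!: eventually_mono)

text \<open>One inequality is the pairing estimate. For the other, the supremum \<open>S\<close>
  over the unit ball is shown by testing to be itself a Morrey bound of \<open>g\<close>, and the
  Morrey norm is below every such bound.\<close>

lemma dual_norm_seq_pairing:
  fixes g :: "'n fun_seq"
  assumes g: "g \<in> morrey_seq p r q"
    and G: "\<And>f. block_seq f \<Longrightarrow> G f = seq_pairing g f"
  shows "dual_norm (predual_seq p' \<rho> q') (predual_seq_norm p' \<rho> q') G = morrey_seq_norm p r q g"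
proof -
  define N where "N = morrey_seq_norm p r q g"
  have gN: "morrey_seq_bound g N" unfolding N_def by (rule morrey_seq_imp_bound[OF g])
  have N0: "0 \<le> N" unfolding N_def by (rule morrey_seq_norm_nonneg[OF g])
  define A where "A = {f :: 'n fun_seq. block_seq f \<and> block_seq_norm f \<le> 1}"
  have A: "{f \<in> predual_seq p' \<rho> q'. predual_seq_norm p' \<rho> q' f \<le> 1} = A"
    by (auto simp: A_def predual_seq_iff predual_seq_norm_eq)
  define S where "S = (SUP f\<in>A. cmod (G f))"
  have zero: "(\<lambda>j x. 0) \<in> A" using block_seq_zero by (simp add: A_def)
  have le: "cmod (G f) \<le> N" if f: "f \<in> A" for f
  proof -
    have "cmod (G f) \<le> N * block_seq_norm f"
      using seq_pairing_bound(2)[OF _ gN, of f] f G by (simp add: A_def)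
    also have "\<dots> \<le> N * 1" using f N0 by (intro mult_left_mono) (auto simp: A_def)
    finally show ?thesis by simp
  qed
  have bdd: "bdd_above ((\<lambda>f. cmod (G f)) ` A)" using le by (auto intro!: bdd_aboveI)
  have S_le: "S \<le> N" unfolding S_def by (rule cSUP_least) (use zero le in auto)
  have S_ge: "cmod (G f) \<le> S" if "f \<in> A" for f
    unfolding S_def by (rule cSUP_upper[OF that bdd])
  have S0: "0 \<le> S" using S_ge[OF zero] norm_ge_zero order_trans by blast
  have "morrey_seq_bound g S"
  proof (rule morrey_seq_boundI[OF _ morrey_seq_bound_integrable[OF gN] S0])
    show "g j \<in> borel_measurable lebesgue" for j using gN by (simp add: morrey_seq_bound_def)
    fix m B f assume "test_seq m B f"
    then have f: "block_seq f" by (rule test_seq_block_seq)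
    show "cmod (seq_pairing g f) \<le> S * block_seq_norm f"
    \<comment> \<open>A sequence of norm 0 cannot be scaled to norm 1, but its pairing with
      \<open>g\<close> is 0.\<close>
    proof (cases "block_seq_norm f = 0")
      case True
      then show ?thesis using seq_pairing_bound(2)[OF f gN] by simp
    next
      case False
      define c where "c = block_seq_norm f"
      have c: "0 < c" using False block_seq_norm_nonneg[OF f] by (simp add: c_def)
      have "(\<lambda>j x. of_real (1 / c) * f j x) \<in> A"
        using block_seq_cmult[OF f, of "of_real (1 / c)"] c by (simp add: A_def norm_divide flip: c_def)
      then have "cmod (G (\<lambda>j x. of_real (1 / c) * f j x)) \<le> S" by (rule S_ge)
      moreover have "G (\<lambda>j x. of_real (1 / c) * f j x) = of_real (1 / c) * seq_pairing g f"
        unfolding G[OF block_seq_cmult(1)[OF f]]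
        by (rule bounded_functionalD(2)[OF bounded_functional_seq_pairing[OF gN] f])
      ultimately have "cmod (seq_pairing g f) / c \<le> S" using c by (simp add: norm_mult norm_divide)
      then show ?thesis using c by (simp add: divide_le_eq flip: c_def)
    qed
  qed
  then have "N \<le> S" unfolding N_def by (rule bound_imp_morrey_seq(2))
  then show ?thesis using S_le by (simp add: dual_norm_def A S_def N_def)
qed

section \<open>Both sequence spaces as normed spaces\<close>

lemma seq_pairing_add_left:
  assumes g: "morrey_seq_bound g S" and h: "morrey_seq_bound h S'" and f: "block_seq f"
  shows "seq_pairing (\<lambda>j x. g j x + h j x) f = seq_pairing g f + seq_pairing h f"
proof -
  have [measurable]: "f j \<in> borel_measurable lebesgue" "g j \<in> borel_measurable lebesgue" "h j \<in> borel_measurable lebesgue" for j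
    using f g h by (auto simp: block_seq_def morrey_seq_bound_def)
  have "AE x in lebesgue. (\<Sum>j. (g j x + h j x) * f j x) = (\<Sum>j. g j x * f j x) + (\<Sum>j. h j x * f j x)"
    using morrey_seq_bound_AE_pairing[OF f g] morrey_seq_bound_AE_pairing[OF f h]
    by eventually_elim (auto simp: distrib_right suminf_add)
  then have "seq_pairing (\<lambda>j x. g j x + h j x) f = (\<integral>x. (\<Sum>j. g j x * f j x) + (\<Sum>j. h j x * f j x) \<partial>lebesgue)"
    unfolding seq_pairing_def by (intro integral_cong_AE) measurable
  also have "\<dots> = seq_pairing g f + seq_pairing h f"
    unfolding seq_pairing_def
    by (rule Bochner_Integration.integral_add) (rule seq_pairing_bound(1)[OF f] g h)+
  finally show ?thesis .
qed

lemma seq_pairing_cmult_left: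
  assumes g: "morrey_seq_bound g S" and f: "block_seq f"
  shows "seq_pairing (\<lambda>j x. c * g j x) f = c * seq_pairing g f"
proof -
  have [measurable]: "f j \<in> borel_measurable lebesgue" "g j \<in> borel_measurable lebesgue" for j
    using f g by (auto simp: block_seq_def morrey_seq_bound_def)
  have "AE x in lebesgue. (\<Sum>j. (c * g j x) * f j x) = c * (\<Sum>j. g j x * f j x)"
    using morrey_seq_bound_AE_pairing[OF f g]
    by eventually_elim (auto simp: mult.assoc suminf_mult)
  then have "seq_pairing (\<lambda>j x. c * g j x) f = (\<integral>x. c * (\<Sum>j. g j x * f j x) \<partial>lebesgue)"
    unfolding seq_pairing_def by (intro integral_cong_AE) measurable
  then show ?thesis by (simp add: seq_pairing_def)
qed

text \<open>
  By duality the Morrey norm of a sequence is the norm of the functional it induces, so the norm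
  axioms reduce to those for functionals.
\<close>

lemma morrey_seq_bound_add:
  fixes g h :: "'n fun_seq"
  assumes g: "morrey_seq_bound g S" and h: "morrey_seq_bound h S'"
  shows "morrey_seq_bound (\<lambda>j x. g j x + h j x) (S + S')"
proof (rule morrey_seq_boundI)
  have [measurable]: "g j \<in> borel_measurable lebesgue" "h j \<in> borel_measurable lebesgue" for j
    using g h by (auto simp: morrey_seq_bound_def)
  show "(\<lambda>x. g j x + h j x) \<in> borel_measurable lebesgue" for j by measurable
  show "integrable lebesgue (\<lambda>x. (g j x + h j x) * of_real (decay x))" for j
    unfolding distrib_right
    by (intro Bochner_Integration.integrable_add morrey_seq_bound_integrable[OF g] morrey_seq_bound_integrable[OF h])
  show "0 \<le> S + S'" using g h by (simp add: morrey_seq_bound_def morrey_bound_def)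
  fix m B f assume "test_seq m B f"
  then have f: "block_seq f" by (rule test_seq_block_seq)
  show "cmod (seq_pairing (\<lambda>j x. g j x + h j x) f) \<le> (S + S') * block_seq_norm f"
    unfolding seq_pairing_add_left[OF g h f] distrib_right
    by (intro order_trans[OF norm_triangle_ineq] add_mono seq_pairing_bound(2)[OF f] g h)
qed

lemma morrey_seq_bound_cmult:
  fixes g :: "'n fun_seq"
  assumes g: "morrey_seq_bound g S"
  shows "morrey_seq_bound (\<lambda>j x. c * g j x) (cmod c * S)"
proof (rule morrey_seq_boundI)
  have [measurable]: "g j \<in> borel_measurable lebesgue" for j
    using g by (auto simp: morrey_seq_bound_def)
  show "(\<lambda>x. c * g j x) \<in> borel_measurable lebesgue" for j by measurable
  show "integrable lebesgue (\<lambda>x. c * g j x * of_real (decay x))" for j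
    unfolding mult.assoc by (intro integrable_mult_right morrey_seq_bound_integrable[OF g])
  show "0 \<le> cmod c * S" using g by (simp add: morrey_seq_bound_def morrey_bound_def)
  fix m B f assume "test_seq m B f"
  then have f: "block_seq f" by (rule test_seq_block_seq)
  show "cmod (seq_pairing (\<lambda>j x. c * g j x) f) \<le> cmod c * S * block_seq_norm f"
    unfolding seq_pairing_cmult_left[OF g f] norm_mult mult.assoc
    by (intro mult_left_mono seq_pairing_bound(2)[OF f g]) simp
qed

lemma morrey_seq_bound_AE_zero:
  fixes g :: "'n fun_seq"
  assumes m: "\<And>j. g j \<in> borel_measurable lebesgue" and g: "seq_ae_eq g (\<lambda>j x. 0)"
  shows "morrey_seq_bound g 0"
proof (rule morrey_seq_boundI[OF m])
  have 0: "AE x in lebesgue. g j x = 0" for j using g by (simp add: seq_ae_eq_def)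
  note [measurable] = m
  show "integrable lebesgue (\<lambda>x. g j x * of_real (decay x))" for j
  proof (rule integrable_cong_AE_imp[of _ "\<lambda>x. 0"])
    show "AE x in lebesgue. 0 = g j x * of_real (decay x)" using 0[of j] by eventually_elim simp
  qed (simp, measurable)
  fix k B f assume "test_seq k B f"
  then have f: "block_seq f" by (rule test_seq_block_seq)
  have "AE x in lebesgue. \<forall>j. g j x = 0" unfolding AE_all_countable by (intro allI 0)
  then have "AE x in lebesgue. (\<Sum>j. g j x * f j x) = 0" by eventually_elim simp
  then have "seq_pairing g f = 0" unfolding seq_pairing_def by (rule integral_eq_zero_AE)
  then show "cmod (seq_pairing g f) \<le> 0 * block_seq_norm f" by simp
qed simp

text \<open>Definiteness comes from pairing with the strictly positive \<open>decay\<close>; the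
  other axioms are inherited from the block norm.\<close>

lemma normed_predual_seq:
  "normed_seq_space (predual_seq p' \<rho> q' :: 'n fun_seq set) (predual_seq_norm p' \<rho> q')"
  unfolding normed_seq_space_def predual_seq_iff Ball_def
proof (intro conjI allI impI)
  show "block_seq (\<lambda>j x. 0)" by (rule block_seq_zero(1))
  fix f :: "'n fun_seq" assume f: "block_seq f"
  show "predual_seq_norm p' \<rho> q' f = 0 \<longleftrightarrow> seq_ae_eq f (\<lambda>j x. 0)"
    unfolding predual_seq_norm_eq[OF f]
  proof
    have s: "AE x in lebesgue. summable (\<lambda>j. cmod (f j x) powr q')"
      and bf: "block_fun (\<lambda>x. lq_norm q' (\<lambda>j. f j x))"
      using f by (auto simp: block_seq_def)
    have [measurable]: "f j \<in> borel_measurable lebesgue" for j by (rule block_seq_measurable[OF f])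
    obtain S where S: "morrey_bound decay S" using decay_morrey by blast
    show "seq_ae_eq f (\<lambda>j x. 0)" if "block_seq_norm f = 0"
    proof -
      have "AE x in lebesgue. lq_norm q' (\<lambda>j. f j x) = 0"
        by (rule block_norm_eq_0_imp[OF bf _ _ lq_norm_nonneg S decay_measurable decay_pos])
          (use that in \<open>simp_all add: block_seq_norm_def\<close>)
      then have "AE x in lebesgue. f j x = 0" for j
        using s
      proof eventually_elim
        case (elim x)
        then show ?case using lq_norm_ge[OF _ elim(2), of j] q' by simp
      qed
      then show ?thesis by (simp add: seq_ae_eq_def)
    qed
    assume "seq_ae_eq f (\<lambda>j x. 0)"
    then have "AE x in lebesgue. \<forall>j. f j x = 0" by (simp add: seq_ae_eq_def AE_all_countable)
    then have "AE x in lebesgue. lq_norm q' (\<lambda>j. f j x) = 0"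
      by eventually_elim (simp add: lq_norm_def)
    then show "block_seq_norm f = 0"
      unfolding block_seq_norm_def using block_norm_cong[of _ "\<lambda>x. 0"] block_norm_zero by simp
  qed
  show "block_seq (\<lambda>j x. c * f j x)" for c by (rule block_seq_cmult(1)[OF f])
  show "predual_seq_norm p' \<rho> q' (\<lambda>j x. c * f j x) = cmod c * predual_seq_norm p' \<rho> q' f" for c
    using block_seq_cmult[OF f] predual_seq_norm_eq f by simp
  fix g :: "'n fun_seq" assume g: "block_seq g"
  show "block_seq (\<lambda>j x. f j x + g j x)" by (rule block_seq_add(1)[OF f g])
  show "predual_seq_norm p' \<rho> q' (\<lambda>j x. f j x + g j x) \<le> predual_seq_norm p' \<rho> q' f + predual_seq_norm p' \<rho> q' g"
    using block_seq_add[OF f g] predual_seq_norm_eq f g by simp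
qed

lemma normed_morrey_seq:
  "normed_seq_space (morrey_seq p r q :: 'n fun_seq set) (morrey_seq_norm p r q)"
  unfolding normed_seq_space_def
proof (intro conjI ballI allI)
  have 0: "morrey_seq_bound (\<lambda>j x. 0) 0"
    by (rule morrey_seq_bound_AE_zero) (auto simp: seq_ae_eq_def)
  show "(\<lambda>j x. 0 :: complex) \<in> (morrey_seq p r q :: 'n fun_seq set)" by (rule bound_imp_morrey_seq(1)[OF 0])
  fix f :: "'n fun_seq" assume f: "f \<in> morrey_seq p r q"
  note bf = morrey_seq_imp_bound[OF f]
  show mult: "(\<lambda>j x. c * f j x) \<in> morrey_seq p r q" for c
    by (rule bound_imp_morrey_seq(1)[OF morrey_seq_bound_cmult[OF bf]])
  have le: "morrey_seq_norm p r q (\<lambda>j x. c * f j x) \<le> cmod c * morrey_seq_norm p r q f" for c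
    by (rule bound_imp_morrey_seq(2)[OF morrey_seq_bound_cmult[OF bf]])
  show "morrey_seq_norm p r q (\<lambda>j x. c * f j x) = cmod c * morrey_seq_norm p r q f" for c
  proof (cases "c = 0")
    case True
    then show ?thesis using le[of c] morrey_seq_norm_nonneg[OF mult[of c]] by simp
  next
    case False
    \<comment> \<open>The reverse inequality is obtained by scaling back with
      \<open>inverse c\<close>.\<close>
    have "morrey_seq_norm p r q (\<lambda>j x. inverse c * (c * f j x)) \<le> cmod (inverse c) * morrey_seq_norm p r q (\<lambda>j x. c * f j x)"
      by (rule bound_imp_morrey_seq(2)[OF morrey_seq_bound_cmult[OF morrey_seq_imp_bound[OF mult]]])
    moreover have "(\<lambda>j x. inverse c * (c * f j x)) = f" using False by (simp add: fun_eq_iff)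
    ultimately have "morrey_seq_norm p r q f \<le> inverse (cmod c) * morrey_seq_norm p r q (\<lambda>j x. c * f j x)"
      by (simp add: norm_inverse)
    then have "cmod c * morrey_seq_norm p r q f \<le> cmod c * (inverse (cmod c) * morrey_seq_norm p r q (\<lambda>j x. c * f j x))"
      by (rule mult_left_mono) simp
    also have "\<dots> = morrey_seq_norm p r q (\<lambda>j x. c * f j x)" using False by simp
    finally show ?thesis using le[of c] by (rule antisym[rotated])
  qed
  show "morrey_seq_norm p r q f = 0 \<longleftrightarrow> seq_ae_eq f (\<lambda>j x. 0)"
  proof
    assume "morrey_seq_norm p r q f = 0"
    then have f0: "morrey_seq_bound f 0" using bf by simp
    \<comment> \<open>The bound 0 makes all pairings with test sequences vanish, and these determine
      \<open>f\<close>.\<close>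
    have "seq_pairing f h = seq_pairing (\<lambda>j x. 0) h" if "test_seq m B h" for m B h
      using seq_pairing_bound(2)[OF test_seq_block_seq[OF that] f0]
        seq_pairing_bound(2)[OF test_seq_block_seq[OF that] 0] by simp
    then show "seq_ae_eq f (\<lambda>j x. 0)"
      using morrey_seq_bound_unique[OF f0 0] by (auto simp: seq_ae_eq_def)
  next
    assume "seq_ae_eq f (\<lambda>j x. 0)"
    then have "morrey_seq_bound f 0"
      using bf by (intro morrey_seq_bound_AE_zero) (auto simp: morrey_seq_bound_def)
    then show "morrey_seq_norm p r q f = 0"
      using bound_imp_morrey_seq(2) morrey_seq_norm_nonneg[OF f] by (auto intro: antisym)
  qed
  fix g :: "'n fun_seq" assume g: "g \<in> morrey_seq p r q"
  note add = morrey_seq_bound_add[OF bf morrey_seq_imp_bound[OF g]]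
  show "(\<lambda>j x. f j x + g j x) \<in> morrey_seq p r q"
    "morrey_seq_norm p r q (\<lambda>j x. f j x + g j x) \<le> morrey_seq_norm p r q f + morrey_seq_norm p r q g"
    using bound_imp_morrey_seq[OF add] by auto
qed

text \<open>A formula valid on the weighted space holds in particular on test sequences, and density
  carries it to all block sequences.\<close>

lemma represented_imp_eq:
  fixes g :: "'n fun_seq"
  assumes G: "bounded_functional G C" and g: "morrey_seq_bound g S"
    and rep: "represented_by (weighted_seq p' \<alpha> q') G g" and f: "block_seq f"
  shows "G f = seq_pairing g f"
  by (rule bounded_functional_eqI[OF G bounded_functional_seq_pairing[OF g] _ f])
    (use rep test_seq_weighted in \<open>auto simp: represented_by_def pairing_eq\<close>)

lemma represented_unique:
  fixes g h :: "'n fun_seq"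
  assumes "morrey_seq_bound g S" "morrey_seq_bound h S'"
    and "represented_by (weighted_seq p' \<alpha> q') \<gamma> g" "represented_by (weighted_seq p' \<alpha> q') \<gamma> h"
  shows "seq_ae_eq h g"
  unfolding seq_ae_eq_def
proof
  fix j
  show "AE x in lebesgue. h j x = g j x"
  proof (rule morrey_seq_bound_unique[OF assms(2,1)])
    fix m B f assume "test_seq m B f"
    then have "f \<in> weighted_seq p' \<alpha> q'" by (rule test_seq_weighted)
    then show "seq_pairing h f = seq_pairing g f"
      using assms(3,4) by (simp add: represented_by_def pairing_eq flip: pairing_eq)
  qed
qed

end

text \<open>\<open>\<gamma>\<close> matters on \<open>D\<close> only, since the integral formula
  speaks about \<open>D\<close>; that an element of the dual is determined by its values there is
  the conjunct about \<open>G\<close> and \<open>H\<close>. The last supremum is taken in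
  \<open>ereal\<close>, so that the equation also asserts its finiteness.\<close>

theorem theorem3p1:
  fixes p p' q q' r \<rho> \<alpha> :: real
    and Y X D :: "'n::finite fun_seq set"
    and normY normX normD :: "'n fun_seq \<Rightarrow> real"
  assumes "Y = morrey_seq p r q" and "normY = morrey_seq_norm p r q"
    and "X = predual_seq p' \<rho> q'" and "normX = predual_seq_norm p' \<rho> q'"
    and "D = weighted_seq p' \<alpha> q'" and "normD = weighted_seq_norm p' \<alpha> q'"
  assumes "1 < p" and "- real CARD('n) / p < r" and "r < 0"
    and "r + \<rho> = - real CARD('n)" and "1 < q"
    and "1 / p + 1 / p' = 1" and "1 / q + 1 / q' = 1"
    and "\<alpha> > real CARD('n) / p"
  shows
    "predual_space X normX Y normY \<and>
     (D \<subseteq> X \<and> (\<exists>C. \<forall>f\<in>D. normX f \<le> C * normD f)) \<and>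
     (\<forall>\<gamma>. (\<exists>G\<in>seq_dual X normX. \<forall>f\<in>D. G f = \<gamma> f) \<longleftrightarrow>
          (\<exists>g\<in>Y. represented_by D \<gamma> g \<and> (\<forall>h\<in>Y. represented_by D \<gamma> h \<longrightarrow> seq_ae_eq h g))) \<and>
     (\<forall>G\<in>seq_dual X normX. \<forall>H\<in>seq_dual X normX.
          (\<forall>f\<in>D. G f = H f) \<longrightarrow> (\<forall>f\<in>X. G f = H f)) \<and>
     (\<forall>G\<in>seq_dual X normX. \<forall>g\<in>Y. represented_by D G g \<longrightarrow> dual_norm X normX G = normY g) \<and>
     (\<forall>g\<in>Y. (\<forall>f\<in>X. pairing_exists g f) \<and>
        ereal (normY g) = (SUP f \<in> {f \<in> X. normX f \<le> 1}. ereal (cmod (pairing g f))))"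
proof -
  interpret morrey_setting p p' q q' r \<rho> \<alpha> "TYPE('n)"
    by unfold_locales (use assms in auto)
  have X: "f \<in> X \<longleftrightarrow> block_seq f" for f by (simp add: assms(3) predual_seq_iff)
  have Yb: "morrey_seq_bound g (normY g)" if "g \<in> Y" for g
    using that morrey_seq_imp_bound by (simp add: assms(1,2))
  have bY: "g \<in> Y" if "morrey_seq_bound g S" for g S
    using bound_imp_morrey_seq(1)[OF that] by (simp add: assms(1))
  have dual: "\<exists>C\<ge>0. bounded_functional G C" if "G \<in> seq_dual X normX" for G
    using seq_dual_imp_bounded_functional that by (simp add: assms(3,4))
  have in_dual: "seq_pairing g \<in> seq_dual X normX" if "g \<in> Y" for g
    using bounded_functional_imp_seq_dual[OF bounded_functional_seq_pairing[OF Yb[OF that]]]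
    by (simp add: assms(3,4))
  have norm: "dual_norm X normX G = normY g" if "g \<in> Y" "\<And>f. f \<in> X \<Longrightarrow> G f = seq_pairing g f" for g G
    using dual_norm_seq_pairing[of g G] that by (simp add: assms(1-4) predual_seq_iff)
  have repr: "\<exists>g\<in>Y. \<forall>f\<in>X. G f = seq_pairing g f" if G: "G \<in> seq_dual X normX" for G
  proof -
    obtain C where C: "0 \<le> C" "bounded_functional G C" using dual[OF G] by blast
    obtain g where g: "morrey_seq_bound g C" "\<And>f. block_seq f \<Longrightarrow> G f = seq_pairing g f"
      using bounded_functional_representation[OF C(2,1)] by blast
    then show ?thesis using bY[OF g(1)] by (intro bexI[of _ g]) (simp_all add: X)
  qed
  have DX: "D \<subseteq> X" and DC: "\<exists>C. \<forall>f\<in>D. normX f \<le> C * normD f"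
  proof -
    obtain C where C: "\<And>f. f \<in> D \<Longrightarrow> block_seq f \<and> block_seq_norm f \<le> C * normD f"
      using weighted_seq_embedding unfolding assms(5,6) by blast
    show "D \<subseteq> X" using C X by blast
    have "normX f \<le> C * normD f" if "f \<in> D" for f
      using C[OF that] predual_seq_norm_eq[of f] by (simp add: assms(4))
    then show "\<exists>C. \<forall>f\<in>D. normX f \<le> C * normD f" by blast
  qed
  have testD: "f \<in> D" if "test_seq m B f" for m B f
    using test_seq_weighted[OF that] by (simp add: assms(5))
  have exists: "pairing_exists g f" if "g \<in> Y" "f \<in> X" for g f
    using pairing_exists_block_seq[OF Yb[OF that(1)]] that(2) by (simp add: X)
  have repD: "represented_by D \<gamma> g" if "g \<in> Y" "\<And>f. f \<in> D \<Longrightarrow> \<gamma> f = seq_pairing g f" for \<gamma> g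
    using that exists DX by (auto simp: represented_by_def pairing_eq)
  have uniq: "seq_ae_eq h g" if "g \<in> Y" "h \<in> Y" "represented_by D \<gamma> g" "represented_by D \<gamma> h" for g h \<gamma>
    using represented_unique[OF Yb[OF that(1)] Yb[OF that(2)]] that(3,4) by (simp add: assms(5))
  have ps: "predual_space X normX Y normY"
    unfolding predual_space_def
  \<comment> \<open>The isometry sends \<open>y\<close> to the pairing with \<open>y\<close>;
    without complex conjugation it is linear.\<close>
  proof (intro conjI exI[of _ seq_pairing] ballI allI)
    show "normed_seq_space X normX" using normed_predual_seq by (simp add: assms(3,4))
    show "normed_seq_space Y normY" using normed_morrey_seq by (simp add: assms(1,2))
    show "seq_pairing y \<in> seq_dual X normX" "dual_norm X normX (seq_pairing y) = normY y" if "y \<in> Y" for y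
      using in_dual[OF that] norm[OF that] by auto
    show "seq_pairing (\<lambda>j x. y j x + z j x) f = seq_pairing y f + seq_pairing z f"
      if "y \<in> Y" "z \<in> Y" "f \<in> X" for y z f
      using seq_pairing_add_left[OF Yb[OF that(1)] Yb[OF that(2)]] that(3) by (simp add: X)
    show "seq_pairing (\<lambda>j x. c * y j x) f = c * seq_pairing y f" if "y \<in> Y" "f \<in> X" for c y f
      using seq_pairing_cmult_left[OF Yb[OF that(1)]] that(2) by (simp add: X)
    show "\<exists>y\<in>Y. \<forall>f\<in>X. seq_pairing y f = G f" if "G \<in> seq_dual X normX" for G
      using repr[OF that] by (metis (no_types))
  qed
  have eqv: "(\<exists>G\<in>seq_dual X normX. \<forall>f\<in>D. G f = \<gamma> f) \<longleftrightarrow>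
      (\<exists>g\<in>Y. represented_by D \<gamma> g \<and> (\<forall>h\<in>Y. represented_by D \<gamma> h \<longrightarrow> seq_ae_eq h g))" for \<gamma>
  proof
    assume "\<exists>G\<in>seq_dual X normX. \<forall>f\<in>D. G f = \<gamma> f"
    then obtain G where G: "G \<in> seq_dual X normX" "\<And>f. f \<in> D \<Longrightarrow> G f = \<gamma> f" by blast
    obtain g where g: "g \<in> Y" "\<And>f. f \<in> X \<Longrightarrow> G f = seq_pairing g f" using repr[OF G(1)] by blast
    have "represented_by D \<gamma> g" by (rule repD[OF g(1)]) (use G(2) g(2) DX in \<open>metis subsetD\<close>)
    then show "\<exists>g\<in>Y. represented_by D \<gamma> g \<and> (\<forall>h\<in>Y. represented_by D \<gamma> h \<longrightarrow> seq_ae_eq h g)"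
      using g(1) uniq by blast
  next
    assume "\<exists>g\<in>Y. represented_by D \<gamma> g \<and> (\<forall>h\<in>Y. represented_by D \<gamma> h \<longrightarrow> seq_ae_eq h g)"
    then obtain g where g: "g \<in> Y" "represented_by D \<gamma> g" by blast
    \<comment> \<open>The extension of \<open>\<gamma>\<close> is the pairing with \<open>g\<close>
      on all of \<open>X\<close>.\<close>
    then show "\<exists>G\<in>seq_dual X normX. \<forall>f\<in>D. G f = \<gamma> f"
      by (intro bexI[OF _ in_dual[OF g(1)]]) (auto simp: represented_by_def pairing_eq)
  qed
  \<comment> \<open>Test sequences lie in \<open>D\<close>, so agreement on \<open>D\<close> is
    agreement on a dense set.\<close>
  have dens: "G f = H f"
    if GH: "G \<in> seq_dual X normX" "H \<in> seq_dual X normX" and eq: "\<And>f. f \<in> D \<Longrightarrow> G f = H f" and f: "f \<in> X" for G H f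
  proof -
    obtain C C' where "bounded_functional G C" "bounded_functional H C'" using dual GH by blast
    then show ?thesis by (rule bounded_functional_eqI) (use eq testD f X in auto)
  qed
  have dn: "dual_norm X normX G = normY g" if G: "G \<in> seq_dual X normX" and g: "g \<in> Y" and rep: "represented_by D G g" for G g
  proof (rule norm[OF g])
    fix f assume "f \<in> X"
    obtain C where "bounded_functional G C" using dual[OF G] by blast
    then show "G f = seq_pairing g f"
      using represented_imp_eq[OF _ Yb[OF g]] rep \<open>f \<in> X\<close> by (simp add: assms(5) X)
  qed
  have sup: "ereal (normY g) = (SUP f \<in> {f \<in> X. normX f \<le> 1}. ereal (cmod (pairing g f)))" if g: "g \<in> Y" for g
  proof -
    define A where "A = {f \<in> X. normX f \<le> 1}"
    have zero: "(\<lambda>j x. 0) \<in> A"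
      using block_seq_zero predual_seq_norm_eq[OF block_seq_zero(1)] by (simp add: A_def X assms(4))
    have le: "cmod (pairing g f) \<le> normY g" if f: "f \<in> A" for f
    proof -
      have bf: "block_seq f" "block_seq_norm f \<le> 1"
        using f predual_seq_norm_eq[of f] by (auto simp: A_def X assms(4))
      have N0: "0 \<le> normY g" using Yb[OF g] by (simp add: morrey_seq_bound_def morrey_bound_def)
      have "cmod (pairing g f) \<le> normY g * block_seq_norm f"
        unfolding pairing_eq by (rule seq_pairing_bound(2)[OF bf(1) Yb[OF g]])
      also have "\<dots> \<le> normY g * 1" using bf N0 by (intro mult_left_mono) auto
      finally show ?thesis by simp
    qed
    \<comment> \<open>This is the norm identity for the functional
      \<open>seq_pairing g\<close>.\<close>
    have "normY g = (SUP f\<in>A. cmod (pairing g f))"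
      using norm[OF g, of "seq_pairing g"] by (simp add: dual_norm_def A_def pairing_eq)
    moreover have "ereal (SUP f\<in>A. cmod (pairing g f)) = (SUP f\<in>A. ereal (cmod (pairing g f)))"
    \<comment> \<open>The real and the extended supremum agree once the latter is finite; the zero
      sequence in \<open>A\<close> bounds it from below.\<close>
    proof (rule ereal_SUP)
      have "(SUP f\<in>A. ereal (cmod (pairing g f))) \<le> ereal (normY g)"
        by (rule SUP_least) (use le in simp)
      moreover have "0 \<le> (SUP f\<in>A. ereal (cmod (pairing g f)))"
        by (rule SUP_upper2[OF zero]) simp
      ultimately show "\<bar>SUP f\<in>A. ereal (cmod (pairing g f))\<bar> \<noteq> \<infinity>"
        by (cases "SUP f\<in>A. ereal (cmod (pairing g f))") auto
    qed
    ultimately show ?thesis by (simp add: A_def)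
  qed
  show ?thesis
    by (intro conjI allI ballI impI ps DX DC eqv exists sup) (rule dens dn; blast)+
qed

end
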